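(* Let $n\geq3$ and let $S_n$ act on $V=\mathbb{C}^n$ by the natural permutation representation $\sigma e_i=e_{\sigma(i)}$. For $a,b,c\in\mathbb{C}$ and $1\leq i<j\leq n$ let $$\kappa^L(e_i,e_j)=\sum_{k\neq i,j}\big(a\,e_{\{i,j,k\}}+b\,e^{\perp}_{\{i,j,k\}}\big)\otimes\big((ijk)-(kji)\big),$$ $$\kappa^C(e_i,e_j)=c\sum_{k\neq i,j}\big((ijk)-(kji)\big)+(a-b)^2\Big(\sum_{\substack{\sigma\text{ a }5\text{-cycle}\\ \sigma^2(i)=j}}2(\sigma-\sigma^{-1})-\sum_{\substack{\sigma\text{ a }5\text{-cycle}\\ \sigma(i)=j}}(\sigma-\sigma^{-1})\Big).$$ Then $$\mathcal{H}_{\kappa,t}=T(V)\#S_n[t]\big/\langle e_ie_j-e_je_i-\kappa^L(e_i,e_j)t-\kappa^C(e_i,e_j)t^2\mid 1\leq i<j\leq n\rangle$$ is a Drinfeld orbifold algebra over $\mathbb{C}[t]$. Further, the algebras $\mathcal{H}_{\kappa,1}$ are precisely the Drinfeld orbifold algebras $\mathcal H_\kappa$ for this action such that $\operatorname{im}\kappa^L_g\subseteq V^g$ for each $g\in S_n$ and $\kappa^L$ is supported only off the identity.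
   Context: Notation: $e_1,\dots,e_n$ is the standard basis; for $I\subseteq\{1,\dots,n\}$, $e_I=\sum_{i\in I}e_i$ and $e_I^\perp=e_{\{1,\dots,n\}}-e_I$; $(ijk)$ denotes a 3-cycle; $V^g$ is the fixed-point space of $g$. The maps $\kappa^L,\kappa^C$ are extended to alternating bilinear maps on $V$. For a finite group $G$ acting linearly on $V$, the skew group algebra $R\#G$ ($R=T(V)$ or $S(V)$) is $R\otimes\mathbb{C}G$ with $(r\otimes g)(s\otimes h)=r(g\cdot s)\otimes gh$. A linear (resp. constant) $2$-cochain is $\alpha=\sum_g\alpha_g g$ with $\alpha_g:\bigwedge^2V\to V$ (resp. $\to\mathbb{C}$); $\alpha(v,w)=\sum_g\alpha_g(v,w)\otimes g$; its support is $\{g:\alpha_g\ne0\}$. For $\kappa=\kappa^L+\kappa^C$, $\mathcal{H}_\kappa=T(V)\#G/\langle vw-wv-\kappa^L(v,w)-\kappa^C(v,w)\mid v,w\in V\rangle$, filtered with $V$ in degree one and $G$ in degree zero; it is a Drinfeld orbifold algebra if its associated graded algebra is isomorphic to $S(V)\#G$. When $\mathcal{H}_\kappa$ is a Drinfeld orbifold algebra, $\mathcal{H}_{\kappa,t}=T(V)\#G[t]/\langle vw-wv-\kappa^L(v,w)t-\kappa^C(v,w)t^2\rangle$ is called a Drinfeld orbifold algebra over $\mathbb{C}[t]$. *)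

theory Defs
  imports Complex_Main "HOL-Combinatorics.Cycles"
begin

text \<open>The symmetric group S_n, realised as permutations of {0..n-1}
  (indices shifted by one). Group product is composition g o h.\<close>
definition Sym :: "nat \<Rightarrow> (nat \<Rightarrow> nat) set" where
  "Sym n = {p. p permutes {..<n}}"

text \<open>sigma is a k-cycle in S_n (cycle_of_list [x1,...,xk] maps x1 to x2 to ... to xk to x1).\<close>
definition is_kcycle :: "nat \<Rightarrow> nat \<Rightarrow> (nat \<Rightarrow> nat) \<Rightarrow> bool" where
  "is_kcycle n k \<sigma> \<longleftrightarrow> (\<exists>xs. length xs = k \<and> distinct xs \<and> set xs \<subseteq> {..<n} \<and> \<sigma> = cycle_of_list xs)"

definition cyc3 :: "nat \<Rightarrow> nat \<Rightarrow> nat \<Rightarrow> (nat \<Rightarrow> nat)" where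
  "cyc3 i j k = cycle_of_list [i, j, k]"

text \<open>Elements of T(V)#S_n, V = C^n: finitely supported complex functions on the basis
  of pairs (w, g), where w is a word in e_0..e_(n-1) (the tensor e_w1 ... e_wm) and g in S_n
  (the element e_w tensor g).\<close>
type_synonym basis = "nat list \<times> (nat \<Rightarrow> nat)"
type_synonym elt = "basis \<Rightarrow> complex"

definition supp :: "elt \<Rightarrow> basis set" where
  "supp f = {x. f x \<noteq> 0}"

definition valid_basis :: "nat \<Rightarrow> basis \<Rightarrow> bool" where
  "valid_basis n x \<longleftrightarrow> set (fst x) \<subseteq> {..<n} \<and> snd x \<in> Sym n"

definition bv :: "nat list \<Rightarrow> (nat \<Rightarrow> nat) \<Rightarrow> elt" where
  "bv w g = (\<lambda>x. if x = (w, g) then 1 else 0)"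

text \<open>Product of basis elements: (e_u tensor g)(e_v tensor h) = e_u (g . e_v) tensor gh, with
  g . e_v = e_(map g v) since sigma e_i = e_(sigma i).\<close>
definition bmult :: "basis \<Rightarrow> basis \<Rightarrow> basis" where
  "bmult x y = (fst x @ map (snd x) (fst y), snd x \<circ> snd y)"

definition emult :: "elt \<Rightarrow> elt \<Rightarrow> elt" (infixl "\<star>" 70) where
  "emult f h = (\<lambda>z. \<Sum>x\<in>supp f. \<Sum>y\<in>supp h. if bmult x y = z then f x * h y else 0)"

definition cspan :: "elt set \<Rightarrow> elt set" where
  "cspan S = {f. \<exists>F c. finite F \<and> F \<subseteq> S \<and> f = (\<lambda>z. \<Sum>v\<in>F. c v * v z)}"

definition ideal_gen :: "nat \<Rightarrow> elt set \<Rightarrow> elt set" where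
  "ideal_gen n R = cspan {bv (fst x) (snd x) \<star> r \<star> bv (fst y) (snd y) | x y r.
      valid_basis n x \<and> valid_basis n y \<and> r \<in> R}"

definition fdeg :: "elt \<Rightarrow> nat" where
  "fdeg f = Max {length (fst x) | x. f x \<noteq> 0}"

definition top :: "elt \<Rightarrow> elt" where
  "top f = (\<lambda>x. if length (fst x) = fdeg f then f x else 0)"

text \<open>A linear 2-cochain kL: kL g i j = vector kappa^L_g(e_i,e_j) (as coordinate function k to C);
  a constant one kC: kC g i j = kappa^C_g(e_i,e_j); only i < j < n, g in S_n matter.
  The defining relation e_i e_j - e_j e_i - kappa^L(e_i,e_j) - kappa^C(e_i,e_j).\<close>
definition rel :: "nat \<Rightarrow> ((nat \<Rightarrow> nat) \<Rightarrow> nat \<Rightarrow> nat \<Rightarrow> nat \<Rightarrow> complex)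
    \<Rightarrow> ((nat \<Rightarrow> nat) \<Rightarrow> nat \<Rightarrow> nat \<Rightarrow> complex) \<Rightarrow> nat \<Rightarrow> nat \<Rightarrow> elt" where
  "rel n kL kC i j = (\<lambda>z. bv [i, j] id z - bv [j, i] id z
      - (\<Sum>g\<in>Sym n. \<Sum>k<n. kL g i j k * bv [k] g z)
      - (\<Sum>g\<in>Sym n. kC g i j * bv [] g z))"

definition rel_ideal :: "nat \<Rightarrow> ((nat \<Rightarrow> nat) \<Rightarrow> nat \<Rightarrow> nat \<Rightarrow> nat \<Rightarrow> complex)
    \<Rightarrow> ((nat \<Rightarrow> nat) \<Rightarrow> nat \<Rightarrow> nat \<Rightarrow> complex) \<Rightarrow> elt set" where
  "rel_ideal n kL kC = ideal_gen n {rel n kL kC i j | i j. i < j \<and> j < n}"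

text \<open>The kernel of T(V)#G to S(V)#G.\<close>
definition comm_ideal :: "nat \<Rightarrow> elt set" where
  "comm_ideal n = ideal_gen n {(\<lambda>z. bv [i, j] id z - bv [j, i] id z) | i j. i < j \<and> j < n}"

text \<open>H_kappa is a Drinfeld orbifold algebra: its associated graded algebra
  gr(T(V)#G / I) = T(V)#G / gr I, with gr I spanned by top components of elements of I,
  equals S(V)#G = T(V)#G / (vw - wv).\<close>
definition DOA :: "nat \<Rightarrow> ((nat \<Rightarrow> nat) \<Rightarrow> nat \<Rightarrow> nat \<Rightarrow> nat \<Rightarrow> complex)
    \<Rightarrow> ((nat \<Rightarrow> nat) \<Rightarrow> nat \<Rightarrow> nat \<Rightarrow> complex) \<Rightarrow> bool" where
  "DOA n kL kC \<longleftrightarrow> cspan (top ` rel_ideal n kL kC) = comm_ideal n"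

definition ind :: "(nat \<Rightarrow> nat) \<Rightarrow> (nat \<Rightarrow> nat) \<Rightarrow> complex" where
  "ind g h = (if g = h then 1 else 0)"

text \<open>The family of the theorem (coefficient of e_k tensor g in kappa^L(e_i,e_j)).\<close>
definition kapL :: "nat \<Rightarrow> complex \<Rightarrow> complex \<Rightarrow> (nat \<Rightarrow> nat) \<Rightarrow> nat \<Rightarrow> nat \<Rightarrow> nat \<Rightarrow> complex" where
  "kapL n a b g i j k = (\<Sum>k'\<in>{..<n} - {i, j}.
      (if k \<in> {i, j, k'} then a else b) * (ind g (cyc3 i j k') - ind g (cyc3 k' j i)))"

definition kapC :: "nat \<Rightarrow> complex \<Rightarrow> complex \<Rightarrow> complex \<Rightarrow> (nat \<Rightarrow> nat) \<Rightarrow> nat \<Rightarrow> nat \<Rightarrow> complex" where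
  "kapC n a b c g i j =
     c * (\<Sum>k'\<in>{..<n} - {i, j}. ind g (cyc3 i j k') - ind g (cyc3 k' j i))
     + (a - b)^2 * ((\<Sum>\<sigma>\<in>{\<sigma>\<in>Sym n. is_kcycle n 5 \<sigma> \<and> \<sigma> (\<sigma> i) = j}. 2 * (ind g \<sigma> - ind g (inv \<sigma>)))
                   - (\<Sum>\<sigma>\<in>{\<sigma>\<in>Sym n. is_kcycle n 5 \<sigma> \<and> \<sigma> i = j}. ind g \<sigma> - ind g (inv \<sigma>)))"

definition fixed_image :: "nat \<Rightarrow> ((nat \<Rightarrow> nat) \<Rightarrow> nat \<Rightarrow> nat \<Rightarrow> nat \<Rightarrow> complex) \<Rightarrow> bool" where
  "fixed_image n kL \<longleftrightarrow> (\<forall>g\<in>Sym n. \<forall>i j. i < j \<and> j < n \<longrightarrow> (\<forall>k<n. kL g i j (g k) = kL g i j k))"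

definition off_identity :: "nat \<Rightarrow> ((nat \<Rightarrow> nat) \<Rightarrow> nat \<Rightarrow> nat \<Rightarrow> nat \<Rightarrow> complex) \<Rightarrow> bool" where
  "off_identity n kL \<longleftrightarrow> (\<forall>i j k. i < j \<and> j < n \<and> k < n \<longrightarrow> kL id i j k = 0)"

end

theory Submission
  imports Defs
begin

text \<open>
  Write \<open>\<kappa>\<close> for the antisymmetric extension of the two cochains. Moving the group elements to the
  right turns the relations into the rewriting rules
  \<open>u e\<^sub>i e\<^sub>j v g \<rightarrow> u e\<^sub>j e\<^sub>i v g + u \<kappa>(e\<^sub>i,e\<^sub>j) v g\<close> for \<open>i > j\<close>. By the diamond lemma the PBW property
  is equivalent to invariance of \<open>\<kappa>\<close> together with the Jacobi identity
  \<open>\<Sum> [\<kappa>(e\<^sub>i,e\<^sub>j), e\<^sub>k] = 0\<close>, which splits by degree into the conditions \<open>Q1\<close> (quadratic part is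
  antisymmetric), \<open>Q2\<close> (linear part) and \<open>Q3\<close> (constant part).

  For the family of the theorem only pairs of 3-cycles whose product is a 5-cycle contribute to
  \<open>Q2\<close>, and a 5-cycle has exactly five factorisations into 3-cycles, so \<open>Q2\<close> is a finite check. The
  condition \<open>Q3\<close> comes for free from a representation: with \<open>d = a - b\<close> the elements
  \<open>X\<^sub>i = z + d T\<^sub>i\<close> of the group algebra, where \<open>T\<^sub>i\<close> is the sum of all 3-cycles moving \<open>i\<close> and \<open>z\<close> is a
  suitable scalar, satisfy the defining relations for \<open>b = 0\<close>; the Jacobi identity for the \<open>X\<^sub>i\<close> then kills
  the constant obstruction.

  Conversely \<open>Q1\<close>, together with the image of \<open>\<kappa>\<^sup>L\<^sub>g\<close> being fixed by \<open>g\<close>, forces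
  \<open>\<Sum> \<kappa>\<^sup>L\<^sub>g(e\<^sub>i,e\<^sub>j)(e\<^sub>k - g e\<^sub>k) = 0\<close>, so \<open>g\<close> moves at most four points; invariance rules out
  transpositions and double transpositions. By \<open>Q2\<close> the difference of two admissible \<open>\<kappa>\<^sup>C\<close> for the same
  \<open>\<kappa>\<^sup>L\<close> satisfies the same equation, whence the single parameter \<open>c\<close>.
\<close>

section \<open>Symmetric groups and the Jacobi identity for cochains\<close>

text \<open>Obstructions are evaluated against functionals \<open>P\<close> on words and group
  elements. One formula for \<open>2 * Jac P\<close> thus serves three times: built from the normal
  form coefficients \<open>N z\<close> it closes the overlaps of the diamond lemma, with the
  coordinate functions \<open>bv\<close> it turns the Drinfeld property into equations, and with a
  coefficient of the map \<open>e_m\<close> to \<open>X_m\<close> it yields \<open>Q3\<close>.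
  Checking \<open>Q3\<close> directly would mean working through the products of 3-cycles with
  3-cycles and 5-cycles. The representation replaces this by the commutators of the
  \<open>T_i\<close>, where the 3-cycle coefficient is a universal constant that need not be known:
  conjugation and inversion show that it multiplies \<open>om\<close>, and the scalar
  \<open>z\<close> absorbs it. Since \<open>z\<close> enters through \<open>3 * d * z\<close>, this
  needs \<open>d\<close> nonzero. Restricting to \<open>b = 0\<close> is harmless because the
  all-ones vector lies in the radical of every constant form, and for \<open>d = 0\<close> nothing
  then remains of the linear part. For the converse, the symmetrised \<open>Q1\<close> contains the
  desired vector equation plus a second, unwanted half; summing over the powers of \<open>g\<close>
  removes that half.\<close>

lemma finite_Sym [simp]: "finite (Sym n)"
  by (simp add: Sym_def finite_permutations)

lemma Sym_id [simp]: "id \<in> Sym n"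
  by (simp add: Sym_def permutes_id)

lemma Sym_comp [simp]: "g \<in> Sym n \<Longrightarrow> h \<in> Sym n \<Longrightarrow> g \<circ> h \<in> Sym n"
  by (simp add: Sym_def permutes_compose)

lemma Sym_inv [simp]: "g \<in> Sym n \<Longrightarrow> inv g \<in> Sym n"
  by (simp add: Sym_def permutes_inv)

lemma Sym_bij: "g \<in> Sym n \<Longrightarrow> bij g"
  by (simp add: Sym_def permutes_bij)

lemma Sym_less_iff [simp]: "g \<in> Sym n \<Longrightarrow> g x < n \<longleftrightarrow> x < n"
  using permutes_in_image[of g "{..<n}" x] by (simp add: Sym_def)

lemma Sym_inv_apply [simp]: "g \<in> Sym n \<Longrightarrow> inv g (g x) = x" "g \<in> Sym n \<Longrightarrow> g (inv g x) = x"
  by (auto simp: Sym_def permutes_inverses)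

lemma Sym_eq_iff [simp]: "g \<in> Sym n \<Longrightarrow> g x = g y \<longleftrightarrow> x = y"
  by (metis Sym_inv_apply(1))

lemma Sym_inv_comp [simp]: "g \<in> Sym n \<Longrightarrow> inv g \<circ> g = id" "g \<in> Sym n \<Longrightarrow> g \<circ> inv g = id"
  by (auto simp: fun_eq_iff)

lemma Sym_inv_inv [simp]: "g \<in> Sym n \<Longrightarrow> inv (inv g) = g"
  by (simp add: Sym_bij inv_inv_eq)

lemma Sym_inv_eq_iff: "g \<in> Sym n \<Longrightarrow> inv g x = y \<longleftrightarrow> x = g y"
  by auto

lemma sum_Sym_right:
  assumes "p \<in> Sym n"
  shows "(\<Sum>h\<in>Sym n. F h) = (\<Sum>h\<in>Sym n. F (h \<circ> p))"
  by (rule sum.reindex_bij_witness[of _ "\<lambda>h. h \<circ> p" "\<lambda>h. h \<circ> inv p"])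
     (use assms in \<open>auto simp: comp_assoc\<close>)

lemma sum_Sym_left:
  assumes "p \<in> Sym n"
  shows "(\<Sum>h\<in>Sym n. F h) = (\<Sum>h\<in>Sym n. F (p \<circ> h))"
  by (rule sum.reindex_bij_witness[of _ "\<lambda>h. p \<circ> h" "\<lambda>h. inv p \<circ> h"])
     (use assms in \<open>auto simp: comp_assoc[symmetric]\<close>)

lemma sum_Sym_conj:
  assumes "p \<in> Sym n"
  shows "(\<Sum>h\<in>Sym n. F h) = (\<Sum>h\<in>Sym n. F (p \<circ> h \<circ> inv p))"
proof -
  have "(\<Sum>h\<in>Sym n. F h) = (\<Sum>h\<in>Sym n. F (p \<circ> h))"
    by (rule sum_Sym_left[OF assms])
  also have "\<dots> = (\<Sum>h\<in>Sym n. F (p \<circ> (h \<circ> inv p)))"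
    by (rule sum_Sym_right) (use assms in simp)
  finally show ?thesis by (simp add: comp_assoc)
qed

lemma sum_Sym_inv: "(\<Sum>h\<in>Sym n. F h) = (\<Sum>h\<in>Sym n. F (inv h))"
  by (rule sum.reindex_bij_witness[of _ inv inv]) auto

lemma sum_lessThan_Sym:
  assumes "p \<in> Sym n"
  shows "(\<Sum>k<n. F k) = (\<Sum>k<n. F (p k))"
  by (rule sum.reindex_bij_witness[of _ p "inv p"]) (use assms in auto)

lemma sum_Sym_product:
  "(\<Sum>h\<in>Sym n. \<Sum>g\<in>Sym n. F g h) = (\<Sum>f\<in>Sym n. \<Sum>h\<in>Sym n. F (f \<circ> inv h) h)"
proof -
  have "(\<Sum>g\<in>Sym n. F g h) = (\<Sum>f\<in>Sym n. F (f \<circ> inv h) h)" if "h \<in> Sym n" for h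
    by (rule sum_Sym_right) (use that in simp)
  then have "(\<Sum>h\<in>Sym n. \<Sum>g\<in>Sym n. F g h) = (\<Sum>h\<in>Sym n. \<Sum>f\<in>Sym n. F (f \<circ> inv h) h)"
    by simp
  also have "\<dots> = (\<Sum>f\<in>Sym n. \<Sum>h\<in>Sym n. F (f \<circ> inv h) h)"
    by (rule sum.swap)
  finally show ?thesis .
qed

abbreviation cyc :: "(nat \<Rightarrow> nat \<Rightarrow> nat \<Rightarrow> 'a::plus) \<Rightarrow> nat \<Rightarrow> nat \<Rightarrow> nat \<Rightarrow> 'a" where
  "cyc F i j k \<equiv> F i j k + F j k i + F k i j"

locale cochain =
  fixes n :: nat
    and KL :: "(nat \<Rightarrow> nat) \<Rightarrow> nat \<Rightarrow> nat \<Rightarrow> nat \<Rightarrow> complex"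
    and KC :: "(nat \<Rightarrow> nat) \<Rightarrow> nat \<Rightarrow> nat \<Rightarrow> complex"
  assumes KL_alt: "KL g j i k = - KL g i j k"
    and KC_alt: "KC g j i = - KC g i j"
begin

text \<open>A functional \<open>P\<close> on the skew group algebra is given by its values on the basis;
  \<open>Kap P u i j v g\<close> is its value on \<open>e\<^sub>u \<kappa>(e\<^sub>i,e\<^sub>j) e\<^sub>v g\<close>.\<close>

definition Kap :: "(nat list \<Rightarrow> (nat \<Rightarrow> nat) \<Rightarrow> complex) \<Rightarrow> nat list \<Rightarrow> nat \<Rightarrow> nat \<Rightarrow> nat list
    \<Rightarrow> (nat \<Rightarrow> nat) \<Rightarrow> complex" where
  "Kap P u i j v g = (\<Sum>h\<in>Sym n. (\<Sum>k<n. KL h i j k * P (u @ k # map h v) (h \<circ> g))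
      + KC h i j * P (u @ map h v) (h \<circ> g))"

definition Jac :: "(nat list \<Rightarrow> (nat \<Rightarrow> nat) \<Rightarrow> complex) \<Rightarrow> nat \<Rightarrow> nat \<Rightarrow> nat \<Rightarrow> complex" where
  "Jac P = cyc (\<lambda>i j k. \<Sum>h\<in>Sym n. (\<Sum>m<n. KL h i j m * (P [m, h k] h - P [k, m] h))
      + KC h i j * (P [h k] h - P [k] h))"

text \<open>\<open>Q1\<close>, \<open>Q2\<close> and \<open>Q3\<close> are the coefficients of \<open>e\<^sub>m e\<^sub>l h\<close> in \<open>Jac\<close>, and of \<open>e\<^sub>l f\<close> and \<open>f\<close> in \<open>2 Jac\<close> after its
  antisymmetric quadratic part has been reduced with the relations.\<close>

definition Q1 :: "nat \<Rightarrow> nat \<Rightarrow> nat \<Rightarrow> (nat \<Rightarrow> nat) \<Rightarrow> nat \<Rightarrow> nat \<Rightarrow> complex" where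
  "Q1 i j k h m l = cyc (\<lambda>i j k. KL h i j m * of_bool (l = h k) - of_bool (m = k) * KL h i j l) i j k"

definition Q2 :: "nat \<Rightarrow> nat \<Rightarrow> nat \<Rightarrow> (nat \<Rightarrow> nat) \<Rightarrow> nat \<Rightarrow> complex" where
  "Q2 i j k f l = cyc (\<lambda>i j k. (\<Sum>h\<in>Sym n. \<Sum>m<n. KL h i j m *
        (KL (f \<circ> inv h) m (h k) l + KL (f \<circ> inv h) m k l))
      + 2 * KC f i j * (of_bool (l = f k) - of_bool (l = k))) i j k"

definition Q3 :: "nat \<Rightarrow> nat \<Rightarrow> nat \<Rightarrow> (nat \<Rightarrow> nat) \<Rightarrow> complex" where
  "Q3 i j k f = cyc (\<lambda>i j k. \<Sum>h\<in>Sym n. \<Sum>m<n. KL h i j m *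
        (KC (f \<circ> inv h) m (h k) + KC (f \<circ> inv h) m k)) i j k"

lemma Kap_alt: "Kap P u j i v g = - Kap P u i j v g"
proof -
  have "KL h j i k = - KL h i j k" "KC h j i = - KC h i j" for h k
    by (rule KL_alt KC_alt)+
  then show ?thesis
    by (simp add: Kap_def sum_negf[symmetric])
qed

text \<open>The deltas in \<open>Q1\<close> collapse one summation each. \<open>F\<close> is
  arbitrary because it stands for the values on two-letter words and also for the values on their
  \<kappa>-reductions.\<close>

lemma sum_Q1:
  assumes "h \<in> Sym n" "i < n" "j < n" "k < n"
  shows "(\<Sum>m<n. \<Sum>l<n. Q1 i j k h m l * F m l) =
    cyc (\<lambda>i j k. \<Sum>m<n. KL h i j m * (F m (h k) - F k m)) i j k"
proof -
  have one: "(\<Sum>m<n. \<Sum>l<n. (KL h i j m * of_bool (l = h k) - of_bool (m = k) * KL h i j l) * F m l)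
      = (\<Sum>m<n. KL h i j m * (F m (h k) - F k m))" if "k < n" for i j k
  proof -
    have "(\<Sum>m<n. \<Sum>l<n. KL h i j m * of_bool (l = h k) * F m l) = (\<Sum>m<n. KL h i j m * F m (h k))"
    proof (rule sum.cong[OF refl])
      fix m
      have "(\<Sum>l<n. KL h i j m * of_bool (l = h k) * F m l)
          = (\<Sum>l<n. if l = h k then KL h i j m * F m l else 0)"
        by (rule sum.cong) auto
      then show "(\<Sum>l<n. KL h i j m * of_bool (l = h k) * F m l) = KL h i j m * F m (h k)"
        using that assms(1) by simp
    qed
    moreover have "(\<Sum>m<n. \<Sum>l<n. of_bool (m = k) * KL h i j l * F m l) = (\<Sum>l<n. KL h i j l * F k l)"
    proof -
      have "(\<Sum>m<n. \<Sum>l<n. of_bool (m = k) * KL h i j l * F m l)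
          = (\<Sum>m<n. if m = k then (\<Sum>l<n. KL h i j l * F m l) else 0)"
        by (rule sum.cong) auto
      then show ?thesis using that by simp
    qed
    ultimately show ?thesis
      by (simp add: algebra_simps sum_subtractf)
  qed
  show ?thesis
    unfolding Q1_def using one[of k i j] one[of i j k] one[of j k i] assms
    by (simp add: distrib_right sum.distrib)
qed

text \<open>No relation is assumed for \<open>P\<close>. Antisymmetry of \<open>Q1\<close> lets the
  quadratic part be written with \<open>e_m e_l - e_l e_m\<close>; subtracting and adding \<kappa>
  of the pair produces the other two sums. The factor 2 comes from summing over all pairs
  \<open>(m, l)\<close> instead of \<open>m < l\<close>.\<close>

lemma jacobi_identity:
  assumes Q1: "\<And>h m l. h \<in> Sym n \<Longrightarrow> m < n \<Longrightarrow> l < n \<Longrightarrow> Q1 i j k h m l + Q1 i j k h l m = 0"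
    and "i < n" "j < n" "k < n"
  shows "2 * Jac P i j k =
      (\<Sum>h\<in>Sym n. \<Sum>m<n. \<Sum>l<n. Q1 i j k h m l * (P [m, l] h - P [l, m] h - Kap P [] m l [] h))
    + (\<Sum>f\<in>Sym n. \<Sum>l<n. Q2 i j k f l * P [l] f) + (\<Sum>f\<in>Sym n. Q3 i j k f * P [] f)"
proof -
  have anti: "(\<Sum>m<n. \<Sum>l<n. Q1 i j k h m l * (F m l - F l m)) = 2 * (\<Sum>m<n. \<Sum>l<n. Q1 i j k h m l * F m l)"
    if "h \<in> Sym n" for h and F :: "nat \<Rightarrow> nat \<Rightarrow> complex"
  proof -
    have "(\<Sum>m<n. \<Sum>l<n. Q1 i j k h m l * F l m) = (\<Sum>l<n. \<Sum>m<n. Q1 i j k h m l * F l m)"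
      by (rule sum.swap)
    also have "\<dots> = (\<Sum>m<n. \<Sum>l<n. - (Q1 i j k h m l * F m l))"
    proof (intro sum.cong refl)
      fix m l assume "m \<in> {..<n}" "l \<in> {..<n}"
      then have "Q1 i j k h l m = - Q1 i j k h m l"
        using Q1[OF that, of m l] by (simp add: add_eq_0_iff)
      then show "Q1 i j k h l m * F m l = - (Q1 i j k h m l * F m l)" by simp
    qed
    finally show ?thesis
      by (simp add: algebra_simps sum_subtractf sum_negf)
  qed
  have rearrange: "(\<Sum>h\<in>S. \<Sum>m<n. K h m * ((\<Sum>l<n. A h m l * p l) + B h m * q)) =
      (\<Sum>l<n. (\<Sum>h\<in>S. \<Sum>m<n. K h m * A h m l) * p l) + (\<Sum>h\<in>S. \<Sum>m<n. K h m * B h m) * q"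
    for S :: "(nat \<Rightarrow> nat) set" and K B and A :: "_ \<Rightarrow> _ \<Rightarrow> _ \<Rightarrow> complex" and p q
  proof -
    have "(\<Sum>l<n. (\<Sum>h\<in>S. \<Sum>m<n. K h m * A h m l) * p l) = (\<Sum>l<n. \<Sum>h\<in>S. \<Sum>m<n. K h m * A h m l * p l)"
      by (simp add: sum_distrib_right)
    also have "\<dots> = (\<Sum>h\<in>S. \<Sum>l<n. \<Sum>m<n. K h m * A h m l * p l)"
      by (rule sum.swap)
    also have "\<dots> = (\<Sum>h\<in>S. \<Sum>m<n. \<Sum>l<n. K h m * A h m l * p l)"
      by (intro sum.cong refl sum.swap)
    finally show ?thesis
      by (simp add: sum_distrib_left sum_distrib_right distrib_left sum.distrib mult.assoc)
  qed
  \<comment> \<open>The double sum is collected by the product \<open>f = g h\<close>. Exchanging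
    the arguments of the second \<open>Kap\<close> costs a sign, which is why \<open>Q2\<close> and
    \<open>Q3\<close> contain sums where \<open>Jac\<close> has differences.\<close>
  have kap: "(\<Sum>h\<in>Sym n. \<Sum>m<n. KL h i j m * (Kap P [] m (h k) [] h - Kap P [] k m [] h))
     = (\<Sum>f\<in>Sym n. \<Sum>l<n. (\<Sum>h\<in>Sym n. \<Sum>m<n. KL h i j m *
        (KL (f \<circ> inv h) m (h k) l + KL (f \<circ> inv h) m k l)) * P [l] f)
      + (\<Sum>f\<in>Sym n. (\<Sum>h\<in>Sym n. \<Sum>m<n. KL h i j m *
        (KC (f \<circ> inv h) m (h k) + KC (f \<circ> inv h) m k)) * P [] f)" for i j k
  proof -
    have "(\<Sum>h\<in>Sym n. \<Sum>m<n. KL h i j m * (Kap P [] m (h k) [] h - Kap P [] k m [] h))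
      = (\<Sum>h\<in>Sym n. \<Sum>g\<in>Sym n. \<Sum>m<n. KL h i j m *
         ((\<Sum>l<n. (KL g m (h k) l + KL g m k l) * P [l] (g \<circ> h)) + (KC g m (h k) + KC g m k) * P [] (g \<circ> h)))"
    proof (rule sum.cong[OF refl])
      fix h assume "h \<in> Sym n"
      have "Kap P [] m (h k) [] h - Kap P [] k m [] h
        = (\<Sum>g\<in>Sym n. (\<Sum>l<n. (KL g m (h k) l + KL g m k l) * P [l] (g \<circ> h)) + (KC g m (h k) + KC g m k) * P [] (g \<circ> h))" for m
        by (subst Kap_alt) (simp add: Kap_def sum.distrib algebra_simps)
      then show "(\<Sum>m<n. KL h i j m * (Kap P [] m (h k) [] h - Kap P [] k m [] h)) =
         (\<Sum>g\<in>Sym n. \<Sum>m<n. KL h i j m *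
         ((\<Sum>l<n. (KL g m (h k) l + KL g m k l) * P [l] (g \<circ> h)) + (KC g m (h k) + KC g m k) * P [] (g \<circ> h)))"
        by (simp add: sum_distrib_left sum.swap[of _ "{..<n}" "Sym n"])
    qed
    also have "\<dots> = (\<Sum>f\<in>Sym n. \<Sum>h\<in>Sym n. \<Sum>m<n. KL h i j m *
         ((\<Sum>l<n. (KL (f \<circ> inv h) m (h k) l + KL (f \<circ> inv h) m k l) * P [l] (f \<circ> inv h \<circ> h))
          + (KC (f \<circ> inv h) m (h k) + KC (f \<circ> inv h) m k) * P [] (f \<circ> inv h \<circ> h)))"
      by (rule sum_Sym_product)
    also have "\<dots> = (\<Sum>f\<in>Sym n. \<Sum>h\<in>Sym n. \<Sum>m<n. KL h i j m *
         ((\<Sum>l<n. (KL (f \<circ> inv h) m (h k) l + KL (f \<circ> inv h) m k l) * P [l] f)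
          + (KC (f \<circ> inv h) m (h k) + KC (f \<circ> inv h) m k) * P [] f))"
      by (intro sum.cong refl) (simp add: comp_assoc)
    also have "\<dots> = (\<Sum>f\<in>Sym n. (\<Sum>l<n. (\<Sum>h\<in>Sym n. \<Sum>m<n. KL h i j m *
        (KL (f \<circ> inv h) m (h k) l + KL (f \<circ> inv h) m k l)) * P [l] f)
      + (\<Sum>h\<in>Sym n. \<Sum>m<n. KL h i j m *
        (KC (f \<circ> inv h) m (h k) + KC (f \<circ> inv h) m k)) * P [] f)"
      by (intro sum.cong refl rearrange)
    finally show ?thesis by (simp add: sum.distrib)
  qed
  have const: "(\<Sum>h\<in>Sym n. 2 * KC h i j * (P [h k] h - P [k] h))
    = (\<Sum>f\<in>Sym n. \<Sum>l<n. 2 * KC f i j * (of_bool (l = f k) - of_bool (l = k)) * P [l] f)" if "k < n" for i j k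
  proof (rule sum.cong[OF refl])
    fix f assume f: "f \<in> Sym n"
    have eq: "(\<Sum>l<n. of_bool (l = x) * P [l] f) = P [x] f" if "x < n" for x
    proof -
      have "(\<Sum>l<n. of_bool (l = x) * P [l] f) = (\<Sum>l<n. if l = x then P [l] f else 0)"
        by (rule sum.cong) auto
      then show ?thesis using that by simp
    qed
    have "(\<Sum>l<n. 2 * KC f i j * (of_bool (l = f k) - of_bool (l = k)) * P [l] f)
      = 2 * KC f i j * ((\<Sum>l<n. of_bool (l = f k) * P [l] f) - (\<Sum>l<n. of_bool (l = k) * P [l] f))"
      by (simp only: sum_distrib_left sum_subtractf[symmetric] right_diff_distrib left_diff_distrib mult.assoc)
    then show "2 * KC f i j * (P [f k] f - P [k] f) = (\<Sum>l<n. 2 * KC f i j * (of_bool (l = f k) - of_bool (l = k)) * P [l] f)"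
      using eq[of "f k"] eq[of k] f that by simp
  qed
  \<comment> \<open>\<open>A h\<close> holds the quadratic terms of \<open>Jac\<close> at
    \<open>h\<close>, and \<open>B h\<close> the same terms with each pair replaced by its
    \<kappa>.\<close>
  define A where "A h = (\<Sum>m<n. \<Sum>l<n. Q1 i j k h m l * P [m, l] h)" for h
  define B where "B h = (\<Sum>m<n. \<Sum>l<n. Q1 i j k h m l * Kap P [] m l [] h)" for h
  have "(\<Sum>h\<in>Sym n. \<Sum>m<n. \<Sum>l<n. Q1 i j k h m l * (P [m, l] h - P [l, m] h - Kap P [] m l [] h))
     = (\<Sum>h\<in>Sym n. 2 * A h - B h)"
    unfolding A_def B_def using anti[of _ "\<lambda>m l. P [m, l] _"]
    by (intro sum.cong refl) (simp add: right_diff_distrib sum_subtractf)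
  also have "\<dots> = 2 * (\<Sum>h\<in>Sym n. A h) - (\<Sum>h\<in>Sym n. B h)"
    by (simp add: sum_subtractf sum_distrib_left)
  finally have 1: "(\<Sum>h\<in>Sym n. \<Sum>m<n. \<Sum>l<n. Q1 i j k h m l * (P [m, l] h - P [l, m] h - Kap P [] m l [] h))
     = 2 * (\<Sum>h\<in>Sym n. A h) - (\<Sum>h\<in>Sym n. B h)" .
  have A: "(\<Sum>h\<in>Sym n. A h) = cyc (\<lambda>i j k. \<Sum>h\<in>Sym n. \<Sum>m<n. KL h i j m * (P [m, h k] h - P [k, m] h)) i j k"
    unfolding A_def using sum_Q1[of _ i j k "\<lambda>m l. P [m, l] _"] assms by (simp add: sum.distrib)
  have B: "(\<Sum>h\<in>Sym n. B h) = cyc (\<lambda>i j k. \<Sum>h\<in>Sym n. \<Sum>m<n. KL h i j m * (Kap P [] m (h k) [] h - Kap P [] k m [] h)) i j k"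
    unfolding B_def using sum_Q1[of _ i j k "\<lambda>m l. Kap P [] m l [] _"] assms by (simp add: sum.distrib)
  have J: "2 * Jac P i j k = 2 * (\<Sum>h\<in>Sym n. A h) + cyc (\<lambda>i j k. \<Sum>h\<in>Sym n. 2 * KC h i j * (P [h k] h - P [k] h)) i j k"
    unfolding A Jac_def by (simp add: sum.distrib sum_distrib_left distrib_left mult.assoc)
  have Q: "(\<Sum>f\<in>Sym n. \<Sum>l<n. Q2 i j k f l * P [l] f) + (\<Sum>f\<in>Sym n. Q3 i j k f * P [] f)
    = (\<Sum>h\<in>Sym n. B h) + cyc (\<lambda>i j k. \<Sum>h\<in>Sym n. 2 * KC h i j * (P [h k] h - P [k] h)) i j k"
    unfolding B kap const[OF \<open>k < n\<close>] const[OF \<open>i < n\<close>] const[OF \<open>j < n\<close>] Q2_def Q3_def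
    by (simp add: sum.distrib distrib_right)
  have "x = y - b + q + r" if "x = y + z" "q + r = b + z" for x y z b q r :: complex
    using that by (simp add: algebra_simps)
  from this[OF J Q] show ?thesis unfolding 1 .
qed

end

section \<open>Normal forms\<close>

fun inversions :: "nat list \<Rightarrow> nat" where
  "inversions [] = 0"
| "inversions (x # xs) = length (filter (\<lambda>y. y < x) xs) + inversions xs"

lemma inversions_swap: "j < i \<Longrightarrow> inversions (u @ j # i # v) < inversions (u @ i # j # v)"
  by (induction u) auto

text \<open>Rewriting always acts at the leftmost descent, which makes the normal form a function;
  independence of this choice is confluence, proved in \<open>N_respects\<close>.\<close>

fun first_descent :: "nat list \<Rightarrow> (nat list \<times> nat \<times> nat \<times> nat list) option" where
  "first_descent (x # y # w) = (if y < x then Some ([], x, y, w)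
     else map_option (\<lambda>(u, i, j, v). (x # u, i, j, v)) (first_descent (y # w)))"
| "first_descent _ = None"

lemma first_descent_None: "first_descent w = None \<longleftrightarrow> sorted w"
proof (induction w rule: first_descent.induct)
  case (1 x y w)
  then show ?case by (auto simp: sorted2 split: if_splits)
qed auto

lemma first_descent_Some:
  "first_descent w = Some (u, i, j, v) \<Longrightarrow> w = u @ i # j # v \<and> j < i \<and> sorted (u @ [i])"
proof (induction w arbitrary: u rule: first_descent.induct)
  case (1 x y w)
  show ?case
  proof (cases "y < x")
    case True
    with 1 show ?thesis by simp
  next
    case False
    with "1.prems" obtain u' where u': "u = x # u'" "first_descent (y # w) = Some (u', i, j, v)"
      by auto
    from "1.IH"[OF False this(2)] False u' show ?thesis
      by (cases u') auto
  qed
qed auto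

text \<open>These are the ambiguities of the diamond lemma. The leftmost descent cannot lie to the
  right of another one, so it coincides with it, shares one letter with it, or lies apart from it on
  the left.\<close>

lemma first_descent_least:
  assumes "first_descent (u @ i # j # v) = Some (u', i', j', v')" "j < i"
  shows "(u' = u \<and> i' = i \<and> j' = j \<and> v' = v) \<or> (u = u' @ [i'] \<and> i = j' \<and> v' = j # v)
     \<or> (\<exists>t. u = u' @ i' # j' # t \<and> v' = t @ i # j # v)"
proof -
  from first_descent_Some[OF assms(1)]
  have eq: "u @ i # j # v = u' @ i' # j' # v'" and "j' < i'" and sorted: "sorted (u' @ [i'])" by auto
  \<comment> \<open>Otherwise the descent \<open>i, j\<close> would lie inside the sorted prefix
    \<open>u' @ [i']\<close>.\<close>
  have "\<not> length u < length u'"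
  proof
    assume less: "length u < length u'"
    have "(u' @ [i']) ! length u = i" "(u' @ [i']) ! Suc (length u) = j"
    proof -
      have "(u' @ i' # j' # v') ! length u = i" "(u' @ i' # j' # v') ! Suc (length u) = j"
        unfolding eq[symmetric] by (auto simp: nth_append)
      then show "(u' @ [i']) ! length u = i" "(u' @ [i']) ! Suc (length u) = j"
        using less by (auto simp: nth_append less_Suc_eq split: if_splits)
    qed
    moreover have "(u' @ [i']) ! length u \<le> (u' @ [i']) ! Suc (length u)"
      by (rule sorted_nth_mono[OF sorted]) (use less in auto)
    ultimately show False using assms(2) by simp
  qed
  then obtain s where s: "u = u' @ s" "s @ i # j # v = i' # j' # v'"
    using eq by (metis append_eq_append_conv_if append_take_drop_id linorder_not_less)
  then show ?thesis
    by (cases s rule: first_descent.cases) auto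
qed

lemma sort_swap: "sort (u @ j # i # v) = sort (u @ i # j # (v::nat list))"
  by (rule properties_for_sort) (auto simp: ac_simps)

context cochain
begin

text \<open>\<open>N z w g\<close> is the coefficient of \<open>z\<close> in the normal form of \<open>e\<^sub>w g\<close>.\<close>

function N :: "basis \<Rightarrow> nat list \<Rightarrow> (nat \<Rightarrow> nat) \<Rightarrow> complex" where
  "N z w g = (case first_descent w of None \<Rightarrow> of_bool (z = (w, g))
     | Some (u, i, j, v) \<Rightarrow> N z (u @ j # i # v) g +
         (\<Sum>h\<in>Sym n. (\<Sum>k<n. KL h i j k * N z (u @ k # map h v) (h \<circ> g))
           + KC h i j * N z (u @ map h v) (h \<circ> g)))"
  by pat_completeness auto
termination
  by (relation "measures [\<lambda>(z, w, g). length w, \<lambda>(z, w, g). inversions w]")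
     (auto dest!: first_descent_Some simp: inversions_swap)

declare N.simps [simp del]

lemma N_sorted: "sorted w \<Longrightarrow> N z w g = of_bool (z = (w, g))"
  by (subst N.simps) (use first_descent_None[of w] in auto)

lemma N_descent:
  "first_descent w = Some (u, i, j, v) \<Longrightarrow> N z w g = N z (u @ j # i # v) g + Kap (N z) u i j v g"
  by (subst N.simps) (simp add: Kap_def)

lemma N_shorter: "length w < length (fst z) \<Longrightarrow> N z w g = 0"
proof (induction z w g rule: N.induct)
  case (1 z w g)
  show ?case
  proof (cases "first_descent w")
    case None
    with 1 show ?thesis by (auto simp: N_sorted first_descent_None)
  next
    case (Some a)
    obtain u i j v where a: "a = (u, i, j, v)" by (cases a)
    have w: "w = u @ i # j # v" using first_descent_Some Some a by blast
    have 1: "N z (u @ j # i # v) g = 0" using "1.IH"(1)[OF Some a[symmetric] refl refl] "1.prems" w by simp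
    have 2: "N z (u @ k # map h v) (h \<circ> g) = 0" if "h \<in> Sym n" "k < n" for h k
      using "1.IH"(2)[OF Some a[symmetric] refl refl that(1)] "1.prems" w that by (simp add: comp_def)
    have 3: "N z (u @ map h v) (h \<circ> g) = 0" if "h \<in> Sym n" for h
      using "1.IH"(3)[OF Some a[symmetric] refl refl that(1)] "1.prems" w that by (simp add: comp_def)
    show ?thesis
      using Some a 1 2 3 by (simp add: N_descent Kap_def)
  qed
qed

text \<open>Every \<kappa>-term shortens the word, so in the degree of the word only the swaps
  survive, and they end in the sorted word.\<close>

lemma N_same_length: "length w = length (fst z) \<Longrightarrow> N z w g = of_bool (z = (sort w, g))"
proof (induction z w g rule: N.induct)
  case (1 z w g)
  show ?case
  proof (cases "first_descent w")
    case None
    then have "sorted w" by (simp add: first_descent_None)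
    then show ?thesis by (simp add: N_sorted sorted_sort_id)
  next
    case (Some a)
    obtain u i j v where a: "a = (u, i, j, v)" by (cases a)
    have w: "w = u @ i # j # v" using first_descent_Some Some a by blast
    have 1: "N z (u @ j # i # v) g = of_bool (z = (sort w, g))"
      using "1.IH"(1)[OF Some a[symmetric] refl refl] "1.prems" w sort_swap[of u j i v] by simp
    have 2: "N z (u @ k # map h v) (h \<circ> g) = 0" for h k
      by (rule N_shorter) (use "1.prems" w in simp)
    have 3: "N z (u @ map h v) (h \<circ> g) = 0" for h
      by (rule N_shorter) (use "1.prems" w in simp)
    show ?thesis
      using Some a 1 2 3 by (simp add: N_descent Kap_def)
  qed
qed

text \<open>Linear and constant terms are merged by indexing them with words of length at most one.\<close>

definition K1 :: "(nat \<Rightarrow> nat) \<Rightarrow> nat \<Rightarrow> nat \<Rightarrow> nat list \<Rightarrow> complex" where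
  "K1 h i j w = (case w of [] \<Rightarrow> KC h i j | k # _ \<Rightarrow> KL h i j k)"

definition W1 :: "nat list set" where
  "W1 = insert [] ((\<lambda>k. [k]) ` {..<n})"

lemma finite_W1 [simp]: "finite W1"
  by (simp add: W1_def)

lemma sum_W1: "(\<Sum>w\<in>W1. K1 h i j w * F w) = (\<Sum>k<n. KL h i j k * F [k]) + KC h i j * F []"
  unfolding W1_def by (subst sum.insert) (auto simp: sum.reindex inj_on_def K1_def)

lemma Kap_W1: "Kap P u i j v g = (\<Sum>h\<in>Sym n. \<Sum>w\<in>W1. K1 h i j w * P (u @ w @ map h v) (h \<circ> g))"
  by (simp add: Kap_def sum_W1)

end

section \<open>Confluence of the rewriting rules\<close>

locale pbw_cochain = cochain +
  assumes KL_conj: "\<lbrakk>p \<in> Sym n; h \<in> Sym n; i < n; j < n; k < n\<rbrakk>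
      \<Longrightarrow> KL (p \<circ> h \<circ> inv p) (p i) (p j) (p k) = KL h i j k"
    and KC_conj: "\<lbrakk>p \<in> Sym n; h \<in> Sym n; i < n; j < n\<rbrakk>
      \<Longrightarrow> KC (p \<circ> h \<circ> inv p) (p i) (p j) = KC h i j"
    and Q1_sym: "\<lbrakk>i < n; j < n; k < n; distinct [i, j, k]; h \<in> Sym n; m < n; l < n\<rbrakk>
      \<Longrightarrow> Q1 i j k h m l + Q1 i j k h l m = 0"
    and Q2_0: "\<lbrakk>i < n; j < n; k < n; distinct [i, j, k]; f \<in> Sym n; l < n\<rbrakk> \<Longrightarrow> Q2 i j k f l = 0"
    and Q3_0: "\<lbrakk>i < n; j < n; k < n; distinct [i, j, k]; f \<in> Sym n\<rbrakk> \<Longrightarrow> Q3 i j k f = 0"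
begin

text \<open>Invariance in the form used by reductions:
  \<open>p \<kappa>(e_i,e_j) = \<kappa>(e_(p i),e_(p j)) p\<close>. Group elements created by one
  reduction can thus be carried past another one.\<close>

lemma Kap_conj:
  assumes p: "p \<in> Sym n" and "i < n" "j < n"
  shows "Kap P u (p i) (p j) (map p v) (p \<circ> g) =
    (\<Sum>h\<in>Sym n. \<Sum>w\<in>W1. K1 h i j w * P (u @ map p w @ map p (map h v)) (p \<circ> (h \<circ> g)))"
proof -
  have W: "(\<Sum>w\<in>W1. F w) = (\<Sum>w\<in>W1. F (map p w))" for F :: "nat list \<Rightarrow> complex"
    by (rule sum.reindex_bij_witness[of _ "map p" "map (inv p)"])
       (use p in \<open>auto simp: W1_def\<close>)
  have K: "K1 (p \<circ> h \<circ> inv p) (p i) (p j) (map p w) = K1 h i j w" if "h \<in> Sym n" "w \<in> W1" for h w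
    using that assms by (auto simp: K1_def W1_def KC_conj KL_conj)
  have "Kap P u (p i) (p j) (map p v) (p \<circ> g) = (\<Sum>h\<in>Sym n. \<Sum>w\<in>W1.
     K1 (p \<circ> h \<circ> inv p) (p i) (p j) w * P (u @ w @ map (p \<circ> h \<circ> inv p) (map p v)) (p \<circ> h \<circ> inv p \<circ> (p \<circ> g)))"
    unfolding Kap_W1 by (rule sum_Sym_conj[OF p])
  also have "\<dots> = (\<Sum>h\<in>Sym n. \<Sum>w\<in>W1.
     K1 (p \<circ> h \<circ> inv p) (p i) (p j) (map p w) * P (u @ map p w @ map (p \<circ> h \<circ> inv p) (map p v)) (p \<circ> h \<circ> inv p \<circ> (p \<circ> g)))"
    by (subst W) simp
  also have "\<dots> = (\<Sum>h\<in>Sym n. \<Sum>w\<in>W1. K1 h i j w * P (u @ map p w @ map p (map h v)) (p \<circ> (h \<circ> g)))"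
  proof (intro sum.cong refl)
    fix h w assume hw: "h \<in> Sym n" "w \<in> W1"
    have "p \<circ> h \<circ> inv p \<circ> (p \<circ> g) = p \<circ> (h \<circ> g)" "map (p \<circ> h \<circ> inv p) (map p v) = map p (map h v)"
      using p by (auto simp: fun_eq_iff)
    then show "K1 (p \<circ> h \<circ> inv p) (p i) (p j) (map p w) * P (u @ map p w @ map (p \<circ> h \<circ> inv p) (map p v)) (p \<circ> h \<circ> inv p \<circ> (p \<circ> g))
      = K1 h i j w * P (u @ map p w @ map p (map h v)) (p \<circ> (h \<circ> g))"
      using K[OF hw] by (simp only:)
  qed
  finally show ?thesis .
qed

text \<open>Reductions at two separate places commute: in either order they give the double sum
  \<open>E\<close>. The left one creates group elements acting on the right pair, so the two orders
  are identified through invariance of \<kappa>.\<close>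

lemma Kap_disjoint:
  assumes *: "\<And>h w. h \<in> Sym n \<Longrightarrow> w \<in> W1 \<Longrightarrow>
      P ((u @ w @ map h t) @ h i # h j # map h v) (h \<circ> g) - P ((u @ w @ map h t) @ h j # h i # map h v) (h \<circ> g)
        = Kap P (u @ w @ map h t) (h i) (h j) (map h v) (h \<circ> g)"
    and **: "\<And>h w. h \<in> Sym n \<Longrightarrow> w \<in> W1 \<Longrightarrow>
      P (u @ i' # j' # t @ w @ map h v) (h \<circ> g) - P (u @ j' # i' # t @ w @ map h v) (h \<circ> g)
        = Kap P u i' j' (t @ w @ map h v) (h \<circ> g)"
    and "i < n" "j < n"
  shows "Kap P u i' j' (t @ i # j # v) g - Kap P u i' j' (t @ j # i # v) g =
     Kap P (u @ i' # j' # t) i j v g - Kap P (u @ j' # i' # t) i j v g"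
proof -
  define E where "E h w h' w' = K1 h i' j' w * K1 h' i j w' *
      P (u @ w @ map h t @ map h w' @ map h (map h' v)) (h \<circ> (h' \<circ> g))" for h w h' w'
  have "Kap P u i' j' (t @ i # j # v) g - Kap P u i' j' (t @ j # i # v) g
    = (\<Sum>h\<in>Sym n. \<Sum>w\<in>W1. K1 h i' j' w * Kap P (u @ w @ map h t) (h i) (h j) (map h v) (h \<circ> g))"
    unfolding Kap_W1[of P u i' j'] sum_subtractf[symmetric] right_diff_distrib[symmetric]
    by (intro sum.cong refl) (use * in simp)
  also have "\<dots> = (\<Sum>h\<in>Sym n. \<Sum>w\<in>W1. \<Sum>h'\<in>Sym n. \<Sum>w'\<in>W1. E h w h' w')"
    by (intro sum.cong refl) (simp add: E_def Kap_conj assms sum_distrib_left mult.assoc)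
  also have "\<dots> = (\<Sum>h\<in>Sym n. \<Sum>h'\<in>Sym n. \<Sum>w\<in>W1. \<Sum>w'\<in>W1. E h w h' w')"
    by (intro sum.cong refl sum.swap)
  also have "\<dots> = (\<Sum>h'\<in>Sym n. \<Sum>h\<in>Sym n. \<Sum>w\<in>W1. \<Sum>w'\<in>W1. E h w h' w')"
    by (rule sum.swap)
  also have "\<dots> = (\<Sum>h'\<in>Sym n. \<Sum>h\<in>Sym n. \<Sum>w'\<in>W1. \<Sum>w\<in>W1. E h w h' w')"
    by (intro sum.cong refl sum.swap)
  also have "\<dots> = (\<Sum>h'\<in>Sym n. \<Sum>w'\<in>W1. \<Sum>h\<in>Sym n. \<Sum>w\<in>W1. E h w h' w')"
    by (intro sum.cong refl sum.swap)
  also have "\<dots> = (\<Sum>h'\<in>Sym n. \<Sum>w'\<in>W1. K1 h' i j w' * Kap P u i' j' (t @ w' @ map h' v) (h' \<circ> g))"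
    unfolding Kap_W1[of P u i' j'] E_def by (simp add: sum_distrib_left mult_ac)
  also have "\<dots> = Kap P (u @ i' # j' # t) i j v g - Kap P (u @ j' # i' # t) i j v g"
    unfolding Kap_W1[of P "u @ i' # j' # t"] Kap_W1[of P "u @ j' # i' # t"]
      sum_subtractf[symmetric] right_diff_distrib[symmetric]
    by (intro sum.cong refl) (use ** in simp)
  finally show ?thesis .
qed

text \<open>The Jacobi identity inside a context \<open>u _ v g\<close>. The relations are required
  only for words one letter shorter than the overlap, which is what the induction supplies.\<close>

lemma Kap_overlap:
  assumes *: "\<And>h m l. h \<in> Sym n \<Longrightarrow> m < n \<Longrightarrow> l < n \<Longrightarrow>
      P (u @ m # l # map h v) (h \<circ> g) - P (u @ l # m # map h v) (h \<circ> g) = Kap P u m l (map h v) (h \<circ> g)"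
    and ijk: "i < n" "j < n" "k < n" "distinct [i, j, k]"
  shows "cyc (\<lambda>i j k. Kap P u i j (k # v) g - Kap P (u @ [k]) i j v g) i j k = 0"
proof -
  \<comment> \<open>\<open>P\<close> with the context absorbed; the suffix \<open>v\<close> has to
    pass the group element \<open>h\<close>.\<close>
  define P2 where "P2 w h = P (u @ w @ map h v) (h \<circ> g)" for w h
  have "Kap P2 [] m l [] h = Kap P u m l (map h v) (h \<circ> g)" for m l h
    by (simp add: Kap_def P2_def comp_assoc)
  then have "P2 [m, l] h - P2 [l, m] h - Kap P2 [] m l [] h = 0" if "h \<in> Sym n" "m < n" "l < n" for h m l
    using *[OF that] by (simp add: P2_def)
  then have "2 * Jac P2 i j k = 0"
    using jacobi_identity[of i j k P2] ijk Q1_sym Q2_0 Q3_0 by simp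
  then have "Jac P2 i j k = 0" by simp
  moreover have "Jac P2 i j k = cyc (\<lambda>i j k. Kap P u i j (k # v) g - Kap P (u @ [k]) i j v g) i j k"
    by (simp add: Jac_def Kap_def P2_def sum_subtractf sum.distrib right_diff_distrib)
  ultimately show ?thesis by simp
qed

text \<open>By definition \<open>N\<close> respects reductions at the leftmost descent only.
  Induction on length, then on inversions, extends this to every position, with the three positions
  of \<open>first_descent_least\<close> as cases.\<close>

theorem N_respects:
  assumes "set (u @ i # j # v) \<subseteq> {..<n}" "g \<in> Sym n"
  shows "N z (u @ i # j # v) g - N z (u @ j # i # v) g = Kap (N z) u i j v g"
proof -
  define T where "T = (\<lambda>w. \<forall>u i j v. \<forall>g\<in>Sym n. w = u @ i # j # v \<longrightarrow> set w \<subseteq> {..<n} \<longrightarrow> j < i \<longrightarrow>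
     N z (u @ i # j # v) g - N z (u @ j # i # v) g = Kap (N z) u i j v g)"
  \<comment> \<open>\<open>T\<close> speaks of descents; ascents and equal letters follow by
    alternation.\<close>
  have any: "N z (u @ i # j # v) g - N z (u @ j # i # v) g = Kap (N z) u i j v g"
    if "T (u @ i # j # v)" "T (u @ j # i # v)" "set (u @ i # j # v) \<subseteq> {..<n}" "g \<in> Sym n" for u i j v g
  proof (cases i j rule: linorder_cases)
    case less
    then have "N z (u @ j # i # v) g - N z (u @ i # j # v) g = Kap (N z) u j i v g"
      using that(2,3,4) unfolding T_def by auto
    then show ?thesis using Kap_alt[of "N z" u j i v g] by (simp add: algebra_simps)
  next
    case equal
    then show ?thesis using Kap_alt[of "N z" u j i v g] by simp
  next
    case greater
    then show ?thesis using that(1,3,4) unfolding T_def by auto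
  qed
  have "T w" for w
  proof (induction w rule: wf_induct[OF wf_measures[of "[length, inversions]"]])
    case (1 w)
    then have shorter: "T w'" if "length w' < length w" for w' using that by simp
    have fewer: "T w'" if "length w' = length w" "inversions w' < inversions w" for w'
      using 1 that by simp
    have len: "N z (u @ i # j # v) g - N z (u @ j # i # v) g = Kap (N z) u i j v g"
      if "length (u @ i # j # v) < length w" "set (u @ i # j # v) \<subseteq> {..<n}" "g \<in> Sym n" for u i j v g
      by (rule any) (use that in \<open>auto intro!: shorter\<close>)
    have inv: "N z (u @ i # j # v) g - N z (u @ j # i # v) g = Kap (N z) u i j v g"
      if "length (u @ i # j # v) = length w" "inversions (u @ i # j # v) < inversions w" "j < i"
         "set (u @ i # j # v) \<subseteq> {..<n}" "g \<in> Sym n" for u i j v g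
      using fewer[of "u @ i # j # v"] that unfolding T_def by blast
    show ?case unfolding T_def
    proof (intro allI ballI impI)
      fix u i j v g
      assume g: "g \<in> Sym n" and w: "w = u @ i # j # v" and sub: "set w \<subseteq> {..<n}" and ji: "j < i"
      from ji have "\<not> sorted w" by (auto simp: w sorted_append)
      then obtain u' i' j' v' where fd: "first_descent w = Some (u', i', j', v')"
        using first_descent_None[of w] by (cases "first_descent w") auto
      note N = N_descent[OF fd, of z g]
      from first_descent_Some[OF fd] have ji': "j' < i'" by simp
      from first_descent_least[OF fd[unfolded w] ji]
      consider (same) "u' = u" "i' = i" "j' = j" "v' = v"
        | (overlap) "u = u' @ [i']" "i = j'" "v' = j # v"
        | (disjoint) t where "u = u' @ i' # j' # t" "v' = t @ i # j # v" by blast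
      then show "N z (u @ i # j # v) g - N z (u @ j # i # v) g = Kap (N z) u i j v g"
      proof cases
        case same
        with N w show ?thesis by simp
      next
        case overlap
        \<comment> \<open>The letters \<open>i' > i > j\<close> span a hexagon of words from
          \<open>i' i j\<close> to \<open>j i i'\<close>. \<open>N1\<close> to \<open>N5\<close> are
          five of its edges; the sixth is the claim.\<close>
        have w': "w = u' @ i' # i # j # v" using w overlap by simp
        have less: "j < i" "i < i'" using ji ji' overlap by auto
        have N1: "N z w g = N z (u' @ i # i' # j # v) g + Kap (N z) u' i' i (j # v) g"
          using N overlap by simp
        have sw: "inversions (u' @ i # i' # j # v) < inversions w"
            "inversions (u' @ i # j # i' # v) < inversions (u' @ i # i' # j # v)"
            "inversions (u' @ i' # j # i # v) < inversions w"
            "inversions (u' @ j # i' # i # v) < inversions (u' @ i' # j # i # v)"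
          using inversions_swap[of i i' u' "j # v"] inversions_swap[of j i' "u' @ [i]" v]
            inversions_swap[of j i "u' @ [i']" v] inversions_swap[of j i' "u'" "i # v"] less
          by (auto simp: w')
        have N2: "N z (u' @ i # i' # j # v) g - N z (u' @ i # j # i' # v) g = Kap (N z) (u' @ [i]) i' j v g"
          using inv[of "u' @ [i]" i' j v g] sw less sub g by (auto simp: w')
        have N3: "N z (u' @ i # j # i' # v) g - N z (u' @ j # i # i' # v) g = Kap (N z) u' i j (i' # v) g"
          using inv[of "u'" i j "i' # v" g] sw less sub g by (auto simp: w')
        have N4: "N z (u' @ i' # j # i # v) g - N z (u' @ j # i' # i # v) g = Kap (N z) u' i' j (i # v) g"
          using inv[of "u'" i' j "i # v" g] sw less sub g by (auto simp: w')
        have N5: "N z (u' @ j # i' # i # v) g - N z (u' @ j # i # i' # v) g = Kap (N z) (u' @ [j]) i' i v g"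
          using inv[of "u' @ [j]" i' i v g] sw less sub g by (auto simp: w')
        \<comment> \<open>The six \<kappa>-terms around the hexagon form the Jacobi expression. Its
          letters are distinct because they strictly decrease.\<close>
        have "cyc (\<lambda>i j k. Kap (N z) u' i j (k # v) g - Kap (N z) (u' @ [k]) i j v g) i' i j = 0"
        proof (rule Kap_overlap)
          fix h m l assume "h \<in> Sym n" "m < n" "l < n"
          then show "N z (u' @ m # l # map h v) (h \<circ> g) - N z (u' @ l # m # map h v) (h \<circ> g)
              = Kap (N z) u' m l (map h v) (h \<circ> g)"
            by (intro len) (use sub g in \<open>auto simp: w' subset_iff\<close>)
        qed (use sub less in \<open>auto simp: w'\<close>)
        then have cyc: "(Kap (N z) u' i' i (j # v) g - Kap (N z) (u' @ [j]) i' i v g)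
          + (Kap (N z) u' i j (i' # v) g - Kap (N z) (u' @ [i']) i j v g)
          + (- Kap (N z) u' i' j (i # v) g - (- Kap (N z) (u' @ [i]) i' j v g)) = 0"
          unfolding Kap_alt[of "N z" u' i' j] Kap_alt[of "N z" "u' @ [i]" i' j] minus_minus .
        have "x - y = e" if "x = a + k1" "a - b = k2" "b - c = k3" "y - d = k4" "d - c = k5"
          "(k1 - k5) + (k3 - e) + (- k4 - (- k2)) = 0" for x y a b c d e k1 k2 k3 k4 k5 :: complex
          using that by algebra
        from this[OF N1 N2 N3 N4 N5 cyc] show ?thesis
          unfolding overlap(1) w' by simp
      next
        case disjoint
        \<comment> \<open>The two swaps span a square. Three edges are known, and by
          \<open>Kap_disjoint\<close> the \<kappa>-terms of the two pairs of opposite edges differ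
          by the same amount.\<close>
        have w': "w = u' @ i' # j' # t @ i # j # v" using w disjoint by simp
        have N1: "N z w g = N z (u' @ j' # i' # t @ i # j # v) g + Kap (N z) u' i' j' (t @ i # j # v) g"
          using N disjoint by simp
        have sw: "inversions (u' @ j' # i' # t @ i # j # v) < inversions w"
            "inversions (u' @ i' # j' # t @ j # i # v) < inversions w"
          using inversions_swap[of j' i' u' "t @ i # j # v"] inversions_swap[of j i "u' @ i' # j' # t" v] ji ji'
          by (auto simp: w')
        have N2: "N z (u' @ j' # i' # t @ i # j # v) g - N z (u' @ j' # i' # t @ j # i # v) g
            = Kap (N z) (u' @ j' # i' # t) i j v g"
          using inv[of "u' @ j' # i' # t" i j v g] sw ji sub g by (auto simp: w')
        have N3: "N z (u' @ i' # j' # t @ j # i # v) g - N z (u' @ j' # i' # t @ j # i # v) g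
            = Kap (N z) u' i' j' (t @ j # i # v) g"
          using inv[of "u'" i' j' "t @ j # i # v" g] sw ji' sub g by (auto simp: w')
        have "Kap (N z) u' i' j' (t @ i # j # v) g - Kap (N z) u' i' j' (t @ j # i # v) g =
            Kap (N z) (u' @ i' # j' # t) i j v g - Kap (N z) (u' @ j' # i' # t) i j v g"
        proof (rule Kap_disjoint)
          fix h w0 assume hw: "h \<in> Sym n" "w0 \<in> W1"
          have w0: "set w0 \<subseteq> {..<n}" "length w0 \<le> 1" using hw by (auto simp: W1_def)
          have subs: "set u' \<subseteq> {..<n}" "set t \<subseteq> {..<n}" "set v \<subseteq> {..<n}" "i < n" "j < n" "i' < n" "j' < n"
            using sub by (auto simp: w')
          have maps: "set (map h t) \<subseteq> {..<n}" "set (map h v) \<subseteq> {..<n}" "h i < n" "h j < n"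
            using subs hw by auto
          have len_less: "length (u' @ w0 @ map h t) + length (map h v) + 2 < length w"
            "length u' + length (t @ w0 @ map h v) + 2 < length w"
            using w0 by (simp_all add: w')
          have hg: "h \<circ> g \<in> Sym n" using hw g by simp
          show "N z ((u' @ w0 @ map h t) @ h i # h j # map h v) (h \<circ> g)
              - N z ((u' @ w0 @ map h t) @ h j # h i # map h v) (h \<circ> g)
              = Kap (N z) (u' @ w0 @ map h t) (h i) (h j) (map h v) (h \<circ> g)"
          proof (rule len[OF _ _ hg])
            show "length ((u' @ w0 @ map h t) @ h i # h j # map h v) < length w"
              using len_less(1) by simp
            show "set ((u' @ w0 @ map h t) @ h i # h j # map h v) \<subseteq> {..<n}"
              using subs w0 maps by simp
          qed
          show "N z (u' @ i' # j' # t @ w0 @ map h v) (h \<circ> g) - N z (u' @ j' # i' # t @ w0 @ map h v) (h \<circ> g)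
              = Kap (N z) u' i' j' (t @ w0 @ map h v) (h \<circ> g)"
          proof (rule len[OF _ _ hg])
            show "length (u' @ i' # j' # t @ w0 @ map h v) < length w"
              using len_less(2) by simp
            show "set (u' @ i' # j' # t @ w0 @ map h v) \<subseteq> {..<n}"
              using subs w0 maps by simp
          qed
        qed (use sub in \<open>auto simp: w'\<close>)
        moreover have "x - y = e" if "k1 - k3 = e - k2" "x = a + k1" "a - b = k2" "y - b = k3"
          for x y a b e k1 k2 k3 :: complex
          using that by algebra
        ultimately have "N z w g - N z (u' @ i' # j' # t @ j # i # v) g = Kap (N z) (u' @ i' # j' # t) i j v g"
          using N1 N2 N3 by blast
        then show ?thesis
          unfolding disjoint(1) w' by simp
      qed
    qed
  qed
  then show ?thesis using any assms by blast
qed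

end

section \<open>Ideals of the skew group algebra\<close>

definition lin_ext :: "(nat list \<Rightarrow> (nat \<Rightarrow> nat) \<Rightarrow> complex) \<Rightarrow> elt \<Rightarrow> complex" where
  "lin_ext P f = (\<Sum>x\<in>supp f. f x * P (fst x) (snd x))"

definition sandwich :: "nat list \<Rightarrow> (nat \<Rightarrow> nat) \<Rightarrow> nat list \<Rightarrow> (nat \<Rightarrow> nat) \<Rightarrow> elt \<Rightarrow> elt" where
  "sandwich u p v q f = bv u p \<star> f \<star> bv v q"

lemma supp_bv [simp]: "supp (bv w g) = {(w, g)}"
  by (auto simp: supp_def bv_def)

lemma bv_apply: "bv w g z = of_bool (z = (w, g))"
  by (simp add: bv_def)

lemma supp_add_finite: "finite (supp f) \<Longrightarrow> finite (supp h) \<Longrightarrow> finite (supp (\<lambda>z. f z + h z))"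
  by (rule finite_subset[of _ "supp f \<union> supp h"]) (auto simp: supp_def)

lemma supp_diff_finite: "finite (supp f) \<Longrightarrow> finite (supp h) \<Longrightarrow> finite (supp (\<lambda>z. f z - h z))"
  by (rule finite_subset[of _ "supp f \<union> supp h"]) (auto simp: supp_def)

lemma supp_scale_finite: "finite (supp f) \<Longrightarrow> finite (supp (\<lambda>z. c * f z))"
  by (rule finite_subset[of _ "supp f"]) (auto simp: supp_def)

lemma supp_sum_finite: "(\<And>t. t \<in> A \<Longrightarrow> finite (supp (f t))) \<Longrightarrow> finite (supp (\<lambda>z. \<Sum>t\<in>A. f t z))"
proof (induction A rule: infinite_finite_induct)
  case (insert x F)
  then show ?case by (simp add: supp_add_finite)
qed (auto simp: supp_def)

lemma lin_ext_superset: "finite S \<Longrightarrow> supp f \<subseteq> S \<Longrightarrow> lin_ext P f = (\<Sum>x\<in>S. f x * P (fst x) (snd x))"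
  unfolding lin_ext_def by (rule sum.mono_neutral_left) (auto simp: supp_def)

lemma lin_ext_bv [simp]: "lin_ext P (bv w g) = P w g"
  by (simp add: lin_ext_def) (simp add: bv_def)

lemma lin_ext_add:
  assumes "finite (supp f)" "finite (supp h)"
  shows "lin_ext P (\<lambda>z. f z + h z) = lin_ext P f + lin_ext P h"
proof -
  let ?S = "supp f \<union> supp h"
  have "lin_ext P (\<lambda>z. f z + h z) = (\<Sum>x\<in>?S. (f x + h x) * P (fst x) (snd x))"
    by (rule lin_ext_superset) (use assms in \<open>auto simp: supp_def\<close>)
  also have "\<dots> = (\<Sum>x\<in>?S. f x * P (fst x) (snd x)) + (\<Sum>x\<in>?S. h x * P (fst x) (snd x))"
    by (simp add: distrib_right sum.distrib)
  also have "\<dots> = lin_ext P f + lin_ext P h"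
    using lin_ext_superset[of ?S f P] lin_ext_superset[of ?S h P] assms by simp
  finally show ?thesis .
qed

lemma lin_ext_scale: "finite (supp f) \<Longrightarrow> lin_ext P (\<lambda>z. c * f z) = c * lin_ext P f"
  by (subst lin_ext_superset[of "supp f"]) (auto simp: supp_def lin_ext_def sum_distrib_left mult.assoc)

lemma lin_ext_diff:
  assumes "finite (supp f)" "finite (supp h)"
  shows "lin_ext P (\<lambda>z. f z - h z) = lin_ext P f - lin_ext P h"
proof -
  have "lin_ext P (\<lambda>z. f z + (-1) * h z) = lin_ext P f + (-1) * lin_ext P h"
    using assms by (simp only: lin_ext_add lin_ext_scale supp_scale_finite)
  then show ?thesis by simp
qed

lemma lin_ext_sum:
  "(\<And>t. t \<in> A \<Longrightarrow> finite (supp (f t))) \<Longrightarrow> lin_ext P (\<lambda>z. \<Sum>t\<in>A. f t z) = (\<Sum>t\<in>A. lin_ext P (f t))"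
proof (induction A rule: infinite_finite_induct)
  case (insert x F)
  then show ?case by (simp add: lin_ext_add supp_sum_finite)
qed (auto simp: supp_def lin_ext_def)

lemmas finite_supp_intros = supp_add_finite supp_diff_finite supp_scale_finite supp_sum_finite

lemma emult_bv_left:
  "bv u p \<star> f = (\<lambda>x. \<Sum>y\<in>supp f. if bmult (u, p) y = x then f y else 0)"
  unfolding emult_def supp_bv by (simp add: bv_apply cong: if_cong)

lemma sandwich_apply:
  assumes "finite (supp f)"
  shows "sandwich u p v q f z = lin_ext (\<lambda>w g. bv (u @ map p w @ map (p \<circ> g) v) (p \<circ> g \<circ> q) z) f"
proof -
  \<comment> \<open>\<open>p\<close> is arbitrary here, so different words may collide and cancel;
    hence the sum over the image \<open>?S\<close> instead of the support of
    \<open>?F\<close>.\<close>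
  let ?F = "bv u p \<star> f" and ?S = "bmult (u, p) ` supp f"
  have supp: "supp ?F \<subseteq> ?S"
  proof
    fix x assume "x \<in> supp ?F"
    then have "(\<Sum>y\<in>supp f. if bmult (u, p) y = x then f y else 0) \<noteq> 0"
      by (simp add: supp_def emult_bv_left)
    then obtain y where "y \<in> supp f" "(if bmult (u, p) y = x then f y else 0) \<noteq> 0"
      by (rule sum.not_neutral_contains_not_neutral)
    then show "x \<in> ?S" by (auto split: if_splits)
  qed
  have "sandwich u p v q f z = (\<Sum>x\<in>supp ?F. if bmult x (v, q) = z then ?F x else 0)"
    unfolding sandwich_def emult_def[of ?F] supp_bv by (simp add: bv_apply[of v q] cong: if_cong)
  also have "\<dots> = (\<Sum>x\<in>?S. if bmult x (v, q) = z then ?F x else 0)"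
    by (rule sum.mono_neutral_left) (use assms supp in \<open>auto simp: supp_def\<close>)
  also have "\<dots> = (\<Sum>x\<in>?S. \<Sum>y\<in>supp f. if bmult (u, p) y = x then (if bmult x (v, q) = z then f y else 0) else 0)"
  proof (rule sum.cong[OF refl])
    fix x show "(if bmult x (v, q) = z then ?F x else 0)
      = (\<Sum>y\<in>supp f. if bmult (u, p) y = x then (if bmult x (v, q) = z then f y else 0) else 0)"
      by (cases "bmult x (v, q) = z") (simp_all add: emult_bv_left cong: if_cong)
  qed
  also have "\<dots> = (\<Sum>y\<in>supp f. \<Sum>x\<in>?S. if bmult (u, p) y = x then (if bmult x (v, q) = z then f y else 0) else 0)"
    by (rule sum.swap)
  also have "\<dots> = (\<Sum>y\<in>supp f. if bmult (bmult (u, p) y) (v, q) = z then f y else 0)"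
    using assms by (intro sum.cong refl) simp
  also have "\<dots> = lin_ext (\<lambda>w g. bv (u @ map p w @ map (p \<circ> g) v) (p \<circ> g \<circ> q) z) f"
    unfolding lin_ext_def by (intro sum.cong refl) (auto simp: bmult_def bv_def)
  finally show ?thesis .
qed

lemma sandwich_eq:
  assumes "finite (supp f)"
  shows "sandwich u p v q f = (\<lambda>z. \<Sum>y\<in>supp f. f y *
      bv (u @ map p (fst y) @ map (p \<circ> snd y) v) (p \<circ> snd y \<circ> q) z)"
  by (rule ext) (simp add: sandwich_apply[OF assms] lin_ext_def)

lemma sandwich_finite: "finite (supp f) \<Longrightarrow> finite (supp (sandwich u p v q f))"
  by (simp add: sandwich_eq finite_supp_intros)

lemma lin_ext_sandwich:
  assumes "finite (supp f)"
  shows "lin_ext P (sandwich u p v q f) = lin_ext (\<lambda>w g. P (u @ map p w @ map (p \<circ> g) v) (p \<circ> g \<circ> q)) f"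
  unfolding sandwich_eq[OF assms]
  by (simp add: lin_ext_sum lin_ext_scale finite_supp_intros) (simp add: lin_ext_def)

lemma supp_sandwich_valid:
  assumes "finite (supp f)" "\<And>x. x \<in> supp f \<Longrightarrow> valid_basis n x"
    "valid_basis n (u, p)" "valid_basis n (v, q)" "x \<in> supp (sandwich u p v q f)"
  shows "valid_basis n x"
proof -
  from assms(5) have "(\<Sum>y\<in>supp f. f y * bv (u @ map p (fst y) @ map (p \<circ> snd y) v) (p \<circ> snd y \<circ> q) x) \<noteq> 0"
    unfolding sandwich_eq[OF assms(1)] by (simp add: supp_def)
  then obtain y where "y \<in> supp f"
    and "f y * bv (u @ map p (fst y) @ map (p \<circ> snd y) v) (p \<circ> snd y \<circ> q) x \<noteq> 0"
    by (rule sum.not_neutral_contains_not_neutral)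
  then have "y \<in> supp f" "x = (u @ map p (fst y) @ map (p \<circ> snd y) v, p \<circ> snd y \<circ> q)"
    by (auto simp: bv_apply split: if_splits)
  then show ?thesis using assms(2)[of y] assms(3,4) by (auto simp: valid_basis_def subset_iff)
qed

section \<open>Spans and two-sided ideals\<close>

lemma cspan_0: "(\<lambda>z. 0) \<in> cspan S"
  unfolding cspan_def by (intro CollectI exI[of _ "{}"]) auto

lemma cspan_superset: "f \<in> S \<Longrightarrow> f \<in> cspan S"
  unfolding cspan_def by (intro CollectI exI[of _ "{f}"] exI[of _ "\<lambda>_. 1"]) auto

lemma cspan_scale: "f \<in> cspan S \<Longrightarrow> (\<lambda>z. c * f z) \<in> cspan S"
proof -
  assume "f \<in> cspan S"
  then obtain F d where "finite F" "F \<subseteq> S" "f = (\<lambda>z. \<Sum>v\<in>F. d v * v z)"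
    unfolding cspan_def by blast
  then show ?thesis unfolding cspan_def
    by (intro CollectI exI[of _ F] exI[of _ "\<lambda>v. c * d v"]) (auto simp: sum_distrib_left mult.assoc)
qed

lemma cspan_add:
  assumes "f \<in> cspan S" "h \<in> cspan S"
  shows "(\<lambda>z. f z + h z) \<in> cspan S"
proof -
  obtain F d where F: "finite F" "F \<subseteq> S" "f = (\<lambda>z. \<Sum>v\<in>F. d v * v z)"
    using assms(1) unfolding cspan_def by blast
  obtain G e where G: "finite G" "G \<subseteq> S" "h = (\<lambda>z. \<Sum>v\<in>G. e v * v z)"
    using assms(2) unfolding cspan_def by blast
  let ?c = "\<lambda>v. (if v \<in> F then d v else 0) + (if v \<in> G then e v else 0)"
  have "f z + h z = (\<Sum>v\<in>F \<union> G. ?c v * v z)" for z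
  proof -
    have "(\<Sum>v\<in>F \<union> G. ?c v * v z) = (\<Sum>v\<in>F \<union> G. (if v \<in> F then d v * v z else 0))
      + (\<Sum>v\<in>F \<union> G. (if v \<in> G then e v * v z else 0))"
      unfolding sum.distrib[symmetric] by (intro sum.cong) (auto simp: distrib_right)
    also have "(\<Sum>v\<in>F \<union> G. (if v \<in> F then d v * v z else 0)) = f z"
      unfolding F by (rule sum.mono_neutral_cong_right) (use F G in auto)
    also have "(\<Sum>v\<in>F \<union> G. (if v \<in> G then e v * v z else 0)) = h z"
      unfolding G by (rule sum.mono_neutral_cong_right) (use F G in auto)
    finally show ?thesis by simp
  qed
  then show ?thesis
    unfolding cspan_def using F G by (intro CollectI exI[of _ "F \<union> G"] exI[of _ ?c]) auto
qed

lemma cspan_diff: "f \<in> cspan S \<Longrightarrow> h \<in> cspan S \<Longrightarrow> (\<lambda>z. f z - h z) \<in> cspan S"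
  using cspan_add[of f S "\<lambda>z. (-1) * h z"] cspan_scale[of h S "-1"] by simp

lemma cspan_sum: "(\<And>t. t \<in> A \<Longrightarrow> f t \<in> cspan S) \<Longrightarrow> (\<lambda>z. \<Sum>t\<in>A. f t z) \<in> cspan S"
proof (induction A rule: infinite_finite_induct)
  case (insert x F)
  then show ?case by (simp add: cspan_add)
qed (auto simp: cspan_0)

lemma cspan_induct [consumes 1, case_names zero add scale]:
  assumes "f \<in> cspan S" and "Q (\<lambda>z. 0)" and "\<And>f h. Q f \<Longrightarrow> Q h \<Longrightarrow> Q (\<lambda>z. f z + h z)"
    and "\<And>c f. f \<in> S \<Longrightarrow> Q (\<lambda>z. c * f z)"
  shows "Q f"
proof -
  obtain F d where F: "finite F" "F \<subseteq> S" "f = (\<lambda>z. \<Sum>v\<in>F. d v * v z)"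
    using assms(1) unfolding cspan_def by blast
  from F(1,2) have "Q (\<lambda>z. \<Sum>v\<in>F. d v * v z)"
    by (induction F rule: finite_induct) (auto simp: assms(2) intro!: assms(3,4))
  then show ?thesis using F by simp
qed

lemma cspan_least: "S \<subseteq> cspan T \<Longrightarrow> cspan S \<subseteq> cspan T"
proof
  fix f assume "S \<subseteq> cspan T" "f \<in> cspan S"
  from this(2,1) show "f \<in> cspan T"
    by (induction rule: cspan_induct) (auto intro: cspan_0 cspan_add cspan_scale)
qed

lemma ideal_gen_sandwich:
  "ideal_gen n R = cspan {sandwich u p v q r | u p v q r.
      valid_basis n (u, p) \<and> valid_basis n (v, q) \<and> r \<in> R}"
  unfolding ideal_gen_def sandwich_def by (rule arg_cong[of _ _ cspan]) force

lemma finite_supp_rel [simp]: "finite (supp (rel n KL KC i j))"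
  unfolding rel_def by (intro finite_supp_intros) auto

lemma lin_ext_rel:
  "lin_ext P (rel n KL KC i j) = P [i, j] id - P [j, i] id
     - (\<Sum>h\<in>Sym n. (\<Sum>k<n. KL h i j k * P [k] h) + KC h i j * P [] h)"
  unfolding rel_def
  by (simp add: lin_ext_diff lin_ext_sum lin_ext_scale finite_supp_intros sum.distrib)

lemma sandwich_rel:
  "sandwich u p v q (rel n KL KC i j) z =
     bv (u @ p i # p j # map p v) (p \<circ> q) z - bv (u @ p j # p i # map p v) (p \<circ> q) z
     - (\<Sum>h\<in>Sym n. (\<Sum>k<n. KL h i j k * bv (u @ p k # map (p \<circ> h) v) (p \<circ> h \<circ> q) z)
         + KC h i j * bv (u @ map (p \<circ> h) v) (p \<circ> h \<circ> q) z)"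
  by (simp add: sandwich_apply lin_ext_rel)

definition commutator :: "nat \<Rightarrow> nat \<Rightarrow> elt" where
  "commutator i j = (\<lambda>z. bv [i, j] id z - bv [j, i] id z)"

lemma finite_supp_commutator [simp]: "finite (supp (commutator i j))"
  unfolding commutator_def by (rule supp_diff_finite) simp_all

lemma sandwich_commutator:
  "sandwich u p v q (commutator i j) z =
     bv (u @ p i # p j # map p v) (p \<circ> q) z - bv (u @ p j # p i # map p v) (p \<circ> q) z"
  unfolding sandwich_apply[OF finite_supp_commutator] unfolding commutator_def
  by (subst lin_ext_diff) simp_all

lemma comm_ideal_sandwich:
  "comm_ideal n = cspan {sandwich u p v q (commutator i j) | u p v q i j.
      valid_basis n (u, p) \<and> valid_basis n (v, q) \<and> i < j \<and> j < n}"
  unfolding comm_ideal_def ideal_gen_sandwich commutator_def by (rule arg_cong[of _ _ cspan]) blast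

lemma rel_ideal_sandwich:
  "rel_ideal n KL KC = cspan {sandwich u p v q (rel n KL KC i j) | u p v q i j.
      valid_basis n (u, p) \<and> valid_basis n (v, q) \<and> i < j \<and> j < n}"
  unfolding rel_ideal_def ideal_gen_sandwich by (rule arg_cong[of _ _ cspan]) blast

lemma comm_ideal_swap:
  assumes "set (u @ i # j # v) \<subseteq> {..<n}" "g \<in> Sym n" "j < i"
  shows "(\<lambda>z. bv (u @ i # j # v) g z - bv (u @ j # i # v) g z) \<in> comm_ideal n"
proof -
  have "sandwich u id v g (commutator j i) \<in> comm_ideal n"
    unfolding comm_ideal_sandwich using assms
    by (intro cspan_superset CollectI exI[of _ u] exI[of _ id] exI[of _ v] exI[of _ g] exI[of _ j] exI[of _ i])
       (auto simp: valid_basis_def)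
  then have "(\<lambda>z. (-1) * sandwich u id v g (commutator j i) z) \<in> comm_ideal n"
    unfolding comm_ideal_sandwich by (rule cspan_scale)
  then show ?thesis by (simp add: sandwich_commutator)
qed

lemma comm_ideal_sort:
  assumes "set w \<subseteq> {..<n}" "g \<in> Sym n"
  shows "(\<lambda>z. bv w g z - bv (sort w) g z) \<in> comm_ideal n"
  using assms(1)
proof (induction w rule: measure_induct_rule[of inversions])
  case (less w)
  show ?case
  proof (cases "first_descent w")
    case None
    then have "sort w = w" by (simp add: first_descent_None sorted_sort_id)
    then show ?thesis using cspan_0 by (simp add: comm_ideal_sandwich)
  next
    case (Some a)
    obtain u i j v where "a = (u, i, j, v)" by (cases a)
    with Some first_descent_Some have w: "w = u @ i # j # v" and ji: "j < i" by blast+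
    have "(\<lambda>z. bv (u @ j # i # v) g z - bv (sort (u @ j # i # v)) g z) \<in> comm_ideal n"
      by (rule less.IH) (use ji w less.prems in \<open>auto intro: inversions_swap\<close>)
    moreover have "(\<lambda>z. bv (u @ i # j # v) g z - bv (u @ j # i # v) g z) \<in> comm_ideal n"
      by (rule comm_ideal_swap) (use ji w less.prems assms in auto)
    ultimately have "(\<lambda>z. (bv (u @ i # j # v) g z - bv (u @ j # i # v) g z) + (bv (u @ j # i # v) g z - bv (sort (u @ j # i # v)) g z)) \<in> comm_ideal n"
      unfolding comm_ideal_sandwich by (intro cspan_add)
    then show ?thesis by (simp add: w sort_swap[of u j i v])
  qed
qed

text \<open>The necessary conditions use only this shadow of the commutator ideal: nothing below
  degree two, and antisymmetric tensors in degree two.\<close>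

lemma comm_ideal_vanish:
  assumes "c \<in> comm_ideal n"
  shows "(\<forall>w g. length w < 2 \<longrightarrow> c (w, g) = 0) \<and> (\<forall>m l h. c ([m, l], h) + c ([l, m], h) = 0)"
  using assms unfolding comm_ideal_sandwich
proof (induction rule: cspan_induct)
  case zero
  then show ?case by simp
next
  case (add f h)
  then show ?case by (metis (no_types, opaque_lifting) add.left_neutral add.assoc add.left_commute)
next
  case (scale c f)
  then obtain u p v q i j where f: "f = sandwich u p v q (commutator i j)" by blast
  have swap: "([l, m], h) = (u @ a # b # map p v, g) \<longleftrightarrow> ([m, l], h) = (u @ b # a # map p v, g)" for l m a b h g
    by (cases u) (auto simp: Cons_eq_append_conv append_eq_Cons_conv)
  have "f ([m, l], h) + f ([l, m], h) = 0" for m l h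
    unfolding f sandwich_commutator bv_apply swap[of l m] by simp
  then have "c * f ([m, l], h) + c * f ([l, m], h) = 0" for m l h
    by (simp add: distrib_left[symmetric] del: mult_eq_0_iff)
  moreover have "f (w, g) = 0" if "length w < 2" for w g
    using that unfolding f sandwich_commutator bv_apply by auto
  ultimately show ?case by simp
qed

section \<open>The PBW criterion\<close>

lemma fdeg_eq_Max: "fdeg f = Max ((\<lambda>x. length (fst x)) ` supp f)"
  unfolding fdeg_def supp_def setcompr_eq_image ..

lemma top_eqI:
  assumes "finite (supp f)" "\<And>x. f x \<noteq> 0 \<Longrightarrow> length (fst x) \<le> L" "f x0 \<noteq> 0" "length (fst x0) = L"
    and "\<And>x. h x = (if length (fst x) = L then f x else 0)"
  shows "top f = h"
proof -
  have "L \<in> (\<lambda>x. length (fst x)) ` supp f"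
    using assms(3,4) by (intro image_eqI[of _ _ x0]) (simp_all add: supp_def)
  moreover have "l \<le> L" if "l \<in> (\<lambda>x. length (fst x)) ` supp f" for l
    using that assms(2) unfolding supp_def by blast
  ultimately have "fdeg f = L" unfolding fdeg_eq_Max
    using assms(1) by (intro Max_eqI) auto
  then show ?thesis using assms(5) by (simp add: top_def fun_eq_iff)
qed

lemma fdeg_ge: "finite (supp f) \<Longrightarrow> f x \<noteq> 0 \<Longrightarrow> length (fst x) \<le> fdeg f"
  unfolding fdeg_eq_Max by (rule Max_ge) (simp_all add: supp_def)

lemma fdeg_attained:
  assumes "finite (supp f)" "f x \<noteq> 0"
  obtains y where "f y \<noteq> 0" "length (fst y) = fdeg f"
proof -
  have "x \<in> supp f" using assms by (simp add: supp_def)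
  then have "fdeg f \<in> (\<lambda>x. length (fst x)) ` supp f"
    unfolding fdeg_eq_Max using assms(1) by (intro Max_in) auto
  then show thesis using that unfolding supp_def by force
qed

context cochain
begin

lemma rel_valid: 
  assumes "i < n" "j < n" "x \<in> supp (rel n KL KC i j)"
  shows "valid_basis n x"
proof (rule ccontr)
  assume x: "\<not> valid_basis n x"
  have "bv [k] h x = 0" "bv [] h x = 0" if "h \<in> Sym n" "k < n" for h k
    using x that by (auto simp: bv_apply valid_basis_def)
  moreover have "bv [i, j] id x = 0" "bv [j, i] id x = 0"
    using x assms(1,2) by (auto simp: bv_apply valid_basis_def)
  ultimately have "rel n KL KC i j x = 0"
    using assms(1) by (simp add: rel_def)
  with assms(3) show False by (simp add: supp_def)
qed

lemma rel_ideal_valid: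
  assumes "f \<in> rel_ideal n KL KC"
  shows "finite (supp f) \<and> (\<forall>x\<in>supp f. valid_basis n x)"
  using assms unfolding rel_ideal_sandwich
proof (induction rule: cspan_induct)
  case zero
  then show ?case by (simp add: supp_def)
next
  case (add f h)
  have "supp (\<lambda>z. f z + h z) \<subseteq> supp f \<union> supp h" by (auto simp: supp_def)
  with add show ?case by (auto simp: supp_add_finite)
next
  case (scale c f)
  then obtain u p v q i j where f: "f = sandwich u p v q (rel n KL KC i j)"
    "valid_basis n (u, p)" "valid_basis n (v, q)" "i < j" "j < n" by blast
  have "supp (\<lambda>z. c * f z) \<subseteq> supp f" by (auto simp: supp_def)
  moreover have "\<forall>x\<in>supp f. valid_basis n x"
    using f supp_sandwich_valid[OF finite_supp_rel rel_valid] by (meson less_trans)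
  ultimately show ?case
    by (auto simp: f supp_scale_finite sandwich_finite)
qed

text \<open>The \<kappa>-terms have shorter words, and the leading commutator does not cancel
  because \<open>p i\<close> and \<open>p j\<close> differ.\<close>

lemma top_sandwich_rel:
  assumes "i < j" "p \<in> Sym n"
  shows "top (sandwich u p v q (rel n KL KC i j)) = sandwich u p v q (commutator i j)"
proof (rule top_eqI)
  show "finite (supp (sandwich u p v q (rel n KL KC i j)))"
    by (simp add: sandwich_finite)
  let ?L = "length u + length v + 2"
  have low: "bv (u @ p k # map (p \<circ> h) v) (p \<circ> h \<circ> q) x = 0" "bv (u @ map (p \<circ> h) v) (p \<circ> h \<circ> q) x = 0"
    if "length (fst x) \<ge> ?L" for x h k
    using that by (auto simp: bv_apply)
  have high: "bv (u @ a # b # map p v) (p \<circ> q) x = 0" if "length (fst x) \<noteq> ?L" for x a b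
    using that by (auto simp: bv_apply)
  have top: "sandwich u p v q (rel n KL KC i j) x = sandwich u p v q (commutator i j) x" if "length (fst x) \<ge> ?L" for x
    using low[OF that] by (simp add: sandwich_rel sandwich_commutator)
  show "length (fst x) \<le> ?L" if "sandwich u p v q (rel n KL KC i j) x \<noteq> 0" for x
  proof (rule ccontr)
    assume "\<not> length (fst x) \<le> ?L"
    with that top[of x] high[of x] show False by (simp add: sandwich_commutator)
  qed
  show "sandwich u p v q (commutator i j) x = (if length (fst x) = ?L then sandwich u p v q (rel n KL KC i j) x else 0)" for x
    using top[of x] high[of x] by (auto simp: sandwich_commutator)
  show "sandwich u p v q (rel n KL KC i j) (u @ p i # p j # map p v, p \<circ> q) \<noteq> 0"
    using assms by (subst top) (auto simp: sandwich_commutator bv_apply)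
qed simp

text \<open>True for every \<kappa>, since commutators are the leading terms of the relations; the
  PBW property is the reverse inclusion.\<close>

lemma comm_ideal_subset_top: "comm_ideal n \<subseteq> cspan (top ` rel_ideal n KL KC)"
  unfolding comm_ideal_sandwich
proof (rule cspan_least, rule subsetI)
  fix f assume "f \<in> {sandwich u p v q (commutator i j) | u p v q i j.
      valid_basis n (u, p) \<and> valid_basis n (v, q) \<and> i < j \<and> j < n}"
  then obtain u p v q i j where f: "f = sandwich u p v q (commutator i j)"
    "valid_basis n (u, p)" "valid_basis n (v, q)" "i < j" "j < n" by blast
  have "sandwich u p v q (rel n KL KC i j) \<in> rel_ideal n KL KC"
    unfolding rel_ideal_sandwich using f by (intro cspan_superset) blast
  moreover have "f = top (sandwich u p v q (rel n KL KC i j))"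
    using f by (simp add: top_sandwich_rel valid_basis_def)
  ultimately show "f \<in> cspan (top ` rel_ideal n KL KC)"
    by (blast intro: cspan_superset)
qed

end

context pbw_cochain
begin

text \<open>Normal form coefficients descend to the quotient: this is \<open>N_respects\<close> read
  on the generators of the ideal.\<close>

lemma lin_ext_N_rel_ideal:
  assumes "f \<in> rel_ideal n KL KC"
  shows "finite (supp f) \<and> lin_ext (N z) f = 0"
  using assms unfolding rel_ideal_sandwich
proof (induction rule: cspan_induct)
  case zero
  then show ?case by (simp add: supp_def lin_ext_def)
next
  case (add f h)
  then show ?case by (simp add: supp_add_finite lin_ext_add)
next
  case (scale c f)
  then obtain u p v q i j where f: "f = sandwich u p v q (rel n KL KC i j)"
    "valid_basis n (u, p)" "valid_basis n (v, q)" "i < j" "j < n" by blast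
  have pq: "p \<in> Sym n" "q \<in> Sym n" "set u \<subseteq> {..<n}" "set v \<subseteq> {..<n}" using f by (auto simp: valid_basis_def)
  have "lin_ext (N z) f = N z (u @ p i # p j # map p v) (p \<circ> q) - N z (u @ p j # p i # map p v) (p \<circ> q)
     - Kap (N z) u (p i) (p j) (map p v) (p \<circ> q)"
    unfolding f(1) using pq f
    by (simp add: lin_ext_sandwich lin_ext_rel Kap_conj sum_W1 comp_assoc)
  also have "\<dots> = 0"
  proof -
    have "set (u @ p i # p j # map p v) \<subseteq> {..<n}" using pq f by auto
    then show ?thesis using N_respects[of u "p i" "p j" "map p v" "p \<circ> q" z] pq by simp
  qed
  finally show ?case
    by (simp add: f(1) sandwich_finite supp_scale_finite lin_ext_scale)
qed

text \<open>For \<open>f\<close> in the ideal and \<open>z\<close> of top degree, \<open>N z\<close>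
  sees only the leading words of \<open>f\<close>, each as its sorted word. So sorting turns
  \<open>top f\<close> into zero, and \<open>top f\<close> is a combination of differences
  \<open>w - sort w\<close>, which lie in the commutator ideal.\<close>

theorem pbw: "DOA n KL KC"
  unfolding DOA_def
proof
  show "comm_ideal n \<subseteq> cspan (top ` rel_ideal n KL KC)" by (rule comm_ideal_subset_top)
  have "top f \<in> comm_ideal n" if f: "f \<in> rel_ideal n KL KC" for f
  proof (cases "\<exists>x. f x \<noteq> 0")
    case False
    then have "top f = (\<lambda>z. 0)" by (auto simp: top_def)
    then show ?thesis using cspan_0 by (simp add: comm_ideal_sandwich)
  next
    case True
    have fin: "finite (supp f)" and valid: "\<And>x. x \<in> supp f \<Longrightarrow> valid_basis n x"
      using rel_ideal_valid[OF f] by auto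
    define S where "S = {x \<in> supp f. length (fst x) = fdeg f}"
    have "finite S" using fin by (simp add: S_def)
    have class_sum: "(\<Sum>x\<in>S. f x * bv (sort (fst x)) (snd x) z) = 0" for z
    proof (cases "length (fst z) = fdeg f")
      case True
      have "0 = lin_ext (N z) f" using lin_ext_N_rel_ideal[OF f] by simp
      also have "\<dots> = (\<Sum>x\<in>S. f x * N z (fst x) (snd x))"
        unfolding lin_ext_def
      proof (rule sum.mono_neutral_right)
        show "\<forall>x\<in>supp f - S. f x * N z (fst x) (snd x) = 0"
        proof
          fix x assume x: "x \<in> supp f - S"
          then have "length (fst x) < length (fst z)"
            using fdeg_ge[OF fin, of x] True by (auto simp: S_def supp_def)
          then show "f x * N z (fst x) (snd x) = 0" by (simp add: N_shorter)
        qed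
      qed (use fin S_def in auto)
      also have "\<dots> = (\<Sum>x\<in>S. f x * bv (sort (fst x)) (snd x) z)"
        by (intro sum.cong refl) (use True in \<open>auto simp: S_def N_same_length bv_apply\<close>)
      finally show ?thesis by simp
    next
      case False
      then have "bv (sort (fst x)) (snd x) z = 0" if "x \<in> S" for x
        using that by (auto simp: bv_apply S_def)
      then show ?thesis by simp
    qed
    have "top f z = (\<Sum>x\<in>S. f x * (bv (fst x) (snd x) z - bv (sort (fst x)) (snd x) z))" for z
    proof -
      have "(\<Sum>x\<in>S. f x * bv (fst x) (snd x) z) = (\<Sum>x\<in>S. if x = z then f x else 0)"
        by (intro sum.cong) (auto simp: bv_apply)
      also have "\<dots> = top f z"
        using \<open>finite S\<close> by (auto simp: S_def top_def supp_def)
      finally show ?thesis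
        using class_sum[of z] by (simp add: right_diff_distrib sum_subtractf)
    qed
    then have "top f = (\<lambda>z. \<Sum>x\<in>S. f x * (bv (fst x) (snd x) z - bv (sort (fst x)) (snd x) z))"
      by (rule HOL.ext)
    also have "\<dots> \<in> comm_ideal n"
    proof -
      have "(\<lambda>z. bv (fst x) (snd x) z - bv (sort (fst x)) (snd x) z) \<in> comm_ideal n" if "x \<in> S" for x
        by (rule comm_ideal_sort) (use valid[of x] that in \<open>auto simp: S_def valid_basis_def\<close>)
      then show ?thesis
        unfolding comm_ideal_sandwich by (intro cspan_sum cspan_scale)
    qed
    finally show ?thesis .
  qed
  then show "cspan (top ` rel_ideal n KL KC) \<subseteq> comm_ideal n"
    unfolding comm_ideal_sandwich by (intro cspan_least) auto
qed

end

section \<open>Conditions forced by the Drinfeld property\<close>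

locale drinfeld_cochain = cochain +
  assumes DOA: "DOA n KL KC"
begin

lemma top_in_comm_ideal: "f \<in> rel_ideal n KL KC \<Longrightarrow> top f \<in> comm_ideal n"
  using DOA unfolding DOA_def by (blast intro: cspan_superset)

text \<open>Leading terms of ideal elements lie in the commutator ideal, which starts in degree
  two.\<close>

lemma rel_ideal_low_degree:
  assumes "f \<in> rel_ideal n KL KC" "\<And>w g. f (w, g) \<noteq> 0 \<Longrightarrow> length w \<le> 1"
  shows "f x = 0"
proof (rule ccontr)
  assume "f x \<noteq> 0"
  have "finite (supp f)" using rel_ideal_valid[OF assms(1)] by simp
  from fdeg_attained[OF this \<open>f x \<noteq> 0\<close>] obtain y where y: "f y \<noteq> 0" "length (fst y) = fdeg f" .
  obtain w g where wg: "y = (w, g)" by (cases y)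
  have "top f (w, g) = 0"
    using comm_ideal_vanish[OF top_in_comm_ideal[OF assms(1)]] assms(2)[of w g] y wg by auto
  then show False using y wg by (simp add: top_def)
qed

lemma rel_ideal_degree_two:
  assumes "f \<in> rel_ideal n KL KC" "\<And>w g. f (w, g) \<noteq> 0 \<Longrightarrow> length w \<le> 2"
  shows "f ([m, l], h) + f ([l, m], h) = 0"
proof (cases "f ([m, l], h) = 0 \<and> f ([l, m], h) = 0")
  case False
  then obtain x where x: "f x \<noteq> 0" "length (fst x) = 2" by auto
  have fin: "finite (supp f)" using rel_ideal_valid[OF assms(1)] by simp
  have "fdeg f = 2"
    using fdeg_ge[OF fin x(1)] x(2) fdeg_attained[OF fin x(1)] assms(2) by (metis le_antisym prod.collapse)
  moreover have "top f ([m, l], h) + top f ([l, m], h) = 0"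
    using comm_ideal_vanish[OF top_in_comm_ideal[OF assms(1)]] by blast
  ultimately show ?thesis by (simp add: top_def)
qed simp

lemma sandwich_rel_in:
  assumes "valid_basis n (u, p)" "valid_basis n (v, q)" "i < n" "j < n"
  shows "sandwich u p v q (rel n KL KC i j) \<in> rel_ideal n KL KC"
proof -
  have alt: "sandwich u p v q (rel n KL KC i j) = (\<lambda>z. (-1) * sandwich u p v q (rel n KL KC j i) z)" for i j
  proof
    fix z
    have "KL h i j k = - KL h j i k" "KC h i j = - KC h j i" for h k by (rule KL_alt KC_alt)+
    then show "sandwich u p v q (rel n KL KC i j) z = (-1) * sandwich u p v q (rel n KL KC j i) z"
      by (simp add: sandwich_rel sum_negf sum.distrib sum_subtractf)
  qed
  show ?thesis
  proof (cases i j rule: linorder_cases)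
    case less
    then show ?thesis unfolding rel_ideal_sandwich using assms by (intro cspan_superset) blast
  next
    case equal
    have "sandwich u p v q (rel n KL KC i j) = (\<lambda>z. 0)"
    proof
      fix z show "sandwich u p v q (rel n KL KC i j) z = 0"
        using fun_cong[OF alt[of i i], of z] by (simp add: equal)
    qed
    then show ?thesis by (simp add: rel_ideal_sandwich cspan_0)
  next
    case greater
    then have "sandwich u p v q (rel n KL KC j i) \<in> rel_ideal n KL KC"
      unfolding rel_ideal_sandwich using assms by (intro cspan_superset) blast
    then show ?thesis
      unfolding alt[of i j] rel_ideal_sandwich by (rule cspan_scale)
  qed
qed

lemma coefficient_linear:
  assumes "g \<in> Sym n" "k < n"
  shows "(\<Sum>h\<in>Sym n. (\<Sum>m<n. A h m * bv [m] h ([k], g)) + B h * bv [] h ([k], g)) = A g k"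
proof -
  have "(\<Sum>m<n. A h m * bv [m] h ([k], g)) = (if h = g then A h k else 0)" for h
  proof -
    have "(\<Sum>m<n. A h m * bv [m] h ([k], g)) = (\<Sum>m<n. if m = k then (if h = g then A h m else 0) else 0)"
      by (intro sum.cong) (auto simp: bv_apply)
    then show ?thesis using assms by simp
  qed
  then show ?thesis using assms by (simp add: bv_apply)
qed

lemma coefficient_constant:
  assumes "g \<in> Sym n"
  shows "(\<Sum>h\<in>Sym n. (\<Sum>m<n. A h m * bv [m] h ([], g)) + B h * bv [] h ([], g)) = B g"
proof -
  have "(\<Sum>h\<in>Sym n. (\<Sum>m<n. A h m * bv [m] h ([], g)) + B h * bv [] h ([], g)) = (\<Sum>h\<in>Sym n. if h = g then B h else 0)"
    by (intro sum.cong) (auto simp: bv_apply)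
  then show ?thesis using assms by simp
qed

text \<open>The elements \<open>e_m h\<close> and \<open>h\<close> stay linearly independent in the
  quotient. Invariance and \<open>Q2\<close> are read off in this way.\<close>

lemma low_degree_zero:
  assumes "f \<in> rel_ideal n KL KC"
    and "\<And>z. f z = (\<Sum>h\<in>Sym n. (\<Sum>m<n. A h m * bv [m] h z) + B h * bv [] h z)"
    and "g \<in> Sym n"
  shows "k < n \<Longrightarrow> A g k = 0" "B g = 0"
proof -
  have short: "length w \<le> 1" if "f (w, g) \<noteq> 0" for w g
  proof (rule ccontr)
    assume "\<not> length w \<le> 1"
    then have "bv [m] h (w, g) = 0" "bv [] h (w, g) = 0" for m h
      by (auto simp: bv_apply)
    with that show False unfolding assms(2) by simp
  qed
  have 0: "f x = 0" for x
    by (rule rel_ideal_low_degree[OF assms(1)]) (rule short)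
  show "A g k = 0" if "k < n"
    using 0[of "([k], g)"] coefficient_linear[OF assms(3) that, of A B] unfolding assms(2) by simp
  show "B g = 0"
    using 0[of "([], g)"] coefficient_constant[OF assms(3), of A B] unfolding assms(2) by simp
qed

text \<open>Conjugating a relation by \<open>p\<close> and subtracting the relation for
  \<open>p i\<close>, \<open>p j\<close> cancels the quadratic words; the remainder has degree at
  most one.\<close>

lemma conj_invariance:
  assumes p: "p \<in> Sym n" and h: "h \<in> Sym n" and "i < n" "j < n"
  shows "k < n \<Longrightarrow> KL (p \<circ> h \<circ> inv p) (p i) (p j) (p k) = KL h i j k"
    and "KC (p \<circ> h \<circ> inv p) (p i) (p j) = KC h i j"
proof -
  define A where "A g k = KL g (p i) (p j) k - KL (inv p \<circ> g \<circ> p) i j (inv p k)" for g k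
  define B where "B g = KC g (p i) (p j) - KC (inv p \<circ> g \<circ> p) i j" for g
  define f where "f z = sandwich [] p [] (inv p) (rel n KL KC i j) z - sandwich [] id [] id (rel n KL KC (p i) (p j)) z" for z
  have mem: "f \<in> rel_ideal n KL KC"
    unfolding f_def using assms sandwich_rel_in[of "[]" p "[]" "inv p" i j] sandwich_rel_in[of "[]" id "[]" id "p i" "p j"]
    unfolding rel_ideal_sandwich by (intro cspan_diff) (auto simp: valid_basis_def)
  have "(\<Sum>h\<in>Sym n. (\<Sum>k<n. KL h i j k * bv [p k] (p \<circ> h \<circ> inv p) z) + KC h i j * bv [] (p \<circ> h \<circ> inv p) z)
    = (\<Sum>h\<in>Sym n. (\<Sum>k<n. KL (inv p \<circ> h \<circ> p) i j (inv p k) * bv [k] h z) + KC (inv p \<circ> h \<circ> p) i j * bv [] h z)" for z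
  proof -
    have e: "inv p \<circ> (p \<circ> h \<circ> inv p) \<circ> p = h" for h
      using p by (auto simp: fun_eq_iff)
    have k: "(\<Sum>k<n. KL h i j (inv p k) * bv [k] g z) = (\<Sum>k<n. KL h i j k * bv [p k] g z)" for g h
      by (subst sum_lessThan_Sym[OF p]) (use p in simp)
    have "(\<Sum>h\<in>Sym n. (\<Sum>k<n. KL (inv p \<circ> h \<circ> p) i j (inv p k) * bv [k] h z) + KC (inv p \<circ> h \<circ> p) i j * bv [] h z)
      = (\<Sum>h\<in>Sym n. (\<Sum>k<n. KL (inv p \<circ> (p \<circ> h \<circ> inv p) \<circ> p) i j (inv p k) * bv [k] (p \<circ> h \<circ> inv p) z)
        + KC (inv p \<circ> (p \<circ> h \<circ> inv p) \<circ> p) i j * bv [] (p \<circ> h \<circ> inv p) z)"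
      by (rule sum_Sym_conj[OF p])
    then show ?thesis unfolding e k by simp
  qed
  then have "f z = (\<Sum>h\<in>Sym n. (\<Sum>m<n. A h m * bv [m] h z) + B h * bv [] h z)" for z
    unfolding f_def A_def B_def using p
    by (simp add: sandwich_rel left_diff_distrib sum_subtractf sum.distrib)
  note 0 = low_degree_zero[OF mem this]
  have e: "inv p \<circ> (p \<circ> h \<circ> inv p) \<circ> p = h" for h
    using p by (auto simp: fun_eq_iff)
  show "KL (p \<circ> h \<circ> inv p) (p i) (p j) (p k) = KL h i j k" if "k < n"
    using 0(1)[of "p \<circ> h \<circ> inv p" "p k"] p h that by (simp add: A_def e)
  show "KC (p \<circ> h \<circ> inv p) (p i) (p j) = KC h i j"
    using 0(2)[of "p \<circ> h \<circ> inv p"] p h by (simp add: B_def e)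
qed

text \<open>In the cyclic sum of \<open>e_k r - r e_k\<close> over the relations \<open>r\<close>
  the cubic words cancel, and the \<kappa>-terms are exactly \<open>Jac\<close>.\<close>

lemma Jac_in_rel_ideal:
  assumes "i < n" "j < n" "k < n"
  shows "(\<lambda>z. Jac (\<lambda>w h. bv w h z) i j k) \<in> rel_ideal n KL KC"
proof -
  define X where "X i j k z = sandwich [k] id [] id (rel n KL KC i j) z - sandwich [] id [k] id (rel n KL KC i j) z" for i j k z
  have X: "X i j k \<in> rel_ideal n KL KC" if "i < n" "j < n" "k < n" for i j k
    unfolding X_def using that sandwich_rel_in[of "[k]" id "[]" id i j] sandwich_rel_in[of "[]" id "[k]" id i j]
    unfolding rel_ideal_sandwich by (intro cspan_diff) (auto simp: valid_basis_def)
  have "(\<lambda>z. cyc (\<lambda>i j k. X i j k z) i j k) \<in> rel_ideal n KL KC"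
    using X assms unfolding rel_ideal_sandwich by (intro cspan_add)
  moreover have "cyc (\<lambda>i j k. X i j k z) i j k = Jac (\<lambda>w h. bv w h z) i j k" for z
  proof -
    have "X i j k z = (bv [k, i, j] id z - bv [k, j, i] id z - bv [i, j, k] id z + bv [j, i, k] id z)
      + (\<Sum>h\<in>Sym n. (\<Sum>m<n. KL h i j m * (bv [m, h k] h z - bv [k, m] h z)) + KC h i j * (bv [h k] h z - bv [k] h z))" for i j k
      by (simp add: X_def sandwich_rel right_diff_distrib sum_subtractf sum.distrib)
    then show ?thesis unfolding Jac_def by simp
  qed
  ultimately show ?thesis by simp
qed

text \<open>\<open>Jac\<close> has degree at most two, so its quadratic coefficients vanish or form
  a leading term; in both cases they are antisymmetric.\<close>

lemma Q1_symmetric: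
  assumes "i < n" "j < n" "k < n" "h \<in> Sym n" "m < n" "l < n"
  shows "Q1 i j k h m l + Q1 i j k h l m = 0"
proof -
  define f where "f z = Jac (\<lambda>w h. bv w h z) i j k" for z
  have mem: "f \<in> rel_ideal n KL KC"
    unfolding f_def using Jac_in_rel_ideal[OF assms(1-3)] .
  define R where "R z = cyc (\<lambda>i j k. \<Sum>h\<in>Sym n. KC h i j * (bv [h k] h z - bv [k] h z)) i j k" for z
  have f: "f z = (\<Sum>h\<in>Sym n. \<Sum>m<n. \<Sum>l<n. Q1 i j k h m l * bv [m, l] h z) + R z" for z
  proof -
    have "(\<Sum>h\<in>Sym n. \<Sum>m<n. \<Sum>l<n. Q1 i j k h m l * bv [m, l] h z)
      = (\<Sum>h\<in>Sym n. cyc (\<lambda>i j k. \<Sum>m<n. KL h i j m * (bv [m, h k] h z - bv [k, m] h z)) i j k)"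
      using assms by (intro sum.cong refl sum_Q1)
    then show ?thesis
      unfolding f_def Jac_def R_def by (simp add: sum.distrib)
  qed
  have R: "R (w, g) = 0" if "length w \<noteq> 1" for w g
  proof -
    have "bv [x] h (w, g) = 0" for x h using that by (auto simp: bv_apply)
    then show ?thesis by (simp add: R_def)
  qed
  have eval: "f ([m, l], h) = Q1 i j k h m l" if "m < n" "l < n" for m l
  proof -
    have "(\<Sum>h'\<in>Sym n. \<Sum>m'<n. \<Sum>l'<n. Q1 i j k h' m' l' * bv [m', l'] h' ([m, l], h))
      = (\<Sum>h'\<in>Sym n. if h' = h then (\<Sum>m'<n. if m' = m then (\<Sum>l'<n. if l' = l then Q1 i j k h' m' l' else 0) else 0) else 0)"
    proof (intro sum.cong refl)
      fix h'
      show "(\<Sum>m'<n. \<Sum>l'<n. Q1 i j k h' m' l' * bv [m', l'] h' ([m, l], h))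
        = (if h' = h then (\<Sum>m'<n. if m' = m then (\<Sum>l'<n. if l' = l then Q1 i j k h' m' l' else 0) else 0) else 0)"
      proof (cases "h' = h")
        case True
        have "(\<Sum>l'<n. Q1 i j k h' m' l' * bv [m', l'] h' ([m, l], h))
          = (if m' = m then (\<Sum>l'<n. if l' = l then Q1 i j k h' m' l' else 0) else 0)" for m'
          using True by (cases "m' = m") (auto simp: bv_apply intro!: sum.cong)
        then show ?thesis using True by simp
      qed (simp add: bv_apply)
    qed
    then show ?thesis using that assms R[of "[m, l]" h] by (simp add: f)
  qed
  have short: "length w \<le> 2" if "f (w, g) \<noteq> 0" for w g
  proof (rule ccontr)
    assume "\<not> length w \<le> 2"
    then have "bv [m, l] h (w, g) = 0" "R (w, g) = 0" for m l h
      using R[of w g] by (auto simp: bv_apply)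
    with that show False unfolding f by simp
  qed
  have "f ([m, l], h) + f ([l, m], h) = 0"
    by (rule rel_ideal_degree_two[OF mem]) (rule short)
  then show ?thesis using eval assms by simp
qed

text \<open>Subtracting multiples of the relations from \<open>2 * Jac\<close> removes the
  antisymmetric quadratic part; by \<open>jacobi_identity\<close> the remainder has the coefficients
  \<open>Q2\<close> and \<open>Q3\<close>.\<close>

lemma Q2_zero:
  assumes "i < n" "j < n" "k < n" "f \<in> Sym n" "l < n"
  shows "Q2 i j k f l = 0"
proof -
  define F where "F z = 2 * Jac (\<lambda>w h. bv w h z) i j k
    - (\<Sum>h\<in>Sym n. \<Sum>m<n. \<Sum>l<n. Q1 i j k h m l * sandwich [] id [] h (rel n KL KC m l) z)" for z
  have "F \<in> rel_ideal n KL KC"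
  proof -
    have "(\<lambda>z. sandwich [] id [] h (rel n KL KC m l) z) \<in> rel_ideal n KL KC"
      if "h \<in> Sym n" "m \<in> {..<n}" "l \<in> {..<n}" for h m l
      using that by (intro sandwich_rel_in) (auto simp: valid_basis_def)
    then show ?thesis
      using Jac_in_rel_ideal[OF assms(1-3)] unfolding F_def rel_ideal_sandwich
      by (intro cspan_diff cspan_sum cspan_scale)
  qed
  moreover have "F z = (\<Sum>f\<in>Sym n. (\<Sum>l<n. Q2 i j k f l * bv [l] f z) + Q3 i j k f * bv [] f z)" for z
  proof -
    have "sandwich [] id [] h (rel n KL KC m l) z
      = bv [m, l] h z - bv [l, m] h z - Kap (\<lambda>w h. bv w h z) [] m l [] h" for h m l
      by (simp add: sandwich_rel Kap_def)
    then show ?thesis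
      unfolding F_def using jacobi_identity[OF Q1_symmetric[OF assms(1-3)] assms(1-3), of "\<lambda>w h. bv w h z"]
      by (simp add: sum.distrib)
  qed
  ultimately show ?thesis
    using low_degree_zero(1)[of F "Q2 i j k" "Q3 i j k" f l] assms by blast
qed

end

section \<open>Three-cycles and five-cycles\<close>

lemma cyc3_apply:
  "distinct [x, y, z] \<Longrightarrow> cyc3 x y z t = (if t = x then y else if t = y then z else if t = z then x else t)"
  by (auto simp: cyc3_def transpose_def)

lemma cyc3_eqI:
  assumes "distinct [x, y, z]" "g x = y" "g y = z" "g z = x" "\<And>t. t \<notin> {x, y, z} \<Longrightarrow> g t = t"
  shows "g = cyc3 x y z"
proof
  fix t show "g t = cyc3 x y z t"
    using assms(2-4) assms(5)[of t] unfolding cyc3_apply[OF assms(1)] by auto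
qed

definition cyc5 :: "nat \<Rightarrow> nat \<Rightarrow> nat \<Rightarrow> nat \<Rightarrow> nat \<Rightarrow> nat \<Rightarrow> nat" where
  "cyc5 x0 x1 x2 x3 x4 = cycle_of_list [x0, x1, x2, x3, x4]"

lemma cyc5_apply:
  "distinct [x0, x1, x2, x3, x4] \<Longrightarrow> cyc5 x0 x1 x2 x3 x4 t = (if t = x0 then x1 else if t = x1 then x2
     else if t = x2 then x3 else if t = x3 then x4 else if t = x4 then x0 else t)"
  by (auto simp: cyc5_def transpose_def)

abbreviation is3 :: "nat \<Rightarrow> (nat \<Rightarrow> nat) \<Rightarrow> bool" where "is3 n \<equiv> is_kcycle n 3"
abbreviation is5 :: "nat \<Rightarrow> (nat \<Rightarrow> nat) \<Rightarrow> bool" where "is5 n \<equiv> is_kcycle n 5"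

lemma is3_iff: "is3 n g \<longleftrightarrow> (\<exists>x y z. distinct [x, y, z] \<and> x < n \<and> y < n \<and> z < n \<and> g = cyc3 x y z)"
  unfolding is_kcycle_def cyc3_def by (auto simp: numeral_3_eq_3 length_Suc_conv) fastforce+

lemma is5_iff: "is5 n g \<longleftrightarrow> (\<exists>x0 x1 x2 x3 x4. distinct [x0, x1, x2, x3, x4] \<and> x0 < n \<and> x1 < n
    \<and> x2 < n \<and> x3 < n \<and> x4 < n \<and> g = cyc5 x0 x1 x2 x3 x4)"
proof
  assume "is5 n g"
  then obtain xs where "length xs = 5" "distinct xs" "set xs \<subseteq> {..<n}" "g = cycle_of_list xs"
    unfolding is_kcycle_def by blast
  moreover from this(1) obtain x0 x1 x2 x3 x4 where "xs = [x0, x1, x2, x3, x4]"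
    by (auto simp: eval_nat_numeral length_Suc_conv)
  ultimately show "\<exists>x0 x1 x2 x3 x4. distinct [x0, x1, x2, x3, x4] \<and> x0 < n \<and> x1 < n
    \<and> x2 < n \<and> x3 < n \<and> x4 < n \<and> g = cyc5 x0 x1 x2 x3 x4"
    unfolding cyc5_def by (intro exI[of _ x0] exI[of _ x1] exI[of _ x2] exI[of _ x3] exI[of _ x4]) auto
next
  assume "\<exists>x0 x1 x2 x3 x4. distinct [x0, x1, x2, x3, x4] \<and> x0 < n \<and> x1 < n
    \<and> x2 < n \<and> x3 < n \<and> x4 < n \<and> g = cyc5 x0 x1 x2 x3 x4"
  then obtain x0 x1 x2 x3 x4 where "distinct [x0, x1, x2, x3, x4] \<and> x0 < n \<and> x1 < n
    \<and> x2 < n \<and> x3 < n \<and> x4 < n \<and> g = cyc5 x0 x1 x2 x3 x4" by blast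
  then show "is5 n g"
    unfolding is_kcycle_def cyc5_def by (intro exI[of _ "[x0, x1, x2, x3, x4]"]) auto
qed

lemma kcycle_Sym: "is_kcycle n k g \<Longrightarrow> g \<in> Sym n"
  unfolding is_kcycle_def Sym_def using permutes_subset[OF cycle_permutes] by blast

lemma kcycle_conj:
  assumes "p \<in> Sym n" "is_kcycle n k g"
  shows "is_kcycle n k (p \<circ> g \<circ> inv p)"
proof -
  obtain xs where xs: "length xs = k" "distinct xs" "set xs \<subseteq> {..<n}" "g = cycle_of_list xs"
    using assms(2) unfolding is_kcycle_def by blast
  have "p \<circ> g \<circ> inv p = cycle_of_list (map p xs)"
    unfolding xs(4) using xs(2) Sym_bij[OF assms(1)] by (rule conjugation_of_cycle)
  moreover have "distinct (map p xs)"
    using xs(2) Sym_bij[OF assms(1)] by (simp add: distinct_map bij_def inj_on_def)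
  ultimately show ?thesis
    unfolding is_kcycle_def using xs assms(1) by (intro exI[of _ "map p xs"]) auto
qed

lemma kcycle_conj_iff:
  assumes "p \<in> Sym n"
  shows "is_kcycle n k (p \<circ> g \<circ> inv p) \<longleftrightarrow> is_kcycle n k g"
proof
  assume "is_kcycle n k (p \<circ> g \<circ> inv p)"
  from kcycle_conj[OF Sym_inv[OF assms] this] show "is_kcycle n k g"
    using assms by (simp add: comp_assoc comp_assoc[symmetric, of "inv p" p])
qed (rule kcycle_conj[OF assms])

lemma is3_canonical:
  assumes "is3 n g" "g p \<noteq> p"
  shows "g = cyc3 p (g p) (g (g p))" "distinct [p, g p, g (g p)]" "p < n" "g (g (g p)) = p"
proof -
  obtain x y z where d: "distinct [x, y, z]" and g: "x < n" "y < n" "z < n" "g = cyc3 x y z"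
    using assms(1) unfolding is3_iff by blast
  have ap: "g t = (if t = x then y else if t = y then z else if t = z then x else t)" for t
    unfolding g(4) by (rule cyc3_apply[OF d])
  have p: "p \<in> {x, y, z}" using assms(2) by (auto simp: ap split: if_splits)
  show dp: "distinct [p, g p, g (g p)]" "p < n" "g (g (g p)) = p"
    using p d g(1-3) by (auto simp: ap)
  have rot: "cyc3 x y z = cyc3 y z x" "cyc3 x y z = cyc3 z x y"
    using d by (auto simp: fun_eq_iff cyc3_apply)
  consider "p = x" "g p = y" "g (g p) = z" | "p = y" "g p = z" "g (g p) = x" | "p = z" "g p = x" "g (g p) = y"
    using p d by (auto simp: ap)
  then show "g = cyc3 p (g p) (g (g p))"
    by cases (use rot g(4) in \<open>simp_all only:\<close>)
qed

lemma is3_fixed: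
  assumes "is3 n g" "g p \<noteq> p" "t \<notin> {p, g p, g (g p)}"
  shows "g t = t"
proof -
  have "g t = cyc3 p (g p) (g (g p)) t"
    by (rule fun_cong[OF is3_canonical(1)[OF assms(1,2)]])
  also have "\<dots> = t"
    using assms(3) by (simp only: cyc3_apply[OF is3_canonical(2)[OF assms(1,2)]]) simp
  finally show ?thesis .
qed

lemma is3_cube: "is3 n g \<Longrightarrow> g (g (g t)) = t"
  using is3_canonical(4)[of n g t] by (cases "g t = t") auto

lemma is3_inv: "is3 n g \<Longrightarrow> inv g = g \<circ> g"
  by (rule inv_equality) (simp_all add: is3_cube)

lemma is3_inv_is3:
  assumes "is3 n g" shows "is3 n (inv g)"
proof -
  obtain x y z where d: "distinct [x, y, z]" "x < n" "y < n" "z < n" "g = cyc3 x y z"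
    using assms unfolding is3_iff by blast
  have "g \<circ> g = cyc3 x z y"
    by (rule cyc3_eqI) (use d in \<open>auto simp: cyc3_apply\<close>)
  then show ?thesis unfolding is3_inv[OF assms] is3_iff using d by (intro exI[of _ x] exI[of _ z] exI[of _ y]) auto
qed

lemma is3_inv_iff: "g \<in> Sym n \<Longrightarrow> is3 n (inv g) \<longleftrightarrow> is3 n g"
  using is3_inv_is3[of n g] is3_inv_is3[of n "inv g"] by auto

lemma is3_moved_pair:
  assumes "is3 n g" "g p \<noteq> p" "g q \<noteq> q" "p \<noteq> q"
  shows "g p = q \<or> g q = p"
proof -
  have "q \<in> {p, g p, g (g p)}"
    using is3_fixed[OF assms(1,2)] assms(3) by blast
  then show ?thesis using assms is3_cube[of n g p] by auto
qed

lemma is3_cyc3: "distinct [x, y, z] \<Longrightarrow> x < n \<Longrightarrow> y < n \<Longrightarrow> z < n \<Longrightarrow> is3 n (cyc3 x y z)"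
  unfolding is3_iff by blast

section \<open>Products of two 3-cycles\<close>

lemma is3_comp_one_shared:
  assumes g: "is3 n g" and h: "is3 n h" and p: "g p \<noteq> p" "h p \<noteq> p"
    and shared: "\<And>t. g t \<noteq> t \<Longrightarrow> h t \<noteq> t \<Longrightarrow> t = p"
  shows "g \<circ> h = cyc5 p (h p) (h (h p)) (g p) (g (g p))"
    and "distinct [p, h p, h (h p), g p, g (g p)]"
proof -
  note cg = is3_canonical[OF g p(1)] and ch = is3_canonical[OF h p(2)]
  have hg: "h (g p) = g p" "h (g (g p)) = g (g p)"
    using shared[of "g p"] shared[of "g (g p)"] cg(2,4) by auto
  have gh: "g (h p) = h p" "g (h (h p)) = h (h p)"
    using shared[of "h p"] shared[of "h (h p)"] ch(2,4) by auto
  show d: "distinct [p, h p, h (h p), g p, g (g p)]"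
    using cg(2) ch(2) hg gh by auto (metis ch(4))+
  show "g \<circ> h = cyc5 p (h p) (h (h p)) (g p) (g (g p))"
  proof
    fix t
    have "g t = t" if "t \<notin> {p, g p, g (g p)}"
      using is3_fixed[OF g p(1) that] .
    moreover have "h t = t" if "t \<notin> {p, h p, h (h p)}"
      using is3_fixed[OF h p(2) that] .
    ultimately show "(g \<circ> h) t = cyc5 p (h p) (h (h p)) (g p) (g (g p)) t"
      unfolding cyc5_apply[OF d] using hg gh cg(4) ch(4) by auto
  qed
qed

text \<open>The number of common moved points decides: one gives a 5-cycle, two a 3-cycle or a
  double transposition, three the inverse 3-cycle or the identity.\<close>

lemma is3_comp_types:
  assumes g: "is3 n g" and h: "is3 n h" and p: "g p \<noteq> p" "h p \<noteq> p"
  shows "is5 n (g \<circ> h) \<or> is3 n (g \<circ> h) \<or> (g \<circ> h) \<circ> (g \<circ> h) = id"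
proof (cases "\<forall>t. g t \<noteq> t \<longrightarrow> h t \<noteq> t \<longrightarrow> t = p")
  case True
  have "p < n" by (rule is3_canonical(3)[OF g p(1)])
  then show ?thesis
    using is3_comp_one_shared[OF g h p] True kcycle_Sym[OF g] kcycle_Sym[OF h]
    unfolding is5_iff by (metis Sym_less_iff)
next
  case False
  \<comment> \<open>Two common points can be named so that \<open>h p = q\<close>, because any two
    moved points of a 3-cycle are adjacent.\<close>
  have main: ?thesis if pq: "p \<noteq> q" "g p \<noteq> p" "h p \<noteq> p" "g q \<noteq> q" "h q \<noteq> q" and hpq: "h p = q" for p q
  proof -
    define z where "z = h q"
    have h': "h = cyc3 p q z" "distinct [p, q, z]"
      using is3_canonical(1,2)[OF h, of p] pq unfolding hpq z_def[symmetric] by simp_all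
    have z: "z < n" "p < n" "q < n"
      using is3_canonical(3)[OF h, of p] is3_canonical(3)[OF h, of q] pq kcycle_Sym[OF h]
      by (auto simp: z_def)
    consider "g p = q" | "g q = p" using is3_moved_pair[OF g] pq by blast
    then show ?thesis
    proof cases
      case 1
      define w where "w = g q"
      have g': "g = cyc3 p q w" "distinct [p, q, w]"
        using is3_canonical(1,2)[OF g, of p] pq unfolding 1 w_def[symmetric] by simp_all
      show ?thesis
      proof (cases "w = z")
        case True
        then have "g \<circ> h = inv h" using is3_inv[OF h] g' h' by simp
        then show ?thesis using is3_inv_is3[OF h] by simp
      next
        case False
        have "(g \<circ> h) \<circ> (g \<circ> h) = id"
        proof
          fix t
          have gh: "g (h t) = (if t = p then w else if t = w then p else if t = q then z else if t = z then q else t)" for t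
            unfolding h'(1) g'(1) cyc3_apply[OF h'(2)] cyc3_apply[OF g'(2)]
            using h'(2) g'(2) False by auto
          show "((g \<circ> h) \<circ> (g \<circ> h)) t = id t"
            unfolding comp_apply gh using h'(2) g'(2) False by auto
        qed
        then show ?thesis by simp
      qed
    next
      case 2
      define w where "w = g p"
      have g': "g = cyc3 q p w" "distinct [q, p, w]"
        using is3_canonical(1,2)[OF g, of q] pq unfolding 2 w_def[symmetric] by simp_all
      show ?thesis
      proof (cases "w = z")
        case True
        have "g \<circ> h = id" using h' g' True by (auto simp: fun_eq_iff cyc3_apply)
        then show ?thesis by simp
      next
        case False
        have "w < n" using is3_canonical(3)[OF g, of p] pq kcycle_Sym[OF g] by (simp add: w_def)
        have d: "distinct [q, z, w]" using h'(2) g'(2) False by auto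
        have "g \<circ> h = cyc3 q z w"
        proof
          fix t show "(g \<circ> h) t = cyc3 q z w t"
            unfolding h'(1) g'(1) comp_apply cyc3_apply[OF d] cyc3_apply[OF h'(2)] cyc3_apply[OF g'(2)]
            using d h'(2) g'(2) by auto
        qed
        then show ?thesis
          using is3_cyc3[OF d] z \<open>w < n\<close> by simp
      qed
    qed
  qed
  from False obtain q where q: "g q \<noteq> q" "h q \<noteq> q" "q \<noteq> p" by blast
  from is3_moved_pair[OF h p(2) q(2)] q(3) have "h p = q \<or> h q = p" by auto
  then show ?thesis
    using main[OF q(3)[symmetric] p q(1,2)] main[OF q(3) q(1,2) p] by (rule disjE)
qed

lemma is5_not_is3: "is5 n f \<Longrightarrow> \<not> is3 n f"
proof
  assume "is5 n f" and 3: "is3 n f"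
  then obtain x0 x1 x2 x3 x4 where "distinct [x0, x1, x2, x3, x4]" "f = cyc5 x0 x1 x2 x3 x4"
    unfolding is5_iff by blast
  then show False using is3_cube[OF 3, of x0] by (auto simp: cyc5_apply)
qed

lemma cyc5_decomp:
  assumes "distinct [x0, x1, x2, x3, x4]"
  shows "cyc5 x0 x1 x2 x3 x4 = cyc3 x0 x3 x4 \<circ> cyc3 x0 x1 x2"
proof
  fix t show "cyc5 x0 x1 x2 x3 x4 t = (cyc3 x0 x3 x4 \<circ> cyc3 x0 x1 x2) t"
    using assms by (auto simp: cyc5_apply cyc3_apply)
qed

lemma cyc5_rotations:
  assumes "distinct [x0, x1, x2, x3, x4]"
  shows "cyc5 x0 x1 x2 x3 x4 = cyc5 x1 x2 x3 x4 x0" "cyc5 x0 x1 x2 x3 x4 = cyc5 x2 x3 x4 x0 x1"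
    "cyc5 x0 x1 x2 x3 x4 = cyc5 x3 x4 x0 x1 x2" "cyc5 x0 x1 x2 x3 x4 = cyc5 x4 x0 x1 x2 x3"
proof -
  have rot: "cyc5 x0 x1 x2 x3 x4 = cyc5 x1 x2 x3 x4 x0"
    if "distinct [x0, x1, x2, x3, x4]" for x0 x1 x2 x3 x4
    using that by (auto simp: fun_eq_iff cyc5_apply)
  show 1: "cyc5 x0 x1 x2 x3 x4 = cyc5 x1 x2 x3 x4 x0" using assms by (rule rot)
  also have "\<dots> = cyc5 x2 x3 x4 x0 x1" by (rule rot) (use assms in auto)
  finally show 2: "cyc5 x0 x1 x2 x3 x4 = cyc5 x2 x3 x4 x0 x1" .
  also have "\<dots> = cyc5 x3 x4 x0 x1 x2" by (rule rot) (use assms in auto)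
  finally show 3: "cyc5 x0 x1 x2 x3 x4 = cyc5 x3 x4 x0 x1 x2" .
  also have "\<dots> = cyc5 x4 x0 x1 x2 x3" by (rule rot) (use assms in auto)
  finally show "cyc5 x0 x1 x2 x3 x4 = cyc5 x4 x0 x1 x2 x3" .
qed

text \<open>Two 3-cycles cover five points only if they share exactly one point \<open>p\<close>;
  the right factor is then \<open>p\<close>, \<open>f p\<close>, \<open>f (f p)\<close>. The five
  choices of \<open>p\<close> give the five factorisations.\<close>

lemma cyc5_factors:
  assumes d: "distinct [x0, x1, x2, x3, x4]" and f: "f = cyc5 x0 x1 x2 x3 x4"
    and h: "is3 n h" and g: "is3 n g" and gh: "g \<circ> h = f"
  shows "h \<in> {cyc3 x0 x1 x2, cyc3 x1 x2 x3, cyc3 x2 x3 x4, cyc3 x3 x4 x0, cyc3 x4 x0 x1}"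
proof -
  have f_app: "f t = (if t = x0 then x1 else if t = x1 then x2 else if t = x2 then x3
      else if t = x3 then x4 else if t = x4 then x0 else t)" for t
    unfolding f by (rule cyc5_apply[OF d])
  have "\<exists>p. g p \<noteq> p \<and> h p \<noteq> p"
  proof (rule ccontr)
    assume disj: "\<not> (\<exists>p. g p \<noteq> p \<and> h p \<noteq> p)"
    have comm: "g (h t) = h (g t)" for t
      using disj by (metis is3_cube[OF g] is3_cube[OF h])
    \<comment> \<open>Disjoint factors commute, so the cube of \<open>f\<close> would be the
      identity.\<close>
    have "f (f (f x0)) = x0"
      unfolding gh[symmetric] by (simp add: comm is3_cube[OF g] is3_cube[OF h])
    then show False using d by (auto simp: f_app)
  qed
  then obtain p where p: "g p \<noteq> p" "h p \<noteq> p" by blast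
  have shared: "t = p" if "g t \<noteq> t" "h t \<noteq> t" for t
  proof (rule ccontr)
    assume "t \<noteq> p"
    \<comment> \<open>Two supports of size three with a second common point cover at most four
      points.\<close>
    let ?G = "{p, g p, g (g p)}" and ?H = "{p, h p, h (h p)}"
    have moved: "x \<in> ?G \<union> ?H" if "f x \<noteq> x" for x
    proof (rule ccontr)
      assume x: "x \<notin> ?G \<union> ?H"
      have "g x = x"
        using x is3_fixed[OF g p(1), of x] by blast
      moreover have "h x = x"
        using x is3_fixed[OF h p(2), of x] by blast
      ultimately show False using \<open>f x \<noteq> x\<close> gh by auto
    qed
    have "{x0, x1, x2, x3, x4} \<subseteq> ?G \<union> ?H"
      using d by (intro subsetI moved) (auto simp: f_app)
    moreover have "card {x0, x1, x2, x3, x4} = 5" using d by simp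
    ultimately have 5: "5 \<le> card (?G \<union> ?H)"
      by (metis card_mono finite.emptyI finite_UnI finite_insert)
    have "t \<in> ?G" "t \<in> ?H"
      using is3_moved_pair[OF g p(1) that(1)] is3_moved_pair[OF h p(2) that(2)] \<open>t \<noteq> p\<close>
        is3_cube[OF g, of p] is3_cube[OF h, of p] is3_cube[OF g, of t] is3_cube[OF h, of t] by auto
    then have "card {p, t} \<le> card (?G \<inter> ?H)"
      by (intro card_mono) auto
    then have "2 \<le> card (?G \<inter> ?H)" using \<open>t \<noteq> p\<close> by simp
    moreover have "card ?G = 3" "card ?H = 3"
      using is3_canonical(2)[OF g p(1)] is3_canonical(2)[OF h p(2)] by auto
    moreover have "card ?G + card ?H = card (?G \<union> ?H) + card (?G \<inter> ?H)"
      by (rule card_Un_Int) auto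
    ultimately show False using 5 by linarith
  qed
  note one = is3_comp_one_shared[OF g h p shared]
  have f_p: "f t = cyc5 p (h p) (h (h p)) (g p) (g (g p)) t" for t
    by (rule fun_cong[OF trans[OF gh[symmetric] one(1)]])
  have fp: "f p = h p" "f (h p) = h (h p)"
    using one(2) by (simp_all add: f_p cyc5_apply)
  have hp: "h = cyc3 p (f p) (f (f p))"
    unfolding fp by (rule is3_canonical(1)[OF h p(2)])
  have "f p \<noteq> p" using fp p by simp
  then have "p \<in> {x0, x1, x2, x3, x4}" by (auto simp: f_app split: if_splits)
  then show ?thesis unfolding hp using d by (auto simp: f_app)
qed

text \<open>Rotating \<open>f\<close> so that the common point comes first makes
  \<open>cyc5_decomp\<close> yield each of the five factorisations.\<close>

lemma sum_cyc5_factors: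
  assumes d: "distinct [x0, x1, x2, x3, x4]" and f: "f = cyc5 x0 x1 x2 x3 x4"
    and less: "x0 < n" "x1 < n" "x2 < n" "x3 < n" "x4 < n"
  shows "(\<Sum>h\<in>Sym n. if is3 n h \<and> is3 n (f \<circ> inv h) then F (f \<circ> inv h) h else 0) =
     F (cyc3 x0 x3 x4) (cyc3 x0 x1 x2) + F (cyc3 x1 x4 x0) (cyc3 x1 x2 x3) + F (cyc3 x2 x0 x1) (cyc3 x2 x3 x4)
     + F (cyc3 x3 x1 x2) (cyc3 x3 x4 x0) + F (cyc3 x4 x2 x3) (cyc3 x4 x0 x1)"
proof -
  let ?h0 = "cyc3 x0 x1 x2" and ?h1 = "cyc3 x1 x2 x3" and ?h2 = "cyc3 x2 x3 x4"
    and ?h3 = "cyc3 x3 x4 x0" and ?h4 = "cyc3 x4 x0 x1"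
  let ?H = "{?h0, ?h1, ?h2, ?h3, ?h4}"
  have is3: "is3 n ?h0" "is3 n ?h1" "is3 n ?h2" "is3 n ?h3" "is3 n ?h4"
    "is3 n (cyc3 x0 x3 x4)" "is3 n (cyc3 x1 x4 x0)" "is3 n (cyc3 x2 x0 x1)" "is3 n (cyc3 x3 x1 x2)" "is3 n (cyc3 x4 x2 x3)"
    using d less by (auto intro!: is3_cyc3)
  note f1 = trans[OF f cyc5_rotations(1)[OF d]] and f2 = trans[OF f cyc5_rotations(2)[OF d]]
    and f3 = trans[OF f cyc5_rotations(3)[OF d]] and f4 = trans[OF f cyc5_rotations(4)[OF d]]
  have quot: "f \<circ> inv h = g" if "f = g \<circ> h" "is3 n h" for g h
    using that kcycle_Sym[of n 3 h] by (simp add: comp_assoc)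
  have quot5: "f \<circ> inv (cyc3 a b c) = cyc3 a d e"
    if "f = cyc5 a b c d e" "is3 n (cyc3 a b c)" "distinct [a, b, c, d, e]" for a b c d e
    by (rule quot) (use that cyc5_decomp[OF that(3)] in simp_all)
  have g: "f \<circ> inv ?h0 = cyc3 x0 x3 x4" "f \<circ> inv ?h1 = cyc3 x1 x4 x0" "f \<circ> inv ?h2 = cyc3 x2 x0 x1"
    "f \<circ> inv ?h3 = cyc3 x3 x1 x2" "f \<circ> inv ?h4 = cyc3 x4 x2 x3"
    using d by (auto intro!: quot5[OF f is3(1)] quot5[OF f1 is3(2)] quot5[OF f2 is3(3)] quot5[OF f3 is3(4)] quot5[OF f4 is3(5)])
  have "(\<Sum>h\<in>Sym n. if is3 n h \<and> is3 n (f \<circ> inv h) then F (f \<circ> inv h) h else 0)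
    = (\<Sum>h\<in>?H. F (f \<circ> inv h) h)"
  proof (rule sum.mono_neutral_cong_right)
    show "?H \<subseteq> Sym n" using is3 kcycle_Sym by blast
    show "\<forall>h\<in>Sym n - ?H. (if is3 n h \<and> is3 n (f \<circ> inv h) then F (f \<circ> inv h) h else 0) = 0"
    proof
      fix h assume h: "h \<in> Sym n - ?H"
      have "\<not> (is3 n h \<and> is3 n (f \<circ> inv h))"
      proof
        assume 3: "is3 n h \<and> is3 n (f \<circ> inv h)"
        have "f \<circ> inv h \<circ> h = f"
          using kcycle_Sym[of n 3 h] 3 by (simp add: comp_assoc)
        then have "h \<in> ?H"
          using cyc5_factors[OF d f, of n h "f \<circ> inv h"] 3 by blast
        then show False using h by blast
      qed
      then show "(if is3 n h \<and> is3 n (f \<circ> inv h) then F (f \<circ> inv h) h else 0) = 0" by (rule if_not_P)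
    qed
    fix h assume "h \<in> ?H"
    then have "is3 n h \<and> is3 n (f \<circ> inv h)" using is3 g by auto
    then show "(if is3 n h \<and> is3 n (f \<circ> inv h) then F (f \<circ> inv h) h else 0) = F (f \<circ> inv h) h" by (rule if_P)
  qed simp
  also have "\<dots> = F (f \<circ> inv ?h0) ?h0 + F (f \<circ> inv ?h1) ?h1 + F (f \<circ> inv ?h2) ?h2 + F (f \<circ> inv ?h3) ?h3 + F (f \<circ> inv ?h4) ?h4"
  proof -
    have neq: "cyc3 a b c \<noteq> cyc3 a' b' c'" if "distinct [a, b, c]" "distinct [a', b', c']" "a \<notin> {a', b', c'}" for a b c a' b' c'
    proof
      assume "cyc3 a b c = cyc3 a' b' c'"
      then have "cyc3 a b c a = cyc3 a' b' c' a" by simp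
      then show False using that by (simp add: cyc3_apply split: if_splits)
    qed
    have "?h0 \<noteq> ?h1" "?h0 \<noteq> ?h2" "?h3 \<noteq> ?h0" "?h4 \<noteq> ?h0" "?h1 \<noteq> ?h2" "?h1 \<noteq> ?h3" "?h4 \<noteq> ?h1" "?h2 \<noteq> ?h3" "?h2 \<noteq> ?h4" "?h3 \<noteq> ?h4"
      by ((rule neq; use d in auto)+)
    then show ?thesis by (simp add: add.assoc eq_commute)
  qed
  finally show ?thesis unfolding g .
qed

lemma Sym_transpose: "x < n \<Longrightarrow> y < n \<Longrightarrow> transpose x y \<in> Sym n"
  unfolding Sym_def by (simp add: permutes_swap_id)

text \<open>Triple transitivity: each further point is placed by a transposition that avoids the
  points already placed.\<close>

lemma exists_Sym_three:
  assumes "distinct [x, y, z]" "distinct [i, j, k]" "x < n" "y < n" "z < n" "i < n" "j < n" "k < n"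
  obtains p where "p \<in> Sym n" "p x = i" "p y = j" "p z = k"
proof -
  obtain p where p: "p \<in> Sym n" "p x = i"
    using Sym_transpose[of x n i] assms by (metis transpose_apply_first)
  obtain q where q: "q \<in> Sym n" "q x = i" "q y = j"
  proof
    show "p \<circ> transpose y (inv p j) \<in> Sym n"
      using p assms by (intro Sym_comp Sym_transpose) simp_all
    have "inv p j \<noteq> x" using p assms by (auto simp: Sym_inv_eq_iff)
    then show "(p \<circ> transpose y (inv p j)) x = i" "(p \<circ> transpose y (inv p j)) y = j"
      using p assms by simp_all
  qed
  show thesis
  proof
    show "q \<circ> transpose z (inv q k) \<in> Sym n"
      using q assms by (intro Sym_comp Sym_transpose) simp_all
    have "inv q k \<noteq> x" "inv q k \<noteq> y" using q assms by (auto simp: Sym_inv_eq_iff)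
    then show "(q \<circ> transpose z (inv q k)) x = i" "(q \<circ> transpose z (inv q k)) y = j"
      "(q \<circ> transpose z (inv q k)) z = k"
      using q assms by simp_all
  qed
qed

section \<open>The family of the theorem: linear part\<close>

text \<open>The permutation matrix of \<open>g\<close> minus its transpose, as an alternating form.
  For a 3-cycle \<open>(x y z)\<close> it is the sum of the wedges of consecutive coordinates,
  \<open>xy + yz + zx\<close>.\<close>

definition om :: "(nat \<Rightarrow> nat) \<Rightarrow> nat \<Rightarrow> nat \<Rightarrow> complex" where
  "om g i j = of_bool (g i = j) - of_bool (g j = i)"

definition moved :: "(nat \<Rightarrow> nat) \<Rightarrow> nat \<Rightarrow> complex" where
  "moved h y = of_bool (h y \<noteq> y)"

text \<open>Closed form of \<open>kapL\<close>: a 3-cycle through \<open>i\<close> and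
  \<open>j\<close> determines its third point, so at most one \<open>k'\<close> contributes. In this
  form alternation and invariance hold for all indices.\<close>

definition famL :: "nat \<Rightarrow> complex \<Rightarrow> complex \<Rightarrow> (nat \<Rightarrow> nat) \<Rightarrow> nat \<Rightarrow> nat \<Rightarrow> nat \<Rightarrow> complex" where
  "famL n a b g i j k = (if is3 n g then om g i j * (if g k \<noteq> k then a else b) else 0)"

text \<open>This is \<open>2 * om (g \<circ> g) - om g\<close>.\<close>

definition om5 :: "(nat \<Rightarrow> nat) \<Rightarrow> nat \<Rightarrow> nat \<Rightarrow> complex" where
  "om5 g i j = 2 * (of_bool (g (g i) = j) - of_bool (g (g j) = i)) - om g i j"

definition famC :: "nat \<Rightarrow> complex \<Rightarrow> complex \<Rightarrow> complex \<Rightarrow> (nat \<Rightarrow> nat) \<Rightarrow> nat \<Rightarrow> nat \<Rightarrow> complex" where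
  "famC n a b c g i j = (if is3 n g then c * om g i j else if is5 n g then (a - b)^2 * om5 g i j else 0)"

lemma om_alt: "om g j i = - om g i j"
  by (simp add: om_def)

lemma om5_alt: "om5 g j i = - om5 g i j"
proof -
  have "2 * (a - b) - - c = - (2 * (b - a) - c)" for a b c :: complex
    by (simp add: algebra_simps)
  then show ?thesis unfolding om5_def om_alt[of g j i] .
qed

lemma om_fixed:
  assumes "g \<in> Sym n"
  shows "g i = i \<Longrightarrow> om g i j = 0" "g j = j \<Longrightarrow> om g i j = 0"
proof -
  show 1: "om g i j = 0" if "g i = i" for i j
    using that Sym_eq_iff[OF assms, of j i] by (auto simp: om_def)
  show "g j = j \<Longrightarrow> om g i j = 0"
    using 1[of j i] om_alt[of g i j] by simp
qed

lemma om5_fixed: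
  assumes "g \<in> Sym n"
  shows "g i = i \<Longrightarrow> om5 g i j = 0" "g j = j \<Longrightarrow> om5 g i j = 0"
proof -
  show 1: "om5 g i j = 0" if "g i = i" for i j
  proof -
    have "g (g j) = i \<longleftrightarrow> j = i"
      using that Sym_eq_iff[OF assms, of j i] Sym_eq_iff[OF assms, of "g j" i] by simp
    then show ?thesis using om_fixed(1)[OF assms that, of j] that by (auto simp: om5_def)
  qed
  show "g j = j \<Longrightarrow> om5 g i j = 0"
    using 1[of j i] om5_alt[of g i j] by simp
qed

lemma om_conj: "p \<in> Sym n \<Longrightarrow> om (p \<circ> g \<circ> inv p) (p i) (p j) = om g i j"
  by (simp add: om_def)

lemma om5_conj: "p \<in> Sym n \<Longrightarrow> om5 (p \<circ> g \<circ> inv p) (p i) (p j) = om5 g i j"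
  by (simp add: om5_def om_def)

lemma moved_conj: "p \<in> Sym n \<Longrightarrow> moved (p \<circ> g \<circ> inv p) k = moved g (inv p k)"
  using Sym_inv_eq_iff[of p n k "g (inv p k)"] by (auto simp: moved_def)

interpretation fam: cochain n "famL n a b" "famC n a b c" for n a b c
proof
  fix g i j k
  show "famL n a b g j i k = - famL n a b g i j k"
    by (simp add: famL_def om_alt[of g j i])
  show "famC n a b c g j i = - famC n a b c g i j"
    by (simp add: famC_def om_alt[of g j i] om5_alt[of g j i])
qed

lemma famL_conj:
  "p \<in> Sym n \<Longrightarrow> famL n a b (p \<circ> h \<circ> inv p) (p i) (p j) (p k) = famL n a b h i j k"
  by (simp add: famL_def kcycle_conj_iff om_conj del: comp_apply) simp

lemma famC_conj:
  "p \<in> Sym n \<Longrightarrow> famC n a b c (p \<circ> h \<circ> inv p) (p i) (p j) = famC n a b c h i j"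
  by (simp add: famC_def kcycle_conj_iff om_conj om5_conj del: comp_apply)

text \<open>This is the vector identity \<open>\<Sum> om\<^sub>h(i,j) (h e\<^sub>k - e\<^sub>k) = 0\<close>, tested against a linear functional \<open>S\<close>.\<close>

lemma om_cyc:
  fixes S :: "nat \<Rightarrow> complex"
  assumes "is3 n h"
  shows "cyc (\<lambda>i j k. om h i j * (S (h k) - S k)) i j k = 0"
proof -
  have h: "h \<in> Sym n" using assms by (rule kcycle_Sym)
  have fixed: "cyc (\<lambda>i j k. om h i j * (S (h k) - S k)) i j k = 0" if "h i = i" for i j k
    using that om_fixed[OF h that] by simp
  show ?thesis
  proof (cases "h i = i \<or> h j = j \<or> h k = k")
    case True
    then show ?thesis
      by (elim disjE) (use fixed[of i j k] fixed[of j k i] fixed[of k i j] in \<open>simp_all only: ac_simps\<close>)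
  next
    case False
    then have i: "h i \<noteq> i" by simp
    have d: "h i \<noteq> i" "h (h i) \<noteq> i" "h (h i) \<noteq> h i" "h (h (h i)) = i"
      using is3_canonical(2-4)[OF assms i] by auto
    have "j \<in> {i, h i, h (h i)}" "k \<in> {i, h i, h (h i)}"
      using is3_fixed[OF assms i] False by blast+
    then show ?thesis
      using d by (elim insertE) (auto simp: om_def)
  qed
qed

lemma sum_om:
  assumes "g \<in> Sym n" "x < n"
  shows "(\<Sum>m<n. F m * om g m x) = F (inv g x) - F (g x)"
proof -
  have "(\<Sum>m<n. F m * om g m x) = (\<Sum>m<n. (if m = inv g x then F m else 0) - (if m = g x then F m else 0))"
  proof (intro sum.cong refl)
    fix m
    have "g m = x \<longleftrightarrow> m = inv g x" using assms by auto
    then show "F m * om g m x = (if m = inv g x then F m else 0) - (if m = g x then F m else 0)"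
      by (simp add: om_def of_bool_def eq_commute[of "g x" m])
  qed
  then show ?thesis using assms by (simp add: sum_subtractf)
qed

lemma sum_om_const:
  assumes "g \<in> Sym n" "x < n"
  shows "(\<Sum>m<n. om g m x) = 0"
  using sum_om[OF assms, of "\<lambda>_. 1"] by simp

lemma sum_om5_const:
  assumes "g \<in> Sym n" "x < n"
  shows "(\<Sum>m<n. om5 g m x) = 0"
proof -
  have "om5 g m x = 2 * om (g \<circ> g) m x - om g m x" for m
    by (simp add: om5_def om_def)
  then show ?thesis
    using assms sum_om_const[of "g \<circ> g" n x] sum_om_const[of g n x]
    by (simp add: sum_subtractf sum_distrib_left[symmetric])
qed

text \<open>The all-ones vector is in the radical of every constant form. This is what later makes
  the constant condition depend on \<open>a - b\<close> and \<open>c\<close> only.\<close>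

lemma sum_famC:
  assumes "g \<in> Sym n" "x < n"
  shows "(\<Sum>m<n. famC n a b c g m x) = 0"
  using sum_om_const[OF assms] sum_om5_const[OF assms]
  unfolding famC_def by (cases "is3 n g"; cases "is5 n g") (simp_all add: sum_distrib_left[symmetric])

text \<open>The contraction of the 2-form of \<open>g\<close> with the sum of the basis vectors moved by \<open>h\<close>.\<close>

definition contr :: "(nat \<Rightarrow> nat) \<Rightarrow> (nat \<Rightarrow> nat) \<Rightarrow> nat \<Rightarrow> complex" where
  "contr g h x = moved h (inv g x) - moved h (g x)"

text \<open>The vector of \<open>h\<close> is \<open>b\<close> times the all-ones vector plus
  \<open>a - b\<close> times the sum of the points moved by \<open>h\<close>. The first part lies in
  the radical of \<open>om g\<close>, which leaves a factor \<open>a - b\<close> and the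
  contraction.\<close>

lemma sum_famL_famL:
  assumes "x < n"
  shows "(\<Sum>m<n. famL n a b h i j m * famL n a b g m x l) =
    (if is3 n h \<and> is3 n g then (a - b) * om h i j * contr g h x * (if g l \<noteq> l then a else b) else 0)"
proof (cases "is3 n h \<and> is3 n g")
  case True
  have g: "g \<in> Sym n" using True kcycle_Sym by blast
  have "famL n a b h i j m * famL n a b g m x l = om h i j * (if g l \<noteq> l then a else b) *
     (b * om g m x + (a - b) * (moved h m * om g m x))" for m
    using True by (simp add: famL_def moved_def algebra_simps)
  then have "(\<Sum>m<n. famL n a b h i j m * famL n a b g m x l) = om h i j * (if g l \<noteq> l then a else b) *
     (b * (\<Sum>m<n. om g m x) + (a - b) * (\<Sum>m<n. moved h m * om g m x))"
    by (simp only: sum_distrib_left[symmetric] sum.distrib)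
  then show ?thesis
    using True sum_om_const[OF g assms] sum_om[OF g assms, of "moved h"] by (simp add: contr_def)
qed (auto simp: famL_def)

text \<open>An alternating form vanishes on a repeated vector, here the sum of the points moved by
  \<open>h\<close>.\<close>

lemma sum_contr:
  assumes "g \<in> Sym n"
  shows "(\<Sum>t<n. moved h t * contr g h t) = 0"
proof -
  have "(\<Sum>t<n. moved h t * moved h (inv g t)) = (\<Sum>t<n. moved h (g t) * moved h t)"
    by (subst sum_lessThan_Sym[OF assms]) (use assms in simp)
  then show ?thesis by (simp add: contr_def right_diff_distrib sum_subtractf mult.commute)
qed

text \<open>If \<open>h\<close> fixes one of the indices, a nonzero term forces the supports to meet
  in exactly one point, which is the excluded 5-cycle case. If \<open>h\<close> moves all three,
  they are its support, the values of \<open>om h\<close> agree, and \<open>sum_contr\<close>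
  applies.\<close>

lemma contr_cyc_zero:
  assumes g: "is3 n g" and h: "is3 n h" and not5: "\<not> is5 n (g \<circ> h)"
    and ijk: "distinct [i, j, k]"
  shows "cyc (\<lambda>i j k. om h i j * contr g h k) i j k = 0"
proof -
  have gS: "g \<in> Sym n" and hS: "h \<in> Sym n" using g h kcycle_Sym by blast+
  have two: "om h i j * contr g h k = 0" if "h k = k" for i j k
  proof (rule ccontr)
    assume nz: "om h i j * contr g h k \<noteq> 0"
    then have c: "contr g h k \<noteq> 0" by simp
    have "g k \<noteq> k"
    proof
      assume "g k = k"
      then have "inv g k = k" using gS by (metis Sym_inv_apply(1))
      then show False using c \<open>g k = k\<close> by (simp add: contr_def)
    qed
    have inv: "inv g k = g (g k)" by (simp add: is3_inv[OF g])
    obtain p where p: "g p \<noteq> p" "h p \<noteq> p" and one: "\<And>t. g t \<noteq> t \<Longrightarrow> h t \<noteq> t \<Longrightarrow> t = p"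
    proof -
      have gk: "g t = t" if "t \<notin> {k, g k, g (g k)}" for t by (rule is3_fixed[OF g \<open>g k \<noteq> k\<close> that])
      have ggk: "g (g k) \<noteq> k" "g (g k) \<noteq> g k" "g (g (g k)) = k"
        using is3_canonical(2-4)[OF g \<open>g k \<noteq> k\<close>] by auto
      \<comment> \<open>A nonzero contraction means that \<open>h\<close> moves exactly one of the
        two neighbours of \<open>k\<close> under \<open>g\<close>; that neighbour is the common
        point.\<close>
      consider "h (g k) = g k" "h (g (g k)) \<noteq> g (g k)" | "h (g k) \<noteq> g k" "h (g (g k)) = g (g k)"
        using c unfolding contr_def moved_def inv by (auto simp: of_bool_def split: if_splits)
      then show thesis
      proof cases
        case 1
        have m: "g (g (g k)) \<noteq> g (g k)" using ggk(1) unfolding ggk(3) by (rule not_sym)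
        have one: "t = g (g k)" if "g t \<noteq> t" "h t \<noteq> t" for t
          using gk[of t] that 1 \<open>h k = k\<close> by blast
        show thesis by (rule that[OF m 1(2) one])
      next
        case 2
        have one: "t = g k" if "g t \<noteq> t" "h t \<noteq> t" for t
          using gk[of t] that 2 \<open>h k = k\<close> by blast
        show thesis by (rule that[OF ggk(2) 2(1) one])
      qed
    qed
    have "is5 n (g \<circ> h)"
      using is3_comp_one_shared[OF g h p one] is3_canonical(3)[OF g p(1)] gS hS unfolding is5_iff
      by (metis Sym_less_iff)
    then show False using not5 by simp
  qed
  show ?thesis
  proof (cases "h i = i \<or> h j = j \<or> h k = k")
    case True
    then show ?thesis
      using two[of k i j] two[of i j k] two[of j k i] om_fixed[OF hS] by auto
  next
    case False
    then have i: "h i \<noteq> i" by simp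
    have d: "h i \<noteq> i" "h (h i) \<noteq> i" "h (h i) \<noteq> h i" "h (h (h i)) = i" and less: "i < n"
      using is3_canonical(2-4)[OF h i] by auto
    have mem: "j \<in> {i, h i, h (h i)}" "k \<in> {i, h i, h (h i)}"
      using is3_fixed[OF h i] False by blast+
    have om: "om h i j = om h j k" "om h k i = om h j k"
      using mem ijk d by (auto simp: om_def)
    have set: "{t. t < n \<and> h t \<noteq> t} = {i, j, k}"
    proof -
      have "t \<in> {i, h i, h (h i)}" if "h t \<noteq> t" for t using is3_fixed[OF h i] that by blast
      moreover have "{i, h i, h (h i)} = {i, j, k}" using mem ijk by auto
      moreover have "{i, j, k} \<subseteq> {t. t < n \<and> h t \<noteq> t}" using False mem less hS by auto
      ultimately show ?thesis by blast
    qed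
    have "(\<Sum>t<n. moved h t * contr g h t) = (\<Sum>t\<in>{t. t < n \<and> h t \<noteq> t}. contr g h t)"
      by (rule sum.mono_neutral_cong_right) (auto simp: moved_def)
    then have "contr g h i + contr g h j + contr g h k = 0"
      unfolding sum_contr[OF gS] set using ijk by (simp add: add.assoc)
    then show ?thesis
      unfolding om by (simp add: distrib_left[symmetric] add.commute add.left_commute)
  qed
qed

text \<open>Symmetrising in \<open>m\<close> and \<open>l\<close> regroups the terms into two
  instances of \<open>om_cyc\<close>, weighted by the vector coefficients at \<open>m\<close> and
  \<open>l\<close>.\<close>

lemma fam_Q1_sym:
  assumes "h \<in> Sym n"
  shows "fam.Q1 n a b i j k h m l + fam.Q1 n a b i j k h l m = 0"
proof (cases "is3 n h")
  case True
  define u where "u t = (if h t \<noteq> t then a else b)" for t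
  have c: "cyc (\<lambda>i j k. om h i j * (of_bool (l = h k) - of_bool (l = k))) i j k = 0" for l
    using om_cyc[OF True, of i j "\<lambda>t. of_bool (l = t)" k] .
  have "fam.Q1 n a b i j k h m l + fam.Q1 n a b i j k h l m =
     u m * cyc (\<lambda>i j k. om h i j * (of_bool (l = h k) - of_bool (l = k))) i j k
   + u l * cyc (\<lambda>i j k. om h i j * (of_bool (m = h k) - of_bool (m = k))) i j k"
    using True unfolding fam.Q1_def famL_def u_def[symmetric] by (simp only: if_True) (simp add: algebra_simps)
  then show ?thesis by (simp only: c) simp
next
  case False
  then show ?thesis by (simp add: fam.Q1_def famL_def)
qed

text \<open>\<open>p\<close> is the only common point, so only adjacency to \<open>p\<close> in the
  left factor counts: \<open>q\<close> follows \<open>p\<close>, and \<open>r\<close> precedes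
  it.\<close>

lemma contr_factor:
  assumes "distinct [p, s, t, q, r]"
  shows "contr (cyc3 p q r) (cyc3 p s t) x = of_bool (x = q) - of_bool (x = r)"
proof -
  have d: "distinct [p, q, r]" "distinct [p, s, t]" "distinct [p, r, q]" using assms by auto
  have "is3 (p + q + r + 1) (cyc3 p q r)" by (rule is3_cyc3) (use d in auto)
  from is3_inv[OF this] have inv: "inv (cyc3 p q r) x = cyc3 p q r (cyc3 p q r x)" by simp
  consider "x = p" | "x = q" | "x = r" | "x = s" | "x = t" | "x \<notin> {p, q, r, s, t}" by blast
  then show ?thesis
    unfolding contr_def inv moved_def cyc3_apply[OF d(1)] cyc3_apply[OF d(2)]
    by cases (use assms in \<open>auto\<close>)
qed

lemma om_cyc3:
  assumes "distinct [p, s, t]"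
  shows "om (cyc3 p s t) i j = of_bool (i = p \<and> j = s) + of_bool (i = s \<and> j = t) + of_bool (i = t \<and> j = p)
    - of_bool (j = p \<and> i = s) - of_bool (j = s \<and> i = t) - of_bool (j = t \<and> i = p)"
proof -
  consider "i = p" | "i = s" | "i = t" | "i \<notin> {p, s, t}" by blast
  then show ?thesis
    unfolding om_def cyc3_apply[OF assms] by cases (use assms in \<open>auto\<close>)
qed

lemma moved_cyc3:
  "distinct [p, q, r] \<Longrightarrow> moved (cyc3 p q r) l = of_bool (l = p) + of_bool (l = q) + of_bool (l = r)"
  by (auto simp: moved_def cyc3_apply)

text \<open>In the sum over the factorisations of a 5-cycle the first identity is the coefficient of
  \<open>(a - b) * b\<close> and the second that of \<open>(a - b)^2\<close>, where the constant
  part enters through \<open>om5\<close>. With \<open>i\<close> rotated to \<open>x0\<close>, twelve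
  pairs \<open>(j, k)\<close> and the position of \<open>l\<close> remain.\<close>

lemma five_cycle_check:
  assumes d: "distinct [x0, x1, x2, x3, x4]" and f: "f = cyc5 x0 x1 x2 x3 x4"
    and jk: "j \<in> {x1, x2, x3, x4}" "k \<in> {x1, x2, x3, x4}" "j \<noteq> k"
    and R: "\<And>g h. R g h = cyc (\<lambda>i j k. om h i j * contr g h k) x0 j k"
  shows "R (cyc3 x0 x3 x4) (cyc3 x0 x1 x2) + R (cyc3 x1 x4 x0) (cyc3 x1 x2 x3) + R (cyc3 x2 x0 x1) (cyc3 x2 x3 x4)
     + R (cyc3 x3 x1 x2) (cyc3 x3 x4 x0) + R (cyc3 x4 x2 x3) (cyc3 x4 x0 x1) = 0" (is ?A)
    and "moved (cyc3 x0 x3 x4) l * R (cyc3 x0 x3 x4) (cyc3 x0 x1 x2) + moved (cyc3 x1 x4 x0) l * R (cyc3 x1 x4 x0) (cyc3 x1 x2 x3)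
     + moved (cyc3 x2 x0 x1) l * R (cyc3 x2 x0 x1) (cyc3 x2 x3 x4)
     + moved (cyc3 x3 x1 x2) l * R (cyc3 x3 x1 x2) (cyc3 x3 x4 x0) + moved (cyc3 x4 x2 x3) l * R (cyc3 x4 x2 x3) (cyc3 x4 x0 x1)
     + cyc (\<lambda>i j k. om5 f i j * (of_bool (l = f k) - of_bool (l = k))) x0 j k = 0" (is ?B)
proof -
  have ne: "x0 \<noteq> x1" "x0 \<noteq> x2" "x0 \<noteq> x3" "x0 \<noteq> x4" "x1 \<noteq> x2" "x1 \<noteq> x3" "x1 \<noteq> x4" "x2 \<noteq> x3" "x2 \<noteq> x4" "x3 \<noteq> x4"
    "x1 \<noteq> x0" "x2 \<noteq> x0" "x3 \<noteq> x0" "x4 \<noteq> x0" "x2 \<noteq> x1" "x3 \<noteq> x1" "x4 \<noteq> x1" "x3 \<noteq> x2" "x4 \<noteq> x2" "x4 \<noteq> x3"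
    using d by auto
  have f_app: "f x0 = x1" "f x1 = x2" "f x2 = x3" "f x3 = x4" "f x4 = x0"
    unfolding f cyc5_apply[OF d] using ne by simp_all
  \<comment> \<open>\<open>R\<close> expressed by equalities between letters alone, so that
    distinctness decides every case.\<close>
  define r where "r p s t q w = cyc (\<lambda>i j k. (of_bool (i = p \<and> j = s) + of_bool (i = s \<and> j = t) + of_bool (i = t \<and> j = p)
    - of_bool (j = p \<and> i = s) - of_bool (j = s \<and> i = t) - of_bool (j = t \<and> i = p)) * (of_bool (k = q) - of_bool (k = w) :: complex)) x0 j k"
    for p s t q w
  have Rr: "R (cyc3 p q w) (cyc3 p s t) = r p s t q w" if dd: "distinct [p, s, t, q, w]" for p s t q w
  proof -
    have "distinct [p, s, t]" using dd by auto
    then show ?thesis unfolding R r_def by (simp only: contr_factor[OF dd] om_cyc3)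
  qed
  have R': "R (cyc3 x0 x3 x4) (cyc3 x0 x1 x2) = r x0 x1 x2 x3 x4" "R (cyc3 x1 x4 x0) (cyc3 x1 x2 x3) = r x1 x2 x3 x4 x0"
    "R (cyc3 x2 x0 x1) (cyc3 x2 x3 x4) = r x2 x3 x4 x0 x1" "R (cyc3 x3 x1 x2) (cyc3 x3 x4 x0) = r x3 x4 x0 x1 x2"
    "R (cyc3 x4 x2 x3) (cyc3 x4 x0 x1) = r x4 x0 x1 x2 x3"
    by (rule Rr; use ne in simp)+
  have jk': "(j, k) \<in> {(x1, x2), (x1, x3), (x1, x4), (x2, x1), (x2, x3), (x2, x4), (x3, x1), (x3, x2), (x3, x4), (x4, x1), (x4, x2), (x4, x3)}"
    using jk by auto
  show ?A
    unfolding R' using jk' by (elim insertE) (simp_all add: r_def ne)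
  have m: "moved (cyc3 x0 x3 x4) l = of_bool (l = x0) + of_bool (l = x3) + of_bool (l = x4)"
     "moved (cyc3 x1 x4 x0) l = of_bool (l = x1) + of_bool (l = x4) + of_bool (l = x0)"
     "moved (cyc3 x2 x0 x1) l = of_bool (l = x2) + of_bool (l = x0) + of_bool (l = x1)"
     "moved (cyc3 x3 x1 x2) l = of_bool (l = x3) + of_bool (l = x1) + of_bool (l = x2)"
     "moved (cyc3 x4 x2 x3) l = of_bool (l = x4) + of_bool (l = x2) + of_bool (l = x3)"
    by (rule moved_cyc3; use ne in simp)+
  show ?B
    unfolding R' m using jk'
    by (elim insertE; (cases "l = x0"; cases "l = x1"; cases "l = x2"; cases "l = x3"; cases "l = x4")?)
       (simp_all add: r_def ne om5_def om_def f_app)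
qed

lemma five_cycle_canonical:
  assumes "is5 n f" "f i \<noteq> i"
  obtains x1 x2 x3 x4 where "distinct [i, x1, x2, x3, x4]" "f = cyc5 i x1 x2 x3 x4"
    "i < n" "x1 < n" "x2 < n" "x3 < n" "x4 < n"
proof -
  obtain x0 x1 x2 x3 x4 where d: "distinct [x0, x1, x2, x3, x4]" and f: "f = cyc5 x0 x1 x2 x3 x4"
    and less: "x0 < n" "x1 < n" "x2 < n" "x3 < n" "x4 < n"
    using assms(1) unfolding is5_iff by blast
  note f1 = trans[OF f cyc5_rotations(1)[OF d]] and f2 = trans[OF f cyc5_rotations(2)[OF d]]
    and f3 = trans[OF f cyc5_rotations(3)[OF d]] and f4 = trans[OF f cyc5_rotations(4)[OF d]]
  have "i \<in> {x0, x1, x2, x3, x4}"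
    using assms(2) unfolding f cyc5_apply[OF d] by (auto split: if_splits)
  then show thesis
  proof (elim insertE emptyE)
    assume "i = x0" then show thesis using that[OF _ f[folded \<open>i = x0\<close>]] d less by auto
  next
    assume "i = x1" then show thesis using that[OF _ f1[folded \<open>i = x1\<close>]] d less by auto
  next
    assume "i = x2" then show thesis using that[OF _ f2[folded \<open>i = x2\<close>]] d less by auto
  next
    assume "i = x3" then show thesis using that[OF _ f3[folded \<open>i = x3\<close>]] d less by auto
  next
    assume "i = x4" then show thesis using that[OF _ f4[folded \<open>i = x4\<close>]] d less by auto
  qed
qed

lemma cyc5_moved: "distinct [x0, x1, x2, x3, x4] \<Longrightarrow> cyc5 x0 x1 x2 x3 x4 t \<noteq> t \<longleftrightarrow> t \<in> {x0, x1, x2, x3, x4}"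
  by (auto simp: cyc5_apply)

lemma cyc5_factors_fixed:
  assumes "is5 n f" "is3 n h" "is3 n g" "g \<circ> h = f" "f x = x"
  shows "h x = x" "g x = x"
proof -
  obtain x0 x1 x2 x3 x4 where d: "distinct [x0, x1, x2, x3, x4]" and f5: "f = cyc5 x0 x1 x2 x3 x4"
    using assms(1) unfolding is5_iff by blast
  have "x \<notin> {x0, x1, x2, x3, x4}" using assms(5) cyc5_moved[OF d, of x] f5 by blast
  then show "h x = x"
    using cyc5_factors[OF d f5 assms(2-4)] d by (auto simp: cyc3_apply)
  then show "g x = x" using assms(4,5) by auto
qed

lemma fam_Q2_zero:
  assumes ijk: "i < n" "j < n" "k < n" "distinct [i, j, k]" and f: "f \<in> Sym n"
  shows "fam.Q2 n a b c i j k f l = 0"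
proof -
  define R where "R g h = cyc (\<lambda>i j k. om h i j * contr g h k) i j k" for g h
  define F where "F g h = (a - b) * (b * R g h + (a - b) * (moved g l * R g h))" for g h
  define T where "T h = (if is3 n h \<and> is3 n (f \<circ> inv h) then F (f \<circ> inv h) h else 0)" for h
  define D where "D = cyc (\<lambda>i j k. famC n a b c f i j * (of_bool (l = f k) - of_bool (l = k))) i j k"
  have inner: "(\<Sum>m<n. famL n a b h i j m * (famL n a b g m (h k) l + famL n a b g m k l))
    = (if is3 n h \<and> is3 n g then (a - b) * (if g l \<noteq> l then a else b) * (om h i j * (contr g h (h k) + contr g h k)) else 0)"
    if "h \<in> Sym n" "k < n" for i j k h g
    using sum_famL_famL[of "h k" n a b h i j g l] sum_famL_famL[of k n a b h i j g l] that
    by (simp add: distrib_left sum.distrib)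
  have cyc: "cyc (\<lambda>i j k. \<Sum>m<n. famL n a b h i j m * (famL n a b (f \<circ> inv h) m (h k) l + famL n a b (f \<circ> inv h) m k l)) i j k
    = 2 * T h" if h: "h \<in> Sym n" for h
  proof (cases "is3 n h \<and> is3 n (f \<circ> inv h)")
    case True
    let ?g = "f \<circ> inv h"
    \<comment> \<open>\<open>om_cyc\<close> with \<open>S = contr ?g h\<close> replaces
      \<open>h k\<close> by \<open>k\<close>; the resulting factor 2 matches the one before the
      constant term in \<open>Q2\<close>.\<close>
    have "cyc (\<lambda>i j k. om h i j * (contr ?g h (h k) - contr ?g h k)) i j k = 0"
      by (rule om_cyc) (use True in blast)
    then have "cyc (\<lambda>i j k. om h i j * (contr ?g h (h k) + contr ?g h k)) i j k = 2 * R ?g h"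
      unfolding R_def by (simp add: algebra_simps) 
    moreover have "(if ?g l \<noteq> l then a else b) = b + (a - b) * moved ?g l"
      by (simp add: moved_def)
    moreover have "e * u * A + e * u * B + e * u * C = 2 * (e * (b * r + e * (m * r)))"
      if "A + B + C = 2 * r" "u = b + e * m" for e u A B C m r :: complex
      using that by algebra
    ultimately show ?thesis
      unfolding inner[OF h ijk(1)] inner[OF h ijk(2)] inner[OF h ijk(3)] T_def F_def if_P[OF True]
      by blast
  next
    case False
    show ?thesis unfolding inner[OF h ijk(1)] inner[OF h ijk(2)] inner[OF h ijk(3)] T_def if_not_P[OF False] by simp
  qed
  have "fam.Q2 n a b c i j k f l = (\<Sum>h\<in>Sym n. cyc (\<lambda>i j k. \<Sum>m<n. famL n a b h i j m *
      (famL n a b (f \<circ> inv h) m (h k) l + famL n a b (f \<circ> inv h) m k l)) i j k) + 2 * D"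
    unfolding fam.Q2_def D_def sum.distrib by (simp add: algebra_simps)
  also have "\<dots> = 2 * ((\<Sum>h\<in>Sym n. T h) + D)"
    using cyc by (simp add: sum_distrib_left distrib_left)
  also have "(\<Sum>h\<in>Sym n. T h) + D = 0"
  proof (cases "is5 n f")
    case False
    have "T h = 0" if "h \<in> Sym n" for h
    proof (cases "is3 n h \<and> is3 n (f \<circ> inv h)")
      case True
      have "f \<circ> inv h \<circ> h = f" using that by (simp add: comp_assoc)
      then have "R (f \<circ> inv h) h = 0"
        unfolding R_def using True False ijk(4) by (intro contr_cyc_zero[where n = n]) auto
      then show ?thesis by (simp add: T_def F_def)
    qed (auto simp: T_def)
    moreover have "D = 0"
    proof (cases "is3 n f")
      case True
      have "D = c * cyc (\<lambda>i j k. om f i j * (of_bool (l = f k) - of_bool (l = k))) i j k"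
        using True by (simp add: D_def famC_def distrib_left)
      then show ?thesis using om_cyc[OF True, of i j "\<lambda>t. of_bool (l = t)" k] by simp
    qed (use False in \<open>simp add: D_def famC_def\<close>)
    ultimately show ?thesis by simp
  next
    case True
    have D: "D = (a - b)^2 * cyc (\<lambda>i j k. om5 f i j * (of_bool (l = f k) - of_bool (l = k))) i j k"
      using True is5_not_is3[OF True] by (simp add: D_def famC_def distrib_left)
    show ?thesis
    proof (cases "f i = i \<or> f j = j \<or> f k = k")
      \<comment> \<open>A point fixed by the 5-cycle is fixed by both factors, which kills two terms
        through \<open>om\<close> and the third through \<open>contr\<close>.\<close>
      case fixed: True
      have "R g h = 0" if "is3 n h" "is3 n g" "g \<circ> h = f" for g h
      proof -
        have "h x = x \<and> g x = x" if "f x = x" for x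
          using cyc5_factors_fixed[OF True \<open>is3 n h\<close> \<open>is3 n g\<close> \<open>g \<circ> h = f\<close> that] by blast
        moreover have "h \<in> Sym n" "g \<in> Sym n" using that kcycle_Sym by blast+
        moreover have "contr g h x = 0" if "g x = x" for x
        proof -
          have "inv g x = x" using that \<open>g \<in> Sym n\<close> by (metis Sym_inv_apply(1))
          then show ?thesis using that by (simp add: contr_def)
        qed
        ultimately show ?thesis
          using fixed om_fixed[OF \<open>h \<in> Sym n\<close>] unfolding R_def by auto
      qed
      then have "T h = 0" if "h \<in> Sym n" for h
      proof (cases "is3 n h \<and> is3 n (f \<circ> inv h)")
        case 3: True
        have "f \<circ> inv h \<circ> h = f" using that by (simp add: comp_assoc)
        with 3 \<open>\<And>h g. is3 n h \<Longrightarrow> is3 n g \<Longrightarrow> g \<circ> h = f \<Longrightarrow> R g h = 0\<close>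
        have "R (f \<circ> inv h) h = 0" by blast
        then show ?thesis by (simp add: T_def F_def)
      qed (auto simp: T_def)
      moreover have "D = 0"
        unfolding D using fixed by (elim disjE) (simp_all add: om5_fixed[OF f])
      ultimately show ?thesis by simp
    next
      case moved: False
      then obtain x1 x2 x3 x4 where d: "distinct [i, x1, x2, x3, x4]" and f5: "f = cyc5 i x1 x2 x3 x4"
        and less: "i < n" "x1 < n" "x2 < n" "x3 < n" "x4 < n"
        using five_cycle_canonical[OF True] by metis
      have jk: "j \<in> {x1, x2, x3, x4}" "k \<in> {x1, x2, x3, x4}" "j \<noteq> k"
        using moved ijk(4) cyc5_moved[OF d, of j] cyc5_moved[OF d, of k] f5 by auto
      note check = five_cycle_check[OF d f5 jk, of R, OF R_def]
      have "(\<Sum>h\<in>Sym n. T h) = F (cyc3 i x3 x4) (cyc3 i x1 x2) + F (cyc3 x1 x4 i) (cyc3 x1 x2 x3) + F (cyc3 x2 i x1) (cyc3 x2 x3 x4)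
     + F (cyc3 x3 x1 x2) (cyc3 x3 x4 i) + F (cyc3 x4 x2 x3) (cyc3 x4 i x1)"
        unfolding T_def by (rule sum_cyc5_factors[OF d f5 less])
      moreover have "e * (b * r0 + e * (m0 * r0)) + e * (b * r1 + e * (m1 * r1)) + e * (b * r2 + e * (m2 * r2))
         + e * (b * r3 + e * (m3 * r3)) + e * (b * r4 + e * (m4 * r4)) + e^2 * s = 0"
        if "r0 + r1 + r2 + r3 + r4 = 0" "m0 * r0 + m1 * r1 + m2 * r2 + m3 * r3 + m4 * r4 + s = 0"
        for e r0 r1 r2 r3 r4 m0 m1 m2 m3 m4 s :: complex
        using that by algebra
      ultimately show ?thesis
        unfolding D F_def using check(1) check(2)[of l] by (simp only:)
    qed
  qed
  finally show ?thesis by simp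
qed

section \<open>The family of the theorem: constant part\<close>

definition factor_sum :: "nat \<Rightarrow> (nat \<Rightarrow> nat) \<Rightarrow> ((nat \<Rightarrow> nat) \<Rightarrow> (nat \<Rightarrow> nat) \<Rightarrow> complex) \<Rightarrow> complex" where
  "factor_sum n f \<tau> = (\<Sum>h\<in>Sym n. if is3 n h \<and> is3 n (f \<circ> inv h) then \<tau> (f \<circ> inv h) h else 0)"

lemma factor_sum_cong:
  assumes "\<And>g h. is3 n g \<Longrightarrow> is3 n h \<Longrightarrow> g \<circ> h = f \<Longrightarrow> \<tau> g h = \<tau>' g h"
  shows "factor_sum n f \<tau> = factor_sum n f \<tau>'"
  unfolding factor_sum_def
proof (intro sum.cong refl)
  fix h assume h: "h \<in> Sym n"
  have "f \<circ> inv h \<circ> h = f" using h by (simp add: comp_assoc)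
  then show "(if is3 n h \<and> is3 n (f \<circ> inv h) then \<tau> (f \<circ> inv h) h else 0)
     = (if is3 n h \<and> is3 n (f \<circ> inv h) then \<tau>' (f \<circ> inv h) h else 0)"
    using assms by presburger
qed

lemma factor_sum_diff: "factor_sum n f (\<lambda>g h. \<tau> g h - \<tau>' g h) = factor_sum n f \<tau> - factor_sum n f \<tau>'"
  unfolding factor_sum_def sum_subtractf[symmetric] by (intro sum.cong) auto

lemma factor_sum_uminus: "factor_sum n f (\<lambda>g h. - \<tau> g h) = - factor_sum n f \<tau>"
  unfolding factor_sum_def sum_negf[symmetric] by (intro sum.cong) auto

lemma factor_sum_zero: "factor_sum n f (\<lambda>g h. 0) = 0"
  unfolding factor_sum_def by simp

lemma sum_Sym_quotient:
  assumes "f \<in> Sym n"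
  shows "(\<Sum>h\<in>Sym n. F h) = (\<Sum>h\<in>Sym n. F (f \<circ> inv h))"
proof -
  have "(\<Sum>h\<in>Sym n. F h) = (\<Sum>h\<in>Sym n. F (f \<circ> h))" by (rule sum_Sym_left[OF assms])
  also have "\<dots> = (\<Sum>h\<in>Sym n. F (f \<circ> inv h))" by (rule sum_Sym_inv)
  finally show ?thesis .
qed

lemma Sym_inv_of_comp: "g \<in> Sym n \<Longrightarrow> h \<in> Sym n \<Longrightarrow> inv (g \<circ> h) = inv h \<circ> inv g"
  by (simp add: o_inv_distrib Sym_bij)

text \<open>Reindexing by the Hurwitz move, which replaces the factorisation \<open>(g, h)\<close>
  by \<open>(g h g^-1, g)\<close>.\<close>

lemma factor_sum_rotate:
  assumes f: "f \<in> Sym n"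
  shows "factor_sum n f \<tau> = factor_sum n f (\<lambda>g h. \<tau> (g \<circ> h \<circ> inv g) g)"
proof -
  have "factor_sum n f \<tau> = (\<Sum>h\<in>Sym n. if is3 n (f \<circ> inv h) \<and> is3 n (f \<circ> inv (f \<circ> inv h))
      then \<tau> (f \<circ> inv (f \<circ> inv h)) (f \<circ> inv h) else 0)"
    unfolding factor_sum_def by (rule sum_Sym_quotient[OF f])
  also have "\<dots> = factor_sum n f (\<lambda>g h. \<tau> (g \<circ> h \<circ> inv g) g)"
    unfolding factor_sum_def
  proof (intro sum.cong refl)
    fix h assume h: "h \<in> Sym n"
    let ?g = "f \<circ> inv h"
    have g: "?g \<in> Sym n" using f h by simp
    have "?g \<circ> h = f" using h by (simp add: comp_assoc)
    then have e: "f \<circ> inv ?g = ?g \<circ> h \<circ> inv ?g" by simp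
    have iff: "is3 n (f \<circ> inv ?g) \<longleftrightarrow> is3 n h" unfolding e by (rule kcycle_conj_iff[OF g])
    show "(if is3 n ?g \<and> is3 n (f \<circ> inv ?g) then \<tau> (f \<circ> inv ?g) ?g else 0)
      = (if is3 n h \<and> is3 n ?g then \<tau> (?g \<circ> h \<circ> inv ?g) ?g else 0)"
      unfolding iff e[symmetric] by (simp only: conj_commute)
  qed
  finally show ?thesis .
qed

lemma factor_sum_inv:
  assumes f: "f \<in> Sym n"
  shows "factor_sum n (inv f) \<tau> = factor_sum n f (\<lambda>g h. \<tau> (inv h) (inv g))"
proof -
  have "factor_sum n (inv f) \<tau> = (\<Sum>h\<in>Sym n. if is3 n (inv h) \<and> is3 n (inv f \<circ> inv (inv h))
      then \<tau> (inv f \<circ> inv (inv h)) (inv h) else 0)"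
    unfolding factor_sum_def by (rule sum_Sym_inv)
  also have "\<dots> = (\<Sum>h\<in>Sym n. if is3 n (inv (f \<circ> inv h)) \<and> is3 n (inv f \<circ> inv (inv (f \<circ> inv h)))
      then \<tau> (inv f \<circ> inv (inv (f \<circ> inv h))) (inv (f \<circ> inv h)) else 0)"
    by (rule sum_Sym_quotient[OF f])
  also have "\<dots> = factor_sum n f (\<lambda>g h. \<tau> (inv h) (inv g))"
    unfolding factor_sum_def
  proof (intro sum.cong refl)
    fix h assume h: "h \<in> Sym n"
    let ?g = "f \<circ> inv h"
    have g: "?g \<in> Sym n" using f h by simp
    have e: "inv f \<circ> inv (inv ?g) = inv h"
      unfolding Sym_inv_inv[OF g] using f by (simp add: comp_assoc[symmetric])
    have "is3 n (inv ?g) \<longleftrightarrow> is3 n ?g" "is3 n (inv h) \<longleftrightarrow> is3 n h"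
      using is3_inv_iff g h by blast+
    then show "(if is3 n (inv ?g) \<and> is3 n (inv f \<circ> inv (inv ?g)) then \<tau> (inv f \<circ> inv (inv ?g)) (inv ?g) else 0)
      = (if is3 n h \<and> is3 n ?g then \<tau> (inv h) (inv ?g) else 0)"
      unfolding e by presburger
  qed
  finally show ?thesis .
qed

lemma factor_sum_conj:
  assumes p: "p \<in> Sym n" and f: "f \<in> Sym n"
  shows "factor_sum n (p \<circ> f \<circ> inv p) \<tau> = factor_sum n f (\<lambda>g h. \<tau> (p \<circ> g \<circ> inv p) (p \<circ> h \<circ> inv p))"
proof -
  let ?c = "\<lambda>h. p \<circ> h \<circ> inv p"
  have "factor_sum n (?c f) \<tau> = (\<Sum>h\<in>Sym n. if is3 n (?c h) \<and> is3 n (?c f \<circ> inv (?c h)) then \<tau> (?c f \<circ> inv (?c h)) (?c h) else 0)"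
    unfolding factor_sum_def by (rule sum_Sym_conj[OF p])
  also have "\<dots> = factor_sum n f (\<lambda>g h. \<tau> (?c g) (?c h))"
    unfolding factor_sum_def
  proof (intro sum.cong refl)
    fix h assume h: "h \<in> Sym n"
    have "inv (?c h) = ?c (inv h)"
      using p h by (simp add: Sym_inv_of_comp[where n = n] comp_assoc)
    then have e: "?c f \<circ> inv (?c h) = ?c (f \<circ> inv h)"
      using p by (auto simp: fun_eq_iff)
    show "(if is3 n (?c h) \<and> is3 n (?c f \<circ> inv (?c h)) then \<tau> (?c f \<circ> inv (?c h)) (?c h) else 0)
       = (if is3 n h \<and> is3 n (f \<circ> inv h) then \<tau> (?c (f \<circ> inv h)) (?c h) else 0)"
      unfolding e kcycle_conj_iff[OF p] ..
  qed
  finally show ?thesis .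
qed

definition share :: "nat \<Rightarrow> (nat \<Rightarrow> nat) \<Rightarrow> (nat \<Rightarrow> nat) \<Rightarrow> complex" where
  "share n g h = (\<Sum>k<n. moved h k * moved g k)"

lemma moved_inv: "g \<in> Sym n \<Longrightarrow> moved (inv g) k = moved g k"
  using Sym_inv_eq_iff[of g n k k] by (auto simp: moved_def)

lemma om_inv: "g \<in> Sym n \<Longrightarrow> om (inv g) i j = - om g i j"
  using Sym_inv_eq_iff[of g n i j] Sym_inv_eq_iff[of g n j i] by (auto simp: om_def)

lemma share_conj:
  assumes p: "p \<in> Sym n"
  shows "share n (p \<circ> g \<circ> inv p) (p \<circ> h \<circ> inv p) = share n g h"
  unfolding share_def by (subst sum_lessThan_Sym[OF p]) (use p in \<open>simp add: moved_conj del: comp_apply\<close>)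

lemma share_conj_left:
  assumes g: "g \<in> Sym n"
  shows "share n (g \<circ> h \<circ> inv g) g = share n g h"
proof -
  have "g \<circ> g \<circ> inv g = g" using g by (simp add: comp_assoc)
  then have "share n (g \<circ> h \<circ> inv g) g = share n h g"
    using share_conj[OF g, of h g] by simp
  then show ?thesis by (simp add: share_def mult.commute)
qed

text \<open>The contribution of the factorisation \<open>g h\<close> to the commutator of
  \<open>T_i\<close> and \<open>T_j\<close>.\<close>

definition brac :: "nat \<Rightarrow> nat \<Rightarrow> (nat \<Rightarrow> nat) \<Rightarrow> (nat \<Rightarrow> nat) \<Rightarrow> complex" where
  "brac i j g h = moved g i * moved h j - moved g j * moved h i"

text \<open>The coefficient of \<open>f\<close> in \<open>[T\<^sub>i,T\<^sub>j] - \<Sum>\<^sub>h om\<^sub>h(i,j) (\<Sum>\<^sub>k T\<^sub>k) h\<close>, with \<open>k\<close> running over the points moved by \<open>h\<close>.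
  It is odd under \<open>f \<mapsto> f\<^sup>-\<^sup>1\<close> and invariant under conjugation, which leaves only 3-cycles and 5-cycles.\<close>

definition defect :: "nat \<Rightarrow> (nat \<Rightarrow> nat) \<Rightarrow> nat \<Rightarrow> nat \<Rightarrow> complex" where
  "defect n f i j = factor_sum n f (\<lambda>g h. brac i j g h - om h i j * share n g h)"

lemma defect_alt: "defect n f j i = - defect n f i j"
  unfolding defect_def factor_sum_uminus[symmetric]
  by (rule factor_sum_cong) (simp add: brac_def om_alt[of _ j i])

lemma defect_conj:
  assumes "p \<in> Sym n" "f \<in> Sym n"
  shows "defect n (p \<circ> f \<circ> inv p) (p i) (p j) = defect n f i j"
  unfolding defect_def factor_sum_conj[OF assms] share_conj[OF assms(1)] om_conj[OF assms(1)] brac_def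
    moved_conj[OF assms(1)] Sym_inv_apply(1)[OF assms(1)] ..

text \<open>Inversion exchanges the factors, so \<open>brac\<close> changes sign, and it transposes
  \<open>om\<close>. It also moves \<open>om\<close> from the right factor to the left one; the
  Hurwitz move, which preserves \<open>share\<close>, brings it back.\<close>

lemma defect_inv:
  assumes f: "f \<in> Sym n"
  shows "defect n (inv f) i j = - defect n f i j"
proof -
  have "defect n (inv f) i j = factor_sum n f (\<lambda>g h. brac i j (inv h) (inv g) - om (inv g) i j * share n (inv h) (inv g))"
    unfolding defect_def by (rule factor_sum_inv[OF f])
  also have "\<dots> = factor_sum n f (\<lambda>g h. om g i j * share n g h - brac i j g h)"
  proof (rule factor_sum_cong)
    fix g h assume "is3 n g" "is3 n h"
    then have "g \<in> Sym n" "h \<in> Sym n" by (simp_all add: kcycle_Sym)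
    then show "brac i j (inv h) (inv g) - om (inv g) i j * share n (inv h) (inv g) = om g i j * share n g h - brac i j g h"
      by (simp add: brac_def moved_inv om_inv share_def mult.commute)
  qed
  also have "\<dots> = factor_sum n f (\<lambda>g h. om g i j * share n g h) - factor_sum n f (brac i j)"
    by (rule factor_sum_diff)
  also have "factor_sum n f (\<lambda>g h. om g i j * share n g h) = factor_sum n f (\<lambda>g h. om h i j * share n g h)"
  proof -
    have "factor_sum n f (\<lambda>g h. om h i j * share n g h) = factor_sum n f (\<lambda>g h. om g i j * share n (g \<circ> h \<circ> inv g) g)"
      by (rule factor_sum_rotate[OF f])
    also have "\<dots> = factor_sum n f (\<lambda>g h. om g i j * share n g h)"
    proof (rule factor_sum_cong)
      fix g h assume "is3 n g"
      from share_conj_left[OF kcycle_Sym[OF this]]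
      show "om g i j * share n (g \<circ> h \<circ> inv g) g = om g i j * share n g h" by (rule arg_cong)
    qed
    finally show ?thesis by simp
  qed
  finally show ?thesis unfolding defect_def factor_sum_diff by simp
qed

text \<open>Both factors share exactly one point, so \<open>share\<close> is 1 and the five
  factorisations leave a finite check in \<open>j\<close>. The form \<open>om5\<close> thus arises a
  second time, now from a commutator.\<close>

lemma defect_is5:
  assumes f: "is5 n f"
  shows "defect n f i j = om5 f i j"
proof (cases "f i = i \<or> f j = j")
  case True
  have "defect n f i j = factor_sum n f (\<lambda>g h. 0)"
    unfolding defect_def
  proof (rule factor_sum_cong)
    fix g h assume gh: "is3 n g" "is3 n h" "g \<circ> h = f"
    have "h \<in> Sym n" using gh kcycle_Sym by blast
    note fixed = cyc5_factors_fixed[OF f gh(2,1,3)]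
    show "brac i j g h - om h i j * share n g h = 0"
      using True
    proof
      assume "f i = i"
      then show ?thesis using fixed[of i] om_fixed(1)[OF \<open>h \<in> Sym n\<close>, of i j] by (simp add: brac_def moved_def)
    next
      assume "f j = j"
      then show ?thesis using fixed[of j] om_fixed(2)[OF \<open>h \<in> Sym n\<close>, of j i] by (simp add: brac_def moved_def)
    qed
  qed
  then show ?thesis using om5_fixed[OF kcycle_Sym[OF f]] True by (auto simp: factor_sum_zero)
next
  case False
  then obtain x1 x2 x3 x4 where d: "distinct [i, x1, x2, x3, x4]" and f5: "f = cyc5 i x1 x2 x3 x4"
    and less: "i < n" "x1 < n" "x2 < n" "x3 < n" "x4 < n"
    using five_cycle_canonical[OF f] by metis
  have ne: "i \<noteq> x1" "i \<noteq> x2" "i \<noteq> x3" "i \<noteq> x4" "x1 \<noteq> x2" "x1 \<noteq> x3" "x1 \<noteq> x4" "x2 \<noteq> x3" "x2 \<noteq> x4" "x3 \<noteq> x4"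
    "x1 \<noteq> i" "x2 \<noteq> i" "x3 \<noteq> i" "x4 \<noteq> i" "x2 \<noteq> x1" "x3 \<noteq> x1" "x4 \<noteq> x1" "x3 \<noteq> x2" "x4 \<noteq> x2" "x4 \<noteq> x3"
    using d by auto
  have f_app: "f i = x1" "f x1 = x2" "f x2 = x3" "f x3 = x4" "f x4 = i"
    unfolding f5 cyc5_apply[OF d] using ne by simp_all
  define T where "T g h = brac i j g h - om h i j * share n g h" for g h
  define r where "r p s t q w = (of_bool (i = p) + of_bool (i = q) + of_bool (i = w)) * (of_bool (j = p) + of_bool (j = s) + of_bool (j = t))
     - (of_bool (j = p) + of_bool (j = q) + of_bool (j = w)) * (of_bool (i = p) + of_bool (i = s) + of_bool (i = t))
     - (of_bool (i = p \<and> j = s) + of_bool (i = s \<and> j = t) + of_bool (i = t \<and> j = p)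
    - of_bool (j = p \<and> i = s) - of_bool (j = s \<and> i = t) - of_bool (j = t \<and> i = p) :: complex)" for p s t q w
  have Tr: "T (cyc3 p q w) (cyc3 p s t) = r p s t q w"
    if "p < n" and dd: "distinct [p, s, t, q, w]" for p s t q w
  proof -
    have d1: "distinct [p, s, t]" and d2: "distinct [p, q, w]" using dd by auto
    have "moved (cyc3 p s t) k * moved (cyc3 p q w) k = (if k = p then 1 else 0)" for k
      unfolding moved_cyc3[OF d1] moved_cyc3[OF d2] using dd by auto
    then have "share n (cyc3 p q w) (cyc3 p s t) = 1"
      using \<open>p < n\<close> by (simp add: share_def)
    then show ?thesis
      by (simp only: T_def r_def brac_def om_cyc3[OF d1] moved_cyc3[OF d1] moved_cyc3[OF d2] mult_1_right)
  qed
  have T': "T (cyc3 i x3 x4) (cyc3 i x1 x2) = r i x1 x2 x3 x4" "T (cyc3 x1 x4 i) (cyc3 x1 x2 x3) = r x1 x2 x3 x4 i"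
    "T (cyc3 x2 i x1) (cyc3 x2 x3 x4) = r x2 x3 x4 i x1" "T (cyc3 x3 x1 x2) (cyc3 x3 x4 i) = r x3 x4 i x1 x2"
    "T (cyc3 x4 x2 x3) (cyc3 x4 i x1) = r x4 i x1 x2 x3"
    by (rule Tr; use ne less in simp)+
  have "defect n f i j = T (cyc3 i x3 x4) (cyc3 i x1 x2) + T (cyc3 x1 x4 i) (cyc3 x1 x2 x3) + T (cyc3 x2 i x1) (cyc3 x2 x3 x4)
     + T (cyc3 x3 x1 x2) (cyc3 x3 x4 i) + T (cyc3 x4 x2 x3) (cyc3 x4 i x1)"
    unfolding defect_def factor_sum_def T_def[symmetric] by (rule sum_cyc5_factors[OF d f5 less])
  moreover have "j \<in> {i, x1, x2, x3, x4}" using False cyc5_moved[OF d, of j] f5 by auto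
  ultimately show ?thesis
    unfolding T' by (elim insertE emptyE) (simp_all add: r_def ne om5_def om_def f_app)
qed

text \<open>Conjugation carries every case \<open>f i = j\<close> to the reference cycle. If
  \<open>f\<close> fixes \<open>i\<close> or \<open>j\<close>, some transposition fixing both
  conjugates \<open>f\<close> to its inverse, and oddness gives zero.\<close>

lemma defect_is3:
  assumes f: "is3 n f"
  shows "defect n f i j = defect n (cyc3 0 1 2) 0 1 * om f i j"
proof -
  have fS: "f \<in> Sym n" using f by (rule kcycle_Sym)
  obtain a b c where abc: "distinct [a, b, c]" "a < n" "b < n" "c < n"
    using f unfolding is3_iff by blast
  have "card {a, b, c} \<le> card {..<n}" by (rule card_mono) (use abc in auto)
  then have n: "3 \<le> n" using abc by simp
  have both: "defect n f i j = defect n (cyc3 0 1 2) 0 1" if "f i = j" "f i \<noteq> i" for i j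
  proof -
    note can = is3_canonical[OF f that(2)]
    have less: "i < n" "f i < n" "f (f i) < n" using can(3) fS by simp_all
    obtain p where p: "p \<in> Sym n" "p 0 = i" "p 1 = f i" "p 2 = f (f i)"
      using exists_Sym_three[of 0 1 2 i "f i" "f (f i)" n] can(2) less n by auto
    have "p \<circ> cyc3 0 1 2 \<circ> inv p = cyc3 i (f i) (f (f i))"
      unfolding cyc3_def using conjugation_of_cycle[of "[0, 1, 2::nat]" p] p Sym_bij[OF p(1)] by simp
    also have "\<dots> = f" by (rule can(1)[symmetric])
    finally have "p \<circ> cyc3 0 1 2 \<circ> inv p = f" .
    moreover have "cyc3 0 1 2 \<in> Sym n"
      by (rule kcycle_Sym, rule is3_cyc3) (use n in auto)
    ultimately show ?thesis
      using defect_conj[OF p(1), of "cyc3 0 1 2" 0 1] p that by simp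
  qed
  have flip: "defect n f i j = 0" if "f i = i \<or> f j = j" for i j
  proof -
    \<comment> \<open>At most one of \<open>i\<close> and \<open>j\<close> is moved;
      \<open>x\<close> is that one, or else any moved point. Exchanging the other two moved points
      \<open>y\<close> and \<open>z\<close> then fixes \<open>i\<close> and
      \<open>j\<close>.\<close>
    obtain x where x: "f x \<noteq> x" and xi: "f i \<noteq> i \<Longrightarrow> x = i" and xj: "f j \<noteq> j \<Longrightarrow> x = j"
    proof -
      obtain x y z where xyz: "distinct [x, y, z]" "f = cyc3 x y z"
        using f unfolding is3_iff by blast
      then have "f x \<noteq> x" by (auto simp: cyc3_apply)
      then show thesis using that \<open>f i = i \<or> f j = j\<close> by metis
    qed
    note can = is3_canonical[OF f x]
    define y z where "y = f x" and "z = f (f x)"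
    have d: "distinct [x, y, z]" unfolding y_def z_def by (rule can(2))
    have f3: "f = cyc3 x y z" unfolding y_def z_def by (rule can(1))
    have less: "y < n" "z < n" using can(3) fS unfolding y_def z_def by simp_all
    have yz: "f y \<noteq> y" "f z \<noteq> z" using d unfolding f3 cyc3_apply[OF d] by auto
    have "i \<notin> {y, z}" "j \<notin> {y, z}" using xi xj yz d by auto
    then have fix_ij: "transpose y z i = i" "transpose y z j = j" by auto
    have p: "transpose y z \<in> Sym n" by (rule Sym_transpose) (use less in auto)
    have "transpose y z \<circ> f \<circ> inv (transpose y z) = f \<circ> f"
    proof
      fix t
      show "(transpose y z \<circ> f \<circ> inv (transpose y z)) t = (f \<circ> f) t"
        unfolding f3 comp_apply inv_transpose_eq cyc3_apply[OF d] using d by (auto simp: transpose_def)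
    qed
    then have "defect n (inv f) i j = defect n f i j"
      using defect_conj[OF p fS, of i j] by (simp add: fix_ij is3_inv[OF f])
    then show ?thesis using defect_inv[OF fS, of i j] by simp
  qed
  show ?thesis
  proof (cases "f i = i \<or> f j = j")
    case True
    then show ?thesis using flip[OF True] om_fixed[OF fS] by auto
  next
    case False
    show ?thesis
    proof (cases "i = j")
      case True
      then show ?thesis using defect_alt[of n f i i] by (simp add: om_def)
    next
      case neq: False
      from is3_moved_pair[OF f _ _ neq] False consider "f i = j" | "f j = i" by blast
      then show ?thesis
      proof cases
        case 1
        have "f j \<noteq> i" using is3_canonical(2)[OF f, of i] False 1 by auto
        then have "om f i j = 1" using 1 by (simp add: om_def)
        then show ?thesis using both[OF 1] False by simp
      next
        case 2
        have "f i \<noteq> j" using is3_canonical(2)[OF f, of j] False 2 by auto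
        then have "om f i j = - 1" using 2 by (simp add: om_def)
        then show ?thesis using both[OF 2] False defect_alt[of n f i j] by simp
      qed
    qed
  qed
qed

text \<open>For an involution oddness suffices. Otherwise \<open>is3_comp_types\<close> leaves only
  disjoint factors: they commute, so the Hurwitz move merely swaps them and \<open>brac\<close>
  changes sign.\<close>

lemma defect_other:
  assumes f: "f \<in> Sym n" and not: "\<not> is3 n f" "\<not> is5 n f"
  shows "defect n f i j = 0"
proof (cases "f \<circ> f = id")
  case True
  then have "inv f = f" using f by (metis Sym_inv_eq_iff comp_apply eq_id_iff fun_eq_iff)
  then show ?thesis using defect_inv[OF f, of i j] by simp
next
  case False
  have disjoint: "g t = t \<or> h t = t" if "is3 n g" "is3 n h" "g \<circ> h = f" for g h t
    using is3_comp_types[OF that(1,2)] that(3) not False by blast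
  have "defect n f i j = factor_sum n f (brac i j)"
    unfolding defect_def
  proof (rule factor_sum_cong)
    fix g h assume "is3 n g" "is3 n h" "g \<circ> h = f"
    from disjoint[OF this] have "moved h k * moved g k = 0" for k
      by (auto simp: moved_def)
    then have "share n g h = 0"
      unfolding share_def by (intro sum.neutral) blast
    then show "brac i j g h - om h i j * share n g h = brac i j g h"
      by simp
  qed
  moreover have "factor_sum n f (brac i j) = - factor_sum n f (brac i j)"
  proof -
    have "factor_sum n f (brac i j) = factor_sum n f (\<lambda>g h. brac i j (g \<circ> h \<circ> inv g) g)"
      by (rule factor_sum_rotate[OF f])
    also have "\<dots> = factor_sum n f (\<lambda>g h. - brac i j g h)"
    proof (rule factor_sum_cong)
      fix g h assume gh: "is3 n g" "is3 n h" "g \<circ> h = f"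
      have gS: "g \<in> Sym n" using gh kcycle_Sym by blast
      have "g (h t) = h (g t)" for t
      proof (cases "g t = t")
        case True
        show ?thesis
        proof (cases "h t = t")
          case False
          then have "h (h t) \<noteq> h t" using kcycle_Sym[OF gh(2)] by simp
          then show ?thesis using disjoint[OF gh, of "h t"] True by simp
        qed (use True in simp)
      next
        case False
        then have "g (g t) \<noteq> g t" using gS by simp
        then show ?thesis using disjoint[OF gh, of "g t"] disjoint[OF gh, of t] False by simp
      qed
      then have "g \<circ> h = h \<circ> g" by (simp add: fun_eq_iff)
      then have "g \<circ> h \<circ> inv g = h" using gS by (simp add: comp_assoc)
      then show "brac i j (g \<circ> h \<circ> inv g) g = - brac i j g h"
        by (simp add: brac_def)
    qed
    finally show ?thesis by (simp add: factor_sum_uminus)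
  qed
  ultimately show ?thesis by simp
qed

section \<open>A representation in the group algebra\<close>

definition rep :: "nat \<Rightarrow> complex \<Rightarrow> complex \<Rightarrow> nat \<Rightarrow> (nat \<Rightarrow> nat) \<Rightarrow> complex" where
  "rep n d z i g = (if is3 n g then d * moved g i else 0) + z * of_bool (g = id)"

lemma is3_not_id: "is3 n g \<Longrightarrow> g \<noteq> id"
  unfolding is3_iff by (metis cyc3_apply distinct_length_2_or_more eq_id_iff)

lemma sum_moved_is3:
  assumes "is3 n h" shows "(\<Sum>k<n. moved h k) = 3"
proof -
  obtain x y z where d: "distinct [x, y, z]" "x < n" "y < n" "z < n" "h = cyc3 x y z"
    using assms unfolding is3_iff by blast
  have "(\<Sum>k<n. moved h k) = (\<Sum>k\<in>{x, y, z}. 1)"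
    by (rule sum.mono_neutral_cong_right) (use d in \<open>auto simp: moved_cyc3\<close>)
  then show ?thesis using d by simp
qed

lemma rep_conj:
  assumes "h \<in> Sym n"
  shows "rep n d z (h k) (h \<circ> g \<circ> inv h) = rep n d z k g"
proof -
  have "h \<circ> g \<circ> inv h = id \<longleftrightarrow> g = id"
  proof
    assume "h \<circ> g \<circ> inv h = id"
    then have "inv h \<circ> (h \<circ> g \<circ> inv h) \<circ> h = inv h \<circ> id \<circ> h" by simp
    then show "g = id" using assms by (simp add: fun_eq_iff)
  qed (use assms in simp)
  then show ?thesis
    unfolding rep_def kcycle_conj_iff[OF assms] moved_conj[OF assms] using assms by simp
qed

text \<open>The scalar \<open>z\<close> drops out of the commutator, but on the right it occurs once
  for each of the three points moved by a 3-cycle. So \<open>3 * d * z\<close> can make up the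
  difference between \<open>d^2\<close> times the reference defect and \<open>c\<close>; off the
  3-cycles the values of \<open>defect\<close> already agree with the constant part.\<close>

lemma rep_commutator:
  assumes f: "f \<in> Sym n" and "d \<noteq> 0"
    and z: "z = (d^2 * defect n (cyc3 0 1 2) 0 1 - c) / (3 * d)"
  shows "(\<Sum>h\<in>Sym n. rep n d z i (f \<circ> inv h) * rep n d z j h - rep n d z j (f \<circ> inv h) * rep n d z i h)
    = (\<Sum>h\<in>Sym n. \<Sum>k<n. famL n d 0 h i j k * rep n d z k (f \<circ> inv h)) + famC n d 0 c f i j"
proof -
  define A where "A i g = (if is3 n g then moved g i else 0)" for i g
  have X: "rep n d z i g = d * A i g + z * of_bool (g = id)" for i g
    by (simp add: rep_def A_def)
  have quot_id: "f \<circ> inv h = id \<longleftrightarrow> h = f" if "h \<in> Sym n" for h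
  proof
    assume "f \<circ> inv h = id"
    then have "f \<circ> inv h \<circ> h = h" by simp
    then show "h = f" using that by (simp add: comp_assoc)
  qed (use that in simp)
  have inv_id: "inv (id :: nat \<Rightarrow> nat) = id" by simp
  \<comment> \<open>The terms containing \<open>z\<close> sit at \<open>h = id\<close> and
    \<open>h = f\<close> and cancel.\<close>
  have "(\<Sum>h\<in>Sym n. rep n d z i (f \<circ> inv h) * rep n d z j h - rep n d z j (f \<circ> inv h) * rep n d z i h)
    = (\<Sum>h\<in>Sym n. d^2 * (if is3 n h \<and> is3 n (f \<circ> inv h) then brac i j (f \<circ> inv h) h else 0)
       + (if h = id then d * z * (A i (f \<circ> inv h) - A j (f \<circ> inv h)) else 0)
       + (if h = f then d * z * (A j h - A i h) else 0))"
  proof (intro sum.cong refl)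
    fix h assume h: "h \<in> Sym n"
    have "A i g * A j h - A j g * A i h = (if is3 n h \<and> is3 n g then brac i j g h else 0)" for g
      by (simp add: A_def brac_def)
    then have brac: "(if is3 n h \<and> is3 n (f \<circ> inv h) then brac i j (f \<circ> inv h) h else 0)
        = A i (f \<circ> inv h) * A j h - A j (f \<circ> inv h) * A i h" by (rule sym)
    have of_bool: "(if Q then t else 0) = t * of_bool Q" for Q and t :: complex by simp
    have "(d * p + z * e) * (d * q + z * e') - (d * p' + z * e) * (d * q' + z * e')
      = d^2 * (p * q - p' * q') + d * z * (p - p') * e' + d * z * (q - q') * e" for p q p' q' e e' :: complex
      by algebra
    then show "rep n d z i (f \<circ> inv h) * rep n d z j h - rep n d z j (f \<circ> inv h) * rep n d z i h =
       d^2 * (if is3 n h \<and> is3 n (f \<circ> inv h) then brac i j (f \<circ> inv h) h else 0)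
       + (if h = id then d * z * (A i (f \<circ> inv h) - A j (f \<circ> inv h)) else 0)
       + (if h = f then d * z * (A j h - A i h) else 0)"
      unfolding X quot_id[OF h] unfolding brac unfolding of_bool .
  qed
  also have "\<dots> = d^2 * factor_sum n f (brac i j) + d * z * (A i f - A j f) + d * z * (A j f - A i f)"
    using f by (simp add: sum.distrib sum_distrib_left[symmetric] factor_sum_def inv_id)
  finally have L: "(\<Sum>h\<in>Sym n. rep n d z i (f \<circ> inv h) * rep n d z j h - rep n d z j (f \<circ> inv h) * rep n d z i h)
    = d^2 * factor_sum n f (brac i j)" by (simp add: algebra_simps)
  have "(\<Sum>h\<in>Sym n. \<Sum>k<n. famL n d 0 h i j k * rep n d z k (f \<circ> inv h))
    = (\<Sum>h\<in>Sym n. d^2 * (if is3 n h \<and> is3 n (f \<circ> inv h) then om h i j * share n (f \<circ> inv h) h else 0)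
        + (if h = f then (if is3 n h then 3 * d * z * om h i j else 0) else 0))"
  proof (intro sum.cong refl)
    fix h assume h: "h \<in> Sym n"
    show "(\<Sum>k<n. famL n d 0 h i j k * rep n d z k (f \<circ> inv h))
      = d^2 * (if is3 n h \<and> is3 n (f \<circ> inv h) then om h i j * share n (f \<circ> inv h) h else 0)
        + (if h = f then (if is3 n h then 3 * d * z * om h i j else 0) else 0)"
    proof (cases "is3 n h")
      case True
      have "famL n d 0 h i j k * rep n d z k (f \<circ> inv h) = d^2 * om h i j * (moved h k * A k (f \<circ> inv h))
         + d * z * om h i j * of_bool (h = f) * moved h k" for k
        unfolding X quot_id[OF h] using True by (simp add: famL_def moved_def algebra_simps power2_eq_square)
      then have "(\<Sum>k<n. famL n d 0 h i j k * rep n d z k (f \<circ> inv h))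
        = d^2 * om h i j * (\<Sum>k<n. moved h k * A k (f \<circ> inv h)) + d * z * om h i j * of_bool (h = f) * (\<Sum>k<n. moved h k)"
        by (simp only: sum.distrib sum_distrib_left[symmetric])
      moreover have "(\<Sum>k<n. moved h k * A k (f \<circ> inv h)) = (if is3 n (f \<circ> inv h) then share n (f \<circ> inv h) h else 0)"
        by (simp add: A_def share_def)
      ultimately show ?thesis using True sum_moved_is3[OF True] by (cases "h = f") simp_all
    qed (auto simp: famL_def)
  qed
  also have "\<dots> = d^2 * factor_sum n f (\<lambda>g h. om h i j * share n g h) + (if is3 n f then 3 * d * z * om f i j else 0)"
    using f by (simp add: sum.distrib sum_distrib_left[symmetric] factor_sum_def)
  finally have R: "(\<Sum>h\<in>Sym n. \<Sum>k<n. famL n d 0 h i j k * rep n d z k (f \<circ> inv h))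
    = d^2 * factor_sum n f (\<lambda>g h. om h i j * share n g h) + (if is3 n f then 3 * d * z * om f i j else 0)" .
  have "d^2 * defect n f i j = (if is3 n f then 3 * d * z * om f i j else 0) + famC n d 0 c f i j"
  proof (cases "is3 n f")
    case True
    have "3 * d * z = d^2 * defect n (cyc3 0 1 2) 0 1 - c" using z \<open>d \<noteq> 0\<close> by simp
    then have "d^2 * (defect n (cyc3 0 1 2) 0 1 * om f i j) = 3 * d * z * om f i j + c * om f i j"
      by algebra
    then show ?thesis using True defect_is3[OF True, of i j] by (simp add: famC_def)
  next
    case False
    then show ?thesis
      using defect_is5[of n f i j] defect_other[OF f, of i j] by (auto simp: famC_def)
  qed
  then show ?thesis
    unfolding L R defect_def factor_sum_diff by (simp add: algebra_simps)
qed

lemma sum_Sym_pairs: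
  "(\<Sum>g\<in>Sym n. \<Sum>h\<in>Sym n. A g h * \<phi> (g \<circ> h)) = (\<Sum>f\<in>Sym n. (\<Sum>h\<in>Sym n. A (f \<circ> inv h) h) * (\<phi> f :: complex))"
proof -
  have "(\<Sum>g\<in>Sym n. \<Sum>h\<in>Sym n. A g h * \<phi> (g \<circ> h)) = (\<Sum>h\<in>Sym n. \<Sum>g\<in>Sym n. A g h * \<phi> (g \<circ> h))"
    by (rule sum.swap)
  also have "\<dots> = (\<Sum>f\<in>Sym n. \<Sum>h\<in>Sym n. A (f \<circ> inv h) h * \<phi> (f \<circ> inv h \<circ> h))"
    by (rule sum_Sym_product)
  also have "\<dots> = (\<Sum>f\<in>Sym n. (\<Sum>h\<in>Sym n. A (f \<circ> inv h) h) * \<phi> f)"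
    unfolding sum_distrib_right by (intro sum.cong refl) (simp add: comp_assoc)
  finally show ?thesis .
qed

lemma fam_Q3_reduced:
  assumes ijk: "i < n" "j < n" "k < n" "distinct [i, j, k]" and f: "f \<in> Sym n" and "d \<noteq> 0"
  shows "fam.Q3 n d 0 c i j k f = 0"
proof -
  define z where "z = (d^2 * defect n (cyc3 0 1 2) 0 1 - c) / (3 * d)"
  define x where "x = rep n d z"
  \<comment> \<open>Testing against an arbitrary \<open>\<phi>\<close> allows further factors on
    either side to be absorbed into \<open>\<phi>\<close>.\<close>
  have rel: "(\<Sum>g\<in>Sym n. \<Sum>h\<in>Sym n. (x i g * x j h - x j g * x i h) * \<phi> (g \<circ> h))
     = (\<Sum>h\<in>Sym n. (\<Sum>k<n. famL n d 0 h i j k * (\<Sum>g\<in>Sym n. x k g * \<phi> (g \<circ> h))) + famC n d 0 c h i j * \<phi> h)" for \<phi> i j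
  proof -
    have "(\<Sum>h\<in>Sym n. \<Sum>k<n. famL n d 0 h i j k * (\<Sum>g\<in>Sym n. x k g * \<phi> (g \<circ> h)))
      = (\<Sum>h\<in>Sym n. \<Sum>g\<in>Sym n. (\<Sum>k<n. famL n d 0 h i j k * x k g) * \<phi> (g \<circ> h))"
      by (intro sum.cong refl) (simp add: sum_distrib_left sum_distrib_right mult.assoc sum.swap[of _ "{..<n}" "Sym n"])
    also have "\<dots> = (\<Sum>g\<in>Sym n. \<Sum>h\<in>Sym n. (\<Sum>k<n. famL n d 0 h i j k * x k g) * \<phi> (g \<circ> h))"
      by (rule sum.swap)
    also have "\<dots> = (\<Sum>f\<in>Sym n. (\<Sum>h\<in>Sym n. \<Sum>k<n. famL n d 0 h i j k * x k (f \<circ> inv h)) * \<phi> f)"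
      by (rule sum_Sym_pairs)
    finally have "(\<Sum>h\<in>Sym n. (\<Sum>k<n. famL n d 0 h i j k * (\<Sum>g\<in>Sym n. x k g * \<phi> (g \<circ> h))) + famC n d 0 c h i j * \<phi> h)
      = (\<Sum>f\<in>Sym n. ((\<Sum>h\<in>Sym n. \<Sum>k<n. famL n d 0 h i j k * x k (f \<circ> inv h)) + famC n d 0 c f i j) * \<phi> f)"
      by (simp add: sum.distrib distrib_right)
    also have "\<dots> = (\<Sum>f\<in>Sym n. (\<Sum>h\<in>Sym n. x i (f \<circ> inv h) * x j h - x j (f \<circ> inv h) * x i h) * \<phi> f)"
      unfolding x_def by (intro sum.cong refl) (simp only: rep_commutator[OF _ \<open>d \<noteq> 0\<close> z_def])
    also have "\<dots> = (\<Sum>g\<in>Sym n. \<Sum>h\<in>Sym n. (x i g * x j h - x j g * x i h) * \<phi> (g \<circ> h))"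
      by (rule sum_Sym_pairs[symmetric])
    finally show ?thesis by simp
  qed
  define \<phi> :: "(nat \<Rightarrow> nat) \<Rightarrow> complex" where "\<phi> q = of_bool (q = f)" for q
  \<comment> \<open>The coefficient of \<open>f\<close> in the image of \<open>e_w h\<close> when
    \<open>e_m\<close> is sent to \<open>X_m\<close>. Words of more than two letters get a dummy
    value; they do not occur in \<open>jacobi_identity\<close>.\<close>
  define P where "P w h = (case w of [] \<Rightarrow> \<phi> h
     | [m] \<Rightarrow> \<Sum>g\<in>Sym n. x m g * \<phi> (g \<circ> h)
     | m # l # _ \<Rightarrow> \<Sum>g\<in>Sym n. \<Sum>g'\<in>Sym n. x m g * x l g' * \<phi> (g \<circ> g' \<circ> h))" for w h
  have P: "P [] h = \<phi> h" "P [m] h = (\<Sum>g\<in>Sym n. x m g * \<phi> (g \<circ> h))"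
    "P [m, l] h = (\<Sum>g\<in>Sym n. \<Sum>g'\<in>Sym n. x m g * x l g' * \<phi> (g \<circ> g' \<circ> h))" for m l h
    by (simp_all add: P_def)
  have respects: "P [m, l] h - P [l, m] h - fam.Kap n d 0 c P [] m l [] h = 0" for m l h
  proof -
    have "P [m, l] h - P [l, m] h = (\<Sum>g\<in>Sym n. \<Sum>g'\<in>Sym n. (x m g * x l g' - x l g * x m g') * \<phi> (g \<circ> g' \<circ> h))"
      by (simp add: P left_diff_distrib sum_subtractf)
    also have "\<dots> = fam.Kap n d 0 c P [] m l [] h"
      unfolding rel[of m l "\<lambda>q. \<phi> (q \<circ> h)"] by (simp add: fam.Kap_def P comp_assoc)
    finally show ?thesis by simp
  qed
  define T where "T i j k = (\<Sum>g\<in>Sym n. \<Sum>g'\<in>Sym n. \<Sum>g''\<in>Sym n. x i g * x j g' * x k g'' * \<phi> (g \<circ> g' \<circ> g''))" for i j k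
  \<comment> \<open>The image of \<open>\<kappa>(e_i,e_j) e_k\<close> is
    \<open>[X_i, X_j] X_k\<close>, because \<open>h X_k = X_(h k) h\<close>. Here
    \<open>T i j k\<close> is the coefficient of \<open>f\<close> in
    \<open>X_i X_j X_k\<close>.\<close>
  have right: "(\<Sum>h\<in>Sym n. (\<Sum>m<n. famL n d 0 h i j m * P [m, h k] h) + famC n d 0 c h i j * P [h k] h) = T i j k - T j i k" for i j k
  proof -
    define \<psi> where "\<psi> q = (\<Sum>g\<in>Sym n. x k g * \<phi> (q \<circ> g))" for q
    have shift: "(\<Sum>g'\<in>Sym n. x (h k) g' * \<phi> (q \<circ> (g' \<circ> h))) = \<psi> (q \<circ> h)" if "h \<in> Sym n" for h q
    proof -
      have "(\<Sum>g'\<in>Sym n. x (h k) g' * \<phi> (q \<circ> (g' \<circ> h)))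
         = (\<Sum>g\<in>Sym n. x (h k) (h \<circ> g \<circ> inv h) * \<phi> (q \<circ> (h \<circ> g \<circ> inv h \<circ> h)))"
        by (rule sum_Sym_conj[OF that])
      also have "\<dots> = (\<Sum>g\<in>Sym n. x k g * \<phi> (q \<circ> h \<circ> g))"
        unfolding x_def rep_conj[OF that] using that by (simp add: comp_assoc)
      finally show ?thesis by (simp add: \<psi>_def)
    qed
    have 1: "P [h k] h = \<psi> h" if "h \<in> Sym n" for h
      using shift[OF that, of id] by (simp add: P)
    have 2: "P [m, h k] h = (\<Sum>g\<in>Sym n. x m g * \<psi> (g \<circ> h))" if "h \<in> Sym n" for m h
      unfolding shift[OF that, symmetric] by (simp add: P sum_distrib_left mult.assoc comp_assoc)
    have "(\<Sum>h\<in>Sym n. (\<Sum>m<n. famL n d 0 h i j m * P [m, h k] h) + famC n d 0 c h i j * P [h k] h)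
      = (\<Sum>h\<in>Sym n. (\<Sum>m<n. famL n d 0 h i j m * (\<Sum>g\<in>Sym n. x m g * \<psi> (g \<circ> h))) + famC n d 0 c h i j * \<psi> h)"
      by (intro sum.cong refl) (simp add: 1 2)
    also have "\<dots> = (\<Sum>g\<in>Sym n. \<Sum>g'\<in>Sym n. (x i g * x j g' - x j g * x i g') * \<psi> (g \<circ> g'))"
      by (rule rel[symmetric])
    also have "\<dots> = T i j k - T j i k"
      unfolding T_def \<psi>_def by (simp add: sum_distrib_left left_diff_distrib sum_subtractf mult.assoc)
    finally show ?thesis .
  qed
  have left: "(\<Sum>h\<in>Sym n. (\<Sum>m<n. famL n d 0 h i j m * P [k, m] h) + famC n d 0 c h i j * P [k] h) = T k i j - T k j i" for i j k
  proof -
    have "(\<Sum>h\<in>Sym n. (\<Sum>m<n. famL n d 0 h i j m * P [k, m] h) + famC n d 0 c h i j * P [k] h)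
      = (\<Sum>h\<in>Sym n. \<Sum>q\<in>Sym n. x k q * ((\<Sum>m<n. famL n d 0 h i j m * (\<Sum>g\<in>Sym n. x m g * \<phi> (q \<circ> (g \<circ> h)))) + famC n d 0 c h i j * \<phi> (q \<circ> h)))"
    proof (intro sum.cong refl)
      fix h
      have "famL n d 0 h i j m * P [k, m] h = (\<Sum>q\<in>Sym n. x k q * (famL n d 0 h i j m * (\<Sum>g\<in>Sym n. x m g * \<phi> (q \<circ> (g \<circ> h)))))" for m
        by (simp add: P sum_distrib_left mult.assoc mult.left_commute comp_assoc)
      then have "(\<Sum>m<n. famL n d 0 h i j m * P [k, m] h) = (\<Sum>q\<in>Sym n. \<Sum>m<n. x k q * (famL n d 0 h i j m * (\<Sum>g\<in>Sym n. x m g * \<phi> (q \<circ> (g \<circ> h)))))"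
        by (simp add: sum.swap[of _ "{..<n}" "Sym n"])
      moreover have "famC n d 0 c h i j * P [k] h = (\<Sum>q\<in>Sym n. x k q * (famC n d 0 c h i j * \<phi> (q \<circ> h)))"
        by (simp add: P sum_distrib_left mult.left_commute)
      ultimately show "(\<Sum>m<n. famL n d 0 h i j m * P [k, m] h) + famC n d 0 c h i j * P [k] h
        = (\<Sum>q\<in>Sym n. x k q * ((\<Sum>m<n. famL n d 0 h i j m * (\<Sum>g\<in>Sym n. x m g * \<phi> (q \<circ> (g \<circ> h)))) + famC n d 0 c h i j * \<phi> (q \<circ> h)))"
        by (simp only: distrib_left sum_distrib_left sum.distrib)
    qed
    also have "\<dots> = (\<Sum>q\<in>Sym n. \<Sum>h\<in>Sym n. x k q * ((\<Sum>m<n. famL n d 0 h i j m * (\<Sum>g\<in>Sym n. x m g * \<phi> (q \<circ> (g \<circ> h)))) + famC n d 0 c h i j * \<phi> (q \<circ> h)))"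
      by (rule sum.swap)
    also have "\<dots> = (\<Sum>q\<in>Sym n. x k q * (\<Sum>g\<in>Sym n. \<Sum>h\<in>Sym n. (x i g * x j h - x j g * x i h) * \<phi> (q \<circ> (g \<circ> h))))"
      unfolding rel[of i j "\<lambda>g. \<phi> (_ \<circ> g)"] by (simp only: sum_distrib_left)
    also have "\<dots> = T k i j - T k j i"
      unfolding T_def by (simp add: sum_distrib_left left_diff_distrib right_diff_distrib sum_subtractf mult.assoc comp_assoc)
    finally show ?thesis .
  qed
  have "fam.Jac n d 0 c P i j k = 0"
  proof -
    \<comment> \<open>What is left is the double commutator \<open>[[X_i, X_j], X_k]\<close>, whose
      cyclic sum vanishes by associativity.\<close>
    have step: "(\<Sum>h\<in>Sym n. (\<Sum>m<n. famL n d 0 h i j m * (P [m, h k] h - P [k, m] h)) + famC n d 0 c h i j * (P [h k] h - P [k] h))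
      = (T i j k - T j i k) - (T k i j - T k j i)" for i j k
      unfolding right[symmetric] left[symmetric]
      by (simp add: right_diff_distrib sum_subtractf sum.distrib)
    show ?thesis unfolding fam.Jac_def step by simp
  qed
  then have "0 = (\<Sum>f\<in>Sym n. fam.Q3 n d 0 c i j k f * P [] f)"
    using fam.jacobi_identity[of n d 0 i j k c P] fam_Q1_sym fam_Q2_zero[OF ijk] ijk respects by simp
  also have "\<dots> = (\<Sum>q\<in>Sym n. if q = f then fam.Q3 n d 0 c i j k q else 0)"
    by (intro sum.cong) (auto simp: P \<phi>_def)
  finally show ?thesis using f by simp
qed

text \<open>Passing from \<open>(a, b)\<close> to \<open>(a - b, 0)\<close> changes the linear part
  by a multiple of the all-ones vector, which \<open>sum_famC\<close> annihilates. For
  \<open>a = b\<close> the linear part that remains is zero.\<close>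

lemma fam_Q3_zero:
  assumes ijk: "i < n" "j < n" "k < n" "distinct [i, j, k]" and f: "f \<in> Sym n"
  shows "fam.Q3 n a b c i j k f = 0"
proof -
  have inner: "(\<Sum>m<n. famL n a b h i j m * (famC n a b c g m (h k) + famC n a b c g m k))
    = (\<Sum>m<n. famL n (a - b) 0 h i j m * (famC n (a - b) 0 c g m (h k) + famC n (a - b) 0 c g m k))"
    if "h \<in> Sym n" "g \<in> Sym n" "k < n" for h g i j k
  proof -
    have C: "famC n a b c g m x = famC n (a - b) 0 c g m x" for m x by (simp add: famC_def)
    have "famL n a b h i j m * (famC n a b c g m (h k) + famC n a b c g m k)
      = famL n (a - b) 0 h i j m * (famC n (a - b) 0 c g m (h k) + famC n (a - b) 0 c g m k)
       + (if is3 n h then om h i j * b else 0) * (famC n a b c g m (h k) + famC n a b c g m k)" for m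
      unfolding C[symmetric] by (simp add: famL_def algebra_simps)
    then have "(\<Sum>m<n. famL n a b h i j m * (famC n a b c g m (h k) + famC n a b c g m k))
      = (\<Sum>m<n. famL n (a - b) 0 h i j m * (famC n (a - b) 0 c g m (h k) + famC n (a - b) 0 c g m k))
       + (if is3 n h then om h i j * b else 0) * ((\<Sum>m<n. famC n a b c g m (h k)) + (\<Sum>m<n. famC n a b c g m k))"
      by (simp only: sum.distrib sum_distrib_left distrib_left)
    then show ?thesis using sum_famC[of g n "h k" a b c] sum_famC[of g n k a b c] that by simp
  qed
  have "fam.Q3 n a b c i j k f = fam.Q3 n (a - b) 0 c i j k f"
    unfolding fam.Q3_def using f ijk by (simp add: inner cong: sum.cong)
  also have "\<dots> = 0"
  proof (cases "a - b = 0")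
    case True
    have "famL n 0 0 h i j m = 0" for h i j m by (simp add: famL_def)
    with True show ?thesis by (simp add: fam.Q3_def)
  next
    case False
    then show ?thesis by (rule fam_Q3_reduced[OF assms])
  qed
  finally show ?thesis .
qed

lemma fam_pbw: "pbw_cochain n (famL n a b) (famC n a b c)"
  by unfold_locales (simp_all only: famL_conj famC_conj fam_Q1_sym fam_Q2_zero fam_Q3_zero)

lemma fam_DOA: "DOA n (famL n a b) (famC n a b c)"
  using fam_pbw by (rule pbw_cochain.pbw)

section \<open>Classification\<close>

lemma is3_moved_iff:
  assumes "is3 n g" "g p \<noteq> p"
  shows "g t \<noteq> t \<longleftrightarrow> t \<in> {p, g p, g (g p)}"
  using is3_fixed[OF assms, of t] is3_canonical(2,4)[OF assms] by auto

lemma kapL_eq_famL: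
  assumes ij: "i \<noteq> j" "i < n" "j < n" and g: "g \<in> Sym n"
  shows "kapL n a b g i j k = famL n a b g i j k"
proof -
  let ?K = "{..<n} - {i, j}"
  have cyc: "is3 n (cyc3 i j k')" "cyc3 i j k' i = j" "cyc3 i j k' j = k'" "is3 n (cyc3 k' j i)" "cyc3 k' j i j = i" "cyc3 k' j i i = k'"
    if "k' \<in> ?K" for k'
    using that ij by (auto simp: cyc3_apply intro!: is3_cyc3)
  show ?thesis
  proof (cases "is3 n g \<and> g i \<noteq> i \<and> g j \<noteq> j")
    case True
    then have g3: "is3 n g" and gi: "g i \<noteq> i" and gj: "g j \<noteq> j" by auto
    from is3_moved_pair[OF g3 gi gj ij(1)] show ?thesis
    proof
      assume 1: "g i = j"
      have d: "distinct [i, j, g j]" and c: "g = cyc3 i j (g j)"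
        using is3_canonical(1,2)[OF g3 gi] unfolding 1 by blast+
      have "g j < n" using g ij by simp
      then have K: "g j \<in> ?K" using d by auto
      have "kapL n a b g i j k = (\<Sum>k'\<in>?K. if k' = g j then (if k \<in> {i, j, k'} then a else b) else 0)"
        unfolding kapL_def
      proof (intro sum.cong refl)
        fix k' assume k': "k' \<in> ?K"
        have "g = cyc3 i j k' \<longleftrightarrow> k' = g j" using c cyc[OF k'] by metis
        moreover have "g \<noteq> cyc3 k' j i" using cyc[OF k'] d by auto
        ultimately show "(if k \<in> {i, j, k'} then a else b) * (ind g (cyc3 i j k') - ind g (cyc3 k' j i))
          = (if k' = g j then (if k \<in> {i, j, k'} then a else b) else 0)"
          by (simp add: ind_def)
      qed
      also have "\<dots> = (if k \<in> {i, j, g j} then a else b)" using K by simp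
      also have "\<dots> = (if g k \<noteq> k then a else b)"
      proof -
        have "g k \<noteq> k \<longleftrightarrow> k \<in> {i, j, g j}"
          using is3_moved_iff[OF g3 gi, of k] unfolding 1 .
        then show ?thesis by simp
      qed
      also have "\<dots> = famL n a b g i j k"
      proof -
        have "om g i j = 1" using 1 d by (auto simp: om_def)
        then show ?thesis using g3 by (simp add: famL_def)
      qed
      finally show ?thesis .
    next
      assume 1: "g j = i"
      have d: "distinct [j, i, g i]" and c: "g = cyc3 j i (g i)"
        using is3_canonical(1,2)[OF g3 gj] unfolding 1 by blast+
      have rot: "cyc3 (g i) j i = cyc3 j i (g i)"
        using d by (auto simp: fun_eq_iff cyc3_apply)
      have "g i < n" using g ij by simp
      then have K: "g i \<in> ?K" using d by auto
      have "kapL n a b g i j k = (\<Sum>k'\<in>?K. if k' = g i then - (if k \<in> {i, j, k'} then a else b) else 0)"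
        unfolding kapL_def
      proof (intro sum.cong refl)
        fix k' assume k': "k' \<in> ?K"
        have "g = cyc3 k' j i \<longleftrightarrow> k' = g i" using c rot cyc[OF k'] by metis
        moreover have "g \<noteq> cyc3 i j k'" using cyc[OF k'] d by auto
        ultimately show "(if k \<in> {i, j, k'} then a else b) * (ind g (cyc3 i j k') - ind g (cyc3 k' j i))
          = (if k' = g i then - (if k \<in> {i, j, k'} then a else b) else 0)"
          by (simp add: ind_def)
      qed
      also have "\<dots> = - (if k \<in> {i, j, g i} then a else b)" using K by simp
      also have "\<dots> = - (if g k \<noteq> k then a else b)"
      proof -
        have "g k \<noteq> k \<longleftrightarrow> k \<in> {i, j, g i}"
          using is3_moved_iff[OF g3 gj, of k] unfolding 1 by blast
        then show ?thesis by simp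
      qed
      also have "\<dots> = famL n a b g i j k"
      proof -
        have "om g i j = - 1" using 1 d by (auto simp: om_def)
        then show ?thesis using g3 by (simp add: famL_def)
      qed
      finally show ?thesis .
    qed
  next
    case False
    then have "famL n a b g i j k = 0"
      using om_fixed[OF g] by (auto simp: famL_def)
    moreover have "g \<noteq> cyc3 i j k'" "g \<noteq> cyc3 k' j i" if k': "k' \<in> ?K" for k'
      using False cyc[OF k'] ij k' by auto
    then have "kapL n a b g i j k = 0"
      by (simp add: kapL_def ind_def)
    ultimately show ?thesis by simp
  qed
qed

lemma is5_inv:
  assumes "is5 n g" shows "is5 n (inv g)"
proof -
  obtain x0 x1 x2 x3 x4 where d: "distinct [x0, x1, x2, x3, x4]" and less: "x0 < n" "x1 < n" "x2 < n" "x3 < n" "x4 < n"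
    and g: "g = cyc5 x0 x1 x2 x3 x4"
    using assms unfolding is5_iff by blast
  have d': "distinct [x0, x4, x3, x2, x1]" using d by auto
  have "inv g = cyc5 x0 x4 x3 x2 x1"
  proof (rule inv_equality)
    show "cyc5 x0 x4 x3 x2 x1 (g t) = t" for t
      unfolding g cyc5_apply[OF d] cyc5_apply[OF d'] using d by auto
    show "g (cyc5 x0 x4 x3 x2 x1 t) = t" for t
      unfolding g cyc5_apply[OF d] cyc5_apply[OF d'] using d by auto
  qed
  then show ?thesis unfolding is5_iff using d' less by blast
qed

lemma is5_inv_iff: "g \<in> Sym n \<Longrightarrow> is5 n (inv g) \<longleftrightarrow> is5 n g"
  using is5_inv[of n g] is5_inv[of n "inv g"] by auto

lemma sum_ind_inv:
  assumes g: "g \<in> Sym n"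
  shows "(\<Sum>\<sigma>\<in>{\<sigma> \<in> Sym n. R \<sigma>}. ind g \<sigma> - ind g (inv \<sigma>)) = of_bool (R g) - of_bool (R (inv g))"
proof -
  let ?S = "{\<sigma> \<in> Sym n. R \<sigma>}"
  have "(\<Sum>\<sigma>\<in>?S. ind g \<sigma> - ind g (inv \<sigma>)) = (\<Sum>\<sigma>\<in>?S. if \<sigma> = g then 1 else 0) - (\<Sum>\<sigma>\<in>?S. if \<sigma> = inv g then 1 else 0)"
    unfolding sum_subtractf[symmetric]
  proof (intro sum.cong refl)
    fix \<sigma> assume \<sigma>: "\<sigma> \<in> ?S"
    have "g = inv \<sigma> \<longleftrightarrow> \<sigma> = inv g" using g \<sigma> by auto
    then show "ind g \<sigma> - ind g (inv \<sigma>) = (if \<sigma> = g then 1 else 0) - (if \<sigma> = inv g then 1 else 0)"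
      by (auto simp: ind_def)
  qed
  then show ?thesis using g by simp
qed

lemma kapC_eq_famC:
  assumes ij: "i \<noteq> j" "i < n" "j < n" and g: "g \<in> Sym n"
  shows "kapC n a b c g i j = famC n a b c g i j"
proof -
  \<comment> \<open>This sum is \<open>kapL\<close> with both coefficients equal to 1.\<close>
  have 3: "(\<Sum>k'\<in>{..<n} - {i, j}. ind g (cyc3 i j k') - ind g (cyc3 k' j i)) = (if is3 n g then om g i j else 0)"
    using kapL_eq_famL[OF assms, of 1 1 0] by (simp add: kapL_def famL_def)
  have inv: "inv g (inv g i) = j \<longleftrightarrow> g (g j) = i" "inv g i = j \<longleftrightarrow> g j = i"
    using g by (auto simp: Sym_inv_eq_iff)
  have 52: "(\<Sum>\<sigma>\<in>{\<sigma>\<in>Sym n. is5 n \<sigma> \<and> \<sigma> (\<sigma> i) = j}. 2 * (ind g \<sigma> - ind g (inv \<sigma>)))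
    = 2 * (of_bool (is5 n g \<and> g (g i) = j) - of_bool (is5 n g \<and> g (g j) = i))"
    unfolding sum_distrib_left[symmetric] sum_ind_inv[OF g] is5_inv_iff[OF g] inv ..
  have 51: "(\<Sum>\<sigma>\<in>{\<sigma>\<in>Sym n. is5 n \<sigma> \<and> \<sigma> i = j}. ind g \<sigma> - ind g (inv \<sigma>))
    = of_bool (is5 n g \<and> g i = j) - of_bool (is5 n g \<and> g j = i)"
    unfolding sum_ind_inv[OF g] is5_inv_iff[OF g] inv ..
  show ?thesis
    unfolding kapC_def 3 51 52 famC_def om5_def om_def
    using is5_not_is3[of n g] by (cases "is5 n g"; cases "is3 n g") auto
qed

lemma DOA_cong:
  assumes "\<And>g i j. g \<in> Sym n \<Longrightarrow> i < j \<Longrightarrow> j < n \<Longrightarrow> (\<forall>k<n. kL g i j k = kL' g i j k) \<and> kC g i j = kC' g i j"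
  shows "DOA n kL kC \<longleftrightarrow> DOA n kL' kC'"
proof -
  have "rel n kL kC i j = rel n kL' kC' i j" if "i < j" "j < n" for i j
  proof
    fix z
    have "(\<Sum>g\<in>Sym n. \<Sum>k<n. kL g i j k * bv [k] g z) = (\<Sum>g\<in>Sym n. \<Sum>k<n. kL' g i j k * bv [k] g z)"
      using assms[OF _ that] by (intro sum.cong refl) simp
    moreover have "(\<Sum>g\<in>Sym n. kC g i j * bv [] g z) = (\<Sum>g\<in>Sym n. kC' g i j * bv [] g z)"
      using assms[OF _ that] by (intro sum.cong refl) simp
    ultimately show "rel n kL kC i j z = rel n kL' kC' i j z" by (simp add: rel_def)
  qed
  then have "{rel n kL kC i j | i j. i < j \<and> j < n} = {rel n kL' kC' i j | i j. i < j \<and> j < n}"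
    by metis
  then show ?thesis by (simp add: DOA_def rel_ideal_def)
qed

text \<open>Applied twice: to the linear part, with \<open>q\<close> a coordinate of the vector, and
  to a difference of constant parts, with \<open>q\<close> a dummy. Choices of \<open>l\<close> in
  \<open>vec\<close> cut the support down to 3-cycles; invariance then transports the values from
  one reference cycle.\<close>

lemma alternating_forms_classification:
  fixes L :: "(nat \<Rightarrow> nat) \<Rightarrow> nat \<Rightarrow> nat \<Rightarrow> nat \<Rightarrow> complex"
  assumes n: "3 \<le> n"
    and alt: "\<And>g i j q. L g j i q = - L g i j q"
    and conj: "\<And>p g i j q. \<lbrakk>p \<in> Sym n; g \<in> Sym n; i < n; j < n; q < n\<rbrakk>
        \<Longrightarrow> L (p \<circ> g \<circ> inv p) (p i) (p j) (p q) = L g i j q"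
    and orb: "\<And>g i j q. \<lbrakk>g \<in> Sym n; i < n; j < n; q < n\<rbrakk> \<Longrightarrow> L g i j (g q) = L g i j q"
    and idz: "\<And>i j q. \<lbrakk>i < n; j < n; q < n\<rbrakk> \<Longrightarrow> L id i j q = 0"
    and vec: "\<And>g i j k l q. \<lbrakk>g \<in> Sym n; i < n; j < n; k < n; l < n; q < n; distinct [i, j, k]\<rbrakk>
        \<Longrightarrow> cyc (\<lambda>i j k. L g i j q * (of_bool (l = g k) - of_bool (l = k))) i j k = 0"
  shows "\<exists>a b. \<forall>g\<in>Sym n. \<forall>i<n. \<forall>j<n. \<forall>q<n. L g i j q = famL n a b g i j q"
proof -
  \<comment> \<open>Here \<open>i\<close> and \<open>k = g i\<close> form a 2-cycle without
    \<open>j\<close>. Testing at \<open>l = k\<close> gives \<open>L g j k q = L g i j q\<close>;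
    conjugation by the transposition of \<open>i\<close> and \<open>k\<close>, which centralises
    \<open>g\<close>, gives the opposite sign.\<close>
  have swap_zero: "L g i j q = 0"
    if g: "g \<in> Sym n" and less: "i < n" "j < n" "q < n" and ij: "i \<noteq> j"
      and sw: "g i \<noteq> i" "g (g i) = i" "g i \<noteq> j" for g i j q
  proof -
    define k where "k = g i"
    have k: "k < n" "k \<noteq> i" "k \<noteq> j" "g k = i" using g less sw by (auto simp: k_def)
    have kj: "k \<noteq> g j" using Sym_eq_iff[OF g, of i j] ij by (simp add: k_def)
    have 1: "L g j k q = L g i j q"
      using vec[of g i j k k q] g less k ij kj by (simp add: k_def)
    have p: "transpose i k \<in> Sym n" using less k by (intro Sym_transpose)
    have comm: "transpose i k (g t) = g (transpose i k t)" for t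
    proof -
      consider "t = i" | "t = k" | "t \<noteq> i" "t \<noteq> k" by blast
      then show ?thesis
      proof cases
        case 3
        then have "g t \<noteq> i" "g t \<noteq> k"
          using Sym_eq_iff[OF g, of t k] Sym_eq_iff[OF g, of t i] k by (auto simp: k_def)
        then show ?thesis using 3 by simp
      qed (use k in \<open>simp_all add: k_def\<close>)
    qed
    have "transpose i k \<circ> g \<circ> inv (transpose i k) = g"
      by (simp add: fun_eq_iff comm)
    then have "L g k j (transpose i k q) = L g i j q"
      using conj[OF p g less(1,2,3)] k ij by simp
    \<comment> \<open>The transposition moves \<open>q\<close> at most to \<open>g q\<close>, where
      \<open>orb\<close> applies.\<close>
    moreover have "L g k j (transpose i k q) = L g k j q"
    proof -
      consider "transpose i k q = g q" | "transpose i k q = q"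
        using k(4) unfolding transpose_def by (metis k_def)
      then show ?thesis using orb[OF g k(1) less(2,3)] by cases simp_all
    qed
    ultimately show ?thesis using 1 alt[of g k j q] by simp
  qed
  have is3: "is3 n g \<and> g i \<noteq> i \<and> g j \<noteq> j"
    if g: "g \<in> Sym n" and less: "i < n" "j < n" "q < n" and nz: "L g i j q \<noteq> 0" for g i j q
  proof -
    have ij: "i \<noteq> j" using nz alt[of g i i q] by auto
    have nz': "L g j i q \<noteq> 0" using nz alt[of g j i q] by simp
    \<comment> \<open>For any other moved \<open>k\<close>, the choice \<open>l = k\<close> leaves
      only the term \<open>- L g i j q\<close>.\<close>
    have moved: "k \<in> {i, j, g i, g j}" if "g k \<noteq> k" for k
    proof (rule ccontr)
      assume k: "k \<notin> {i, j, g i, g j}"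
      have "k < n" using that g by (auto simp: Sym_def permutes_def)
      then show False using vec[of g i j k k q] g less k ij nz that by auto
    qed
    \<comment> \<open>With \<open>i\<close> fixed only \<open>j\<close> and \<open>g j\<close> can
      be moved, so \<open>g\<close> would be the identity or a transposition.\<close>
    have mi: "g i \<noteq> i"
    proof
      assume i: "g i = i"
      show False
      proof (cases "g j = j")
        case True
        then have "g t = t" for t using moved[of t] i by auto
        then have "g = id" by (simp add: fun_eq_iff)
        then show False using idz[OF less] nz by simp
      next
        case False
        have "g (g j) \<noteq> g j" using False g by simp
        then have "g (g j) = j" using moved[of "g (g j)"] i g False by auto
        moreover have "g j \<noteq> i" using Sym_eq_iff[OF g, of j i] i ij by auto
        ultimately show False using swap_zero[OF g less(2,1,3)] ij False nz' by auto
      qed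
    qed
    have mj: "g j \<noteq> j"
    proof
      assume j: "g j = j"
      have "g (g i) \<noteq> g i" using mi g by simp
      then have "g (g i) = i" using moved[of "g (g i)"] j g mi by auto
      moreover have "g i \<noteq> j" using Sym_eq_iff[OF g, of i j] j ij by auto
      ultimately show False using swap_zero[OF g less] ij mi nz by auto
    qed
    have three: "is3 n g" if less: "i < n" "j < n" and ij: "i \<noteq> j" and gi: "g i = j" and gj: "g j \<noteq> i"
      and moved: "\<And>k. g k \<noteq> k \<Longrightarrow> k \<in> {i, j, g i, g j}" for i j
    proof -
      define k where "k = g j"
      have k: "k \<noteq> i" "k \<noteq> j" "k < n" using gj gi g ij less Sym_eq_iff[OF g, of i j] by (auto simp: k_def)
      have "g k \<noteq> k" "g k \<noteq> j" using k Sym_eq_iff[OF g, of k j] Sym_eq_iff[OF g, of k i] gi by (auto simp: k_def)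
      moreover have "g (g k) \<noteq> g k" using \<open>g k \<noteq> k\<close> g by simp
      ultimately have gk: "g k = i" using moved[of "g k"] gi by (auto simp: k_def)
      have "g = cyc3 i j k"
        by (rule cyc3_eqI) (use k ij gi gk moved in \<open>auto simp: k_def\<close>)
      then show ?thesis using is3_cyc3[of i j k n] k ij less by auto
    qed
    have "is3 n g"
    proof (cases "g i = j")
      case 1: True
      have "g j \<noteq> i"
      proof
        assume 2: "g j = i"
        \<comment> \<open>Conjugating \<open>g\<close> by itself exchanges \<open>i\<close> and
          \<open>j\<close> here, which contradicts alternation.\<close>
        have "g \<circ> g \<circ> inv g = g" using g by (simp add: comp_assoc)
        then have "L g j i (g q) = L g i j q" using conj[OF g g less] 1 2 by simp
        then show False using orb[OF g less(2,1,3)] alt[of g j i q] nz by simp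
      qed
      then show ?thesis using three[OF less(1,2) ij 1] moved by blast
    next
      case 1: False
      show ?thesis
      proof (cases "g j = i")
        case 2: True
        show ?thesis by (rule three[OF less(2,1) ij[symmetric] 2 1]) (use moved in blast)
      next
        case 2: False
        define k where "k = g i"
        have k: "k < n" "k \<noteq> i" "k \<noteq> j" "k \<noteq> g j"
          using g less mi 1 ij Sym_eq_iff[OF g, of i j] by (auto simp: k_def)
        have "g k \<noteq> k" "g k \<noteq> g j" using mi g k by (auto simp: k_def)
        moreover have "g (g k) \<noteq> g k" using \<open>g k \<noteq> k\<close> g by simp
        ultimately consider "g k = i" | "g k = j" using moved[of "g k"] by (auto simp: k_def)
        then show ?thesis
        proof cases
          case 3: 1
          then show ?thesis using swap_zero[OF g less ij mi] 1 nz by (simp add: k_def)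
        next
          case 3: 2
          \<comment> \<open>Now \<open>g\<close> sends \<open>i\<close> to \<open>k\<close>,
            \<open>k\<close> to \<open>j\<close>, and \<open>j\<close> elsewhere than
            \<open>i\<close>. Testing at \<open>l = k\<close> and at \<open>l = i\<close> gives
            contradictory values.\<close>
          have "L g j k q = L g i j q"
            using vec[of g i j k k q] g less k ij by (simp add: k_def)
          moreover have "L g j k q = 0"
            using vec[of g i j k i q] g less k ij 3 mi 2 by (simp add: k_def)
          ultimately show ?thesis using nz by simp
        qed
      qed
    qed
    then show ?thesis using mi mj by simp
  qed
  define c where "c = cyc3 0 1 2"
  have dc: "distinct [0, 1, 2::nat]" by simp
  have c: "c \<in> Sym n" unfolding c_def by (rule kcycle_Sym, rule is3_cyc3) (use n in auto)
  define a where "a = L c 0 1 0"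
  \<comment> \<open>For \<open>n = 3\<close> this is a junk value, harmless because \<open>c\<close>
    moves every \<open>q < 3\<close>.\<close>
  define b where "b = L c 0 1 3"
  have base: "L c 0 1 q = (if q \<in> {0, 1, 2} then a else b)" if q: "q < n" for q
  proof -
    have "c 0 = 1" "c 1 = 2" unfolding c_def cyc3_apply[OF dc] by simp_all
    then have "L c 0 1 1 = a" "L c 0 1 2 = a"
      using orb[OF c, of 0 1 0] orb[OF c, of 0 1 1] n by (simp_all add: a_def)
    moreover have "L c 0 1 q = b" if "q \<notin> {0, 1, 2}"
    proof -
      \<comment> \<open>This transposition centralises \<open>c\<close>, so all coordinates fixed by
        \<open>c\<close> carry the same value.\<close>
      let ?p = "transpose 3 q"
      have "3 < n" using that q by auto
      then have p: "?p \<in> Sym n" using q by (intro Sym_transpose)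
      have fixed: "?p 0 = 0" "?p 1 = 1" "?p 2 = 2" using that by (auto simp: transpose_def)
      have "?p \<circ> c \<circ> inv ?p = c"
        unfolding c_def cyc3_def using conjugation_of_cycle[OF dc Sym_bij[OF p]] fixed by simp
      then show ?thesis using conj[OF p c, of 0 1 3] fixed n \<open>3 < n\<close> by (simp add: b_def)
    qed
    ultimately show ?thesis by (auto simp: a_def)
  qed
  have cycle: "L g i j q = (if g q \<noteq> q then a else b)"
    if g3: "is3 n g" and gi: "g i \<noteq> i" "g i = j" and q: "q < n" for g i j q
  proof -
    have gS: "g \<in> Sym n" using g3 by (rule kcycle_Sym)
    note can = is3_canonical[OF g3 gi(1)]
    have "g i < n" "g (g i) < n" using can(3) gS by simp_all
    then obtain p where p: "p \<in> Sym n" "p 0 = i" "p 1 = g i" "p 2 = g (g i)"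
      using exists_Sym_three[of 0 1 2 i "g i" "g (g i)" n] can(2,3) n by auto
    have "p \<circ> c \<circ> inv p = cyc3 i (g i) (g (g i))"
      unfolding c_def cyc3_def using conjugation_of_cycle[OF dc Sym_bij[OF p(1)]] p by simp
    also have "\<dots> = g" by (rule can(1)[symmetric])
    finally have g: "p \<circ> c \<circ> inv p = g" .
    have "L (p \<circ> c \<circ> inv p) (p 0) (p 1) (p (inv p q)) = L c 0 1 (inv p q)"
      by (rule conj) (use p c q n in simp_all)
    then have "L g i j q = L c 0 1 (inv p q)"
      unfolding g using p gi by simp
    also have "\<dots> = (if inv p q \<in> {0, 1, 2} then a else b)" using base p q by simp
    also have "inv p q \<in> {0, 1, 2} \<longleftrightarrow> c (inv p q) \<noteq> inv p q"
      unfolding c_def cyc3_apply[OF dc] by auto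
    also have "\<dots> \<longleftrightarrow> g q \<noteq> q"
    proof -
      have "g q = p (c (inv p q))" using g by auto
      then show ?thesis using p by (metis Sym_inv_apply)
    qed
    finally show ?thesis .
  qed
  show ?thesis
  proof (intro exI ballI allI impI)
    fix g i j q assume g: "g \<in> Sym n" and less: "i < n" "j < n" "q < n"
    show "L g i j q = famL n a b g i j q"
    proof (cases "is3 n g \<and> g i \<noteq> i \<and> g j \<noteq> j \<and> i \<noteq> j")
      case False
      have "L g i j q = 0"
        using False is3[OF g less] alt[of g i i q] by auto
      moreover have "famL n a b g i j q = 0"
        using False om_fixed[OF g] by (auto simp: famL_def om_def[of g j j])
      ultimately show ?thesis by simp
    next
      case True
      then have g3: "is3 n g" by simp
      from True is3_moved_pair[OF g3] consider "g i = j" | "g j = i" by blast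
      then show ?thesis
      proof cases
        case 1
        have "om g i j = 1" using 1 True is3_canonical(2)[OF g3, of i] by (auto simp: om_def)
        then show ?thesis using cycle[OF g3 _ 1 less(3)] True by (simp add: famL_def)
      next
        case 2
        have "om g i j = - 1" using 2 True is3_canonical(2)[OF g3, of j] by (auto simp: om_def)
        then show ?thesis using cycle[OF g3 _ 2 less(3)] True alt[of g i j q] by (simp add: famL_def)
      qed
    qed
  qed
qed

text \<open>Over a full period the orbit of \<open>m\<close> visits \<open>h k\<close> and
  \<open>k\<close> equally often, with a shift by one step.\<close>

lemma sum_orbit_telescope:
  fixes m k :: nat
  assumes "h \<in> Sym n" "(h ^^ N) = id"
  shows "(\<Sum>t<N. of_bool ((h ^^ t) m = h k) - of_bool ((h ^^ t) m = k)) = (0::complex)"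
proof (cases N)
  case (Suc N')
  define a where "a t = (of_bool ((h ^^ t) m = h k) :: complex)" for t
  have "of_bool ((h ^^ t) m = k) = a (Suc t)" for t
    using assms(1) by (simp add: a_def)
  then have "(\<Sum>t<N. of_bool ((h ^^ t) m = h k) - of_bool ((h ^^ t) m = k)) = (\<Sum>t<N. a t - a (Suc t))"
    by (simp add: a_def[symmetric])
  also have "\<dots> = a 0 - a N" by (simp add: sum_lessThan_telescope')
  also have "\<dots> = 0" using assms(2) by (simp add: a_def)
  finally show ?thesis .
qed simp

lemma converse_classification:
  assumes n: "3 \<le> n" and DOA: "DOA n kL kC" and fixed: "fixed_image n kL" and off: "off_identity n kL"
  shows "\<exists>a b c. \<forall>g\<in>Sym n. \<forall>i j. i < j \<and> j < n \<longrightarrow>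
     (\<forall>k<n. kL g i j k = kapL n a b g i j k) \<and> kC g i j = kapC n a b c g i j"
proof -
  define KL where "KL g i j k = (if i < j then kL g i j k else if j < i then - kL g j i k else 0)" for g and i j :: nat and k
  define KC where "KC g i j = (if i < j then kC g i j else if j < i then - kC g j i else 0)" for g and i j :: nat
  have "DOA n KL KC"
    using DOA_cong[of n kL KL kC KC] DOA by (simp add: KL_def KC_def)
  then interpret drinfeld_cochain n KL KC
    by unfold_locales (auto simp: KL_def KC_def)
  have orb: "KL g i j (g q) = KL g i j q" if "g \<in> Sym n" "i < n" "j < n" "q < n" for g i j q
    using fixed that unfolding fixed_image_def KL_def by simp
  have orb_pow: "KL g i j ((g ^^ t) q) = KL g i j q" if "g \<in> Sym n" "i < n" "j < n" "q < n" for g i j q t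
  proof (induction t)
    case (Suc t)
    have "(g ^^ t) q < n" using that by (induction t) simp_all
    then show ?case using orb[OF that(1-3), of "(g ^^ t) q"] Suc by simp
  qed simp
  have idz: "KL id i j q = 0" if "i < n" "j < n" "q < n" for i j q
    using off that unfolding off_identity_def KL_def by simp
  have vec: "cyc (\<lambda>i j k. KL g i j q * (of_bool (l = g k) - of_bool (l = k))) i j k = 0"
    if g: "g \<in> Sym n" and ijk: "i < n" "j < n" "k < n" and lq: "l < n" "q < n" for g i j k l q
  proof -
    have "permutation g" using g by (auto simp: Sym_def permutation_permutes)
    then obtain N where N: "(g ^^ N) = id" "N > 0" by (rule permutation_is_nilpotent)
    \<comment> \<open>With \<open>m = ?x t\<close> in the symmetrised \<open>Q1\<close>, orbit
      invariance makes the first half independent of \<open>t\<close>, and over a full period the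
      second half sums to zero.\<close>
    let ?x = "\<lambda>t. (g ^^ t) q"
    have x: "?x t < n" for t using g lq by (induction t) simp_all
    define V where "V = cyc (\<lambda>i j k. KL g i j q * (of_bool (l = g k) - of_bool (l = k))) i j k"
    have "V + cyc (\<lambda>i j k. KL g i j l * (of_bool (?x t = g k) - of_bool (?x t = k))) i j k = 0" for t
    proof -
      have "Q1 i j k g (?x t) l + Q1 i j k g l (?x t) = 0"
        by (rule Q1_symmetric) (use g ijk lq x in auto)
      then show ?thesis
        unfolding Q1_def V_def using orb_pow[OF g _ _ lq(2)] ijk by (simp add: algebra_simps)
    qed
    then have "0 = (\<Sum>t<N. V + cyc (\<lambda>i j k. KL g i j l * (of_bool (?x t = g k) - of_bool (?x t = k))) i j k)"
      by simp
    also have "\<dots> = of_nat N * V + cyc (\<lambda>i j k. KL g i j l * (\<Sum>t<N. of_bool (?x t = g k) - of_bool (?x t = k))) i j k"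
      by (simp only: sum.distrib sum_distrib_left sum_constant card_lessThan)
    finally have "V = 0"
      using N(2) unfolding sum_orbit_telescope[OF g N(1)] by simp
    then show ?thesis by (simp only: V_def)
  qed
  have "\<exists>a b. \<forall>g\<in>Sym n. \<forall>i<n. \<forall>j<n. \<forall>q<n. KL g i j q = famL n a b g i j q"
  proof (rule alternating_forms_classification[of n KL])
    show "KL g j i q = - KL g i j q" for g i j q by (rule KL_alt)
    show "KL (p \<circ> g \<circ> inv p) (p i) (p j) (p q) = KL g i j q"
      if "p \<in> Sym n" "g \<in> Sym n" "i < n" "j < n" "q < n" for p g i j q
      using that by (rule conj_invariance(1))
    show "cyc (\<lambda>i j k. KL g i j q * (of_bool (l = g k) - of_bool (l = k))) i j k = 0"
      if "g \<in> Sym n" "i < n" "j < n" "k < n" "l < n" "q < n" for g i j k l q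
      using that by (rule vec)
  qed (use n orb idz in simp_all)
  then obtain a b where L: "\<And>g i j q. \<lbrakk>g \<in> Sym n; i < n; j < n; q < n\<rbrakk> \<Longrightarrow> KL g i j q = famL n a b g i j q"
    by blast
  \<comment> \<open>Both constant parts belong to the same linear part, so their difference solves
    the homogeneous equation; \<open>q\<close> is a dummy coordinate.\<close>
  define D where "D g i j (q :: nat) = KC g i j - famC n a b 0 g i j" for g i j q
  have D_alt: "D g j i q = - D g i j q" for g i j q
    using KC_alt[of g j i] fam.KC_alt[of n a b 0 g j i] by (simp add: D_def)
  have D_conj: "D (p \<circ> g \<circ> inv p) (p i) (p j) (p q) = D g i j q"
    if "p \<in> Sym n" "g \<in> Sym n" "i < n" "j < n" for p g i j q
    using conj_invariance(2)[OF that] famC_conj[OF that(1)] by (simp add: D_def)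
  \<comment> \<open>The identity is central, so conjugation by the transposition of \<open>i\<close>
    and \<open>j\<close> shows that the alternating form \<open>D id\<close> is also
    symmetric.\<close>
  have D_id: "D id i j q = 0" if "i < n" "j < n" for i j q
  proof -
    have p: "transpose i j \<in> Sym n" using that by (intro Sym_transpose)
    have "D id j i q = D id i j q"
      using D_conj[OF p Sym_id that, of q] by (simp add: D_def)
    then show ?thesis using D_alt[of id j i q] by simp
  qed
  have D_vec: "cyc (\<lambda>i j k. D f i j q * (of_bool (l = f k) - of_bool (l = k))) i j k = 0"
    if f: "f \<in> Sym n" and ijk: "i < n" "j < n" "k < n" and l: "l < n" and d: "distinct [i, j, k]" for f i j k l q
  proof -
    have "(\<Sum>h\<in>Sym n. \<Sum>m<n. KL h i j m * (KL (f \<circ> inv h) m (h k) l + KL (f \<circ> inv h) m k l))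
      = (\<Sum>h\<in>Sym n. \<Sum>m<n. famL n a b h i j m * (famL n a b (f \<circ> inv h) m (h k) l + famL n a b (f \<circ> inv h) m k l))"
      if "i < n" "j < n" "k < n" for i j k
      using that f l by (intro sum.cong refl) (simp add: L)
    note sums = this[OF ijk] this[OF ijk(2,3,1)] this[OF ijk(3,1,2)]
    \<comment> \<open>The terms \<open>s1\<close>, \<open>s2\<close>, \<open>s3\<close>, quadratic
      in the linear part, are common to both equations and cancel.\<close>
    have "(k1 - c1) * e1 + (k2 - c2) * e2 + (k3 - c3) * e3 = 0"
      if "(s1 + 2 * k1 * e1) + (s2 + 2 * k2 * e2) + (s3 + 2 * k3 * e3) = 0"
        "(s1 + 2 * c1 * e1) + (s2 + 2 * c2 * e2) + (s3 + 2 * c3 * e3) = 0"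
      for s1 s2 s3 k1 k2 k3 c1 c2 c3 e1 e2 e3 :: complex
    proof -
      have "2 * ((k1 - c1) * e1 + (k2 - c2) * e2 + (k3 - c3) * e3) = 0"
        using that by algebra
      then show ?thesis by (simp only: mult_eq_0_iff) simp
    qed
    from this[OF Q2_zero[OF ijk f l, unfolded Q2_def sums] fam_Q2_zero[OF ijk d f, of a b 0 l, unfolded fam.Q2_def]]
    show ?thesis unfolding D_def .
  qed
  have "\<exists>c b'. \<forall>g\<in>Sym n. \<forall>i<n. \<forall>j<n. \<forall>q<n. D g i j q = famL n c b' g i j q"
  proof (rule alternating_forms_classification[of n D])
    show "D g i j (g q) = D g i j q" for g i j q by (simp add: D_def)
    show "D (p \<circ> g \<circ> inv p) (p i) (p j) (p q) = D g i j q"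
      if "p \<in> Sym n" "g \<in> Sym n" "i < n" "j < n" for p g i j q
      using that by (rule D_conj)
    show "D id i j q = 0" if "i < n" "j < n" for i j q
      using that by (rule D_id)
    show "cyc (\<lambda>i j k. D g i j q * (of_bool (l = g k) - of_bool (l = k))) i j k = 0"
      if "g \<in> Sym n" "i < n" "j < n" "k < n" "l < n" "distinct [i, j, k]" for g i j k l q
      using that by (rule D_vec)
    show "D g j i q = - D g i j q" for g i j q by (rule D_alt)
  qed (rule n)
  then obtain c b' where C: "\<And>g i j q. \<lbrakk>g \<in> Sym n; i < n; j < n; q < n\<rbrakk> \<Longrightarrow> D g i j q = famL n c b' g i j q"
    by blast
  have KC: "KC g i j = famC n a b c g i j" if "g \<in> Sym n" "i < n" "j < n" for g i j
  proof -
    \<comment> \<open>At \<open>q = i\<close> the coefficient is \<open>c\<close> whenever the form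
      is nonzero, since \<open>om\<close> vanishes if \<open>g\<close> fixes
      \<open>i\<close>.\<close>
    have "famL n c b' g i j i = (if is3 n g then c * om g i j else 0)"
      using om_fixed(1)[OF that(1), of i j] by (simp add: famL_def)
    then have "KC g i j = famC n a b 0 g i j + (if is3 n g then c * om g i j else 0)"
      using C[OF that that(2)] by (simp add: D_def algebra_simps)
    then show ?thesis by (simp add: famC_def)
  qed
  show ?thesis
  proof (intro exI ballI allI impI)
    fix g i j assume g: "g \<in> Sym n" and "i < j \<and> j < n"
    then have ij: "i < j" "i < n" "j < n" "i \<noteq> j" by auto
    have "kL g i j k = kapL n a b g i j k" if "k < n" for k
      using L[OF g ij(2,3) that] kapL_eq_famL[OF ij(4,2,3) g] ij by (simp add: KL_def)
    moreover have "kC g i j = kapC n a b c g i j"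
      using KC[OF g ij(2,3)] kapC_eq_famC[OF ij(4,2,3) g] ij by (simp add: KC_def)
    ultimately show "(\<forall>k<n. kL g i j k = kapL n a b g i j k) \<and> kC g i j = kapC n a b c g i j" by blast
  qed
qed

theorem theorem3p2:
  fixes n :: nat
  assumes "n \<ge> 3"
  shows "(\<forall>a b c. DOA n (kapL n a b) (kapC n a b c))
       \<and> (\<forall>a b. fixed_image n (kapL n a b) \<and> off_identity n (kapL n a b))
       \<and> (\<forall>kL kC. DOA n kL kC \<and> fixed_image n kL \<and> off_identity n kL \<longrightarrow>
            (\<exists>a b c. \<forall>g\<in>Sym n. \<forall>i j. i < j \<and> j < n \<longrightarrow>
                 (\<forall>k<n. kL g i j k = kapL n a b g i j k) \<and> kC g i j = kapC n a b c g i j))"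
proof (intro conjI allI impI)
  fix a b c
  show "DOA n (kapL n a b) (kapC n a b c)"
    using fam_DOA[of n a b c] by (subst DOA_cong) (simp_all add: kapL_eq_famL kapC_eq_famC)
next
  fix a b
  show "fixed_image n (kapL n a b)"
    unfolding fixed_image_def by (auto simp: kapL_eq_famL famL_def)
  show "off_identity n (kapL n a b)"
    unfolding off_identity_def using is3_not_id[of n id] by (auto simp: kapL_eq_famL famL_def)
next
  fix kL kC assume "DOA n kL kC \<and> fixed_image n kL \<and> off_identity n kL"
  then show "\<exists>a b c. \<forall>g\<in>Sym n. \<forall>i j. i < j \<and> j < n \<longrightarrow>
                 (\<forall>k<n. kL g i j k = kapL n a b g i j k) \<and> kC g i j = kapC n a b c g i j"
    using converse_classification[OF assms] by blast
qed

end
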